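(* Let $T>0$. Assume that $\Gamma$ satisfies Hypothesis A (stated in the context). Let $Z=\{Z(t,x),(t,x)\in[0,T]\times\mathbb{R}^d\}$ be a predictable process such that $$C_Z:=\sup_{(t,x)\in[0,T]\times\mathbb{R}^d}E(|Z(t,x)|^2)<\infty .$$ Then the random element $G=G(t,dx)=Z(t,x)\Gamma(t,dx)$ is a predictable process in the space $L^2(\Omega\times[0,T];\mathcal{H})$.
   Context: Let $d\ge 1$. $f$ is a non-negative continuous function on $\mathbb{R}^d\setminus\{0\}$ which is the Fourier transform of a non-negative tempered measure $\mu$ on $\mathbb{R}^d$, i.e. $f(x)=\int_{\mathbb{R}^d}e^{-2\pi i x\cdot\xi}\mu(d\xi)$, and there is an integer $m\ge1$ with $\int_{\mathbb{R}^d}(1+|\xi|^2)^{-m}\mu(d\xi)<\infty$. The Fourier transform on $\mathbb{R}^d$ is $\mathcal{F}\varphi(\xi)=\int_{\mathbb{R}^d} e^{-2\pi i x\cdot\xi}\varphi(x)\,dx$ (similarly for finite measures). $\mathcal{H}$ denotes the completion of the Schwartz space $\mathcal{S}(\mathbb{R}^d)$ under the inner product $$\langle\varphi,\psi\rangle_{\mathcal{H}}=\int_{\mathbb{R}^d}\int_{\mathbb{R}^d}\varphi(x)f(x-y)\psi(y)\,dx\,dy=\int_{\mathbb{R}^d}\mathcal{F}\varphi(\xi)\overline{\mathcal{F}\psi(\xi)}\,\mu(d\xi).$$ $\mathcal{H}$ may contain distributions. Set $\mathcal{H}_T=L^2([0,T];\mathcal{H})$. Noise: on a complete probability space $(\Omega,\mathcal{F},P)$,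 $W=\{W(\varphi)\}$ is a zero mean Gaussian family indexed by $\varphi\in\mathcal{C}_0^\infty(\mathbb{R}^{d+1})$ with covariance $E(W(\varphi)W(\psi))=\int_0^\infty\int_{\mathbb{R}^d}\int_{\mathbb{R}^d}\varphi(t,x)f(x-y)\psi(t,y)\,dx\,dy\,dt$; restricted to $[0,T]$ it extends by isometry to a Gaussian family $\{W(g),g\in\mathcal{H}_T\}$ with $E(W(g_1)W(g_2))=\langle g_1,g_2\rangle_{\mathcal{H}_T}$. Put $W_t(h)=W(1_{[0,t]}h)$ for $h\in\mathcal{H}$. Let $\mathcal{F}_t$ be the $\sigma$-field generated by $\{W_s(h):h\in\mathcal{H},0\le s\le t\}$ and the $P$-null sets. The predictable $\sigma$-field on $\Omega\times[0,T]$ is generated by the sets $A\times(s,t]$ with $0\le s<t\le T$, $A\in\mathcal{F}_s$; predictability of a random field $\{Z(t,x)\}$ is meant jointly with Borel measurability in $x$. Hypothesis A: $\Gamma$, the fundamental solution of $Lu=0$ for a second order differential operator $L$ (on $t\ge0$, $x\in\mathbb{R}^d$), is a non-negative measure of the form $\Gamma(t,dx)\,dt$ such that for all $T>0$, $$\sup_{0\le t\le T}\Gamma(t,\mathbb{R}^d)\le C_T<\infty\quad\text{and}\quad \int_0^T\int_{\mathbb{R}^d}|\mathcal{F}\Gamma(t)(\xi)|^2\,\mu(d\xi)\,dt<\infty .$$ $G$ is regarded as an element $\widetilde G$ of $L^2(\Omega\times[0,T];\mathcal{H})$ through the identification $E\big(\mathbf 1_B\int_s^t\langle\widetilde G(r),\varphi\rangle_{\mathcal{H}}dr\big)=E\big(\mathbf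 1_B\int_s^t\int_{\mathbb{R}^d}\int_{\mathbb{R}^d}\Gamma(r,dx)Z(r,x)f(x-y)\varphi(y)\,dy\,dr\big)$ for all $\varphi\in\mathcal{S}(\mathbb{R}^d)$, $0\le s<t\le T$ and $B\in\mathcal{F}_s$. *)

theory Defs
  imports "HOL-Probability.Probability"
begin

definition partial_deriv ::
  "'a::euclidean_space \<Rightarrow> ('a \<Rightarrow> 'b::real_normed_vector) \<Rightarrow> 'a \<Rightarrow> 'b" where
  "partial_deriv v \<phi> x = frechet_derivative \<phi> (at x) v"

definition iter_partial_deriv ::
  "'a::euclidean_space list \<Rightarrow> ('a \<Rightarrow> 'b::real_normed_vector) \<Rightarrow> 'a \<Rightarrow> 'b" where
  "iter_partial_deriv vs \<phi> = foldr partial_deriv vs \<phi>"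

definition smooth_function :: "('a::euclidean_space \<Rightarrow> 'b::real_normed_vector) \<Rightarrow> bool" where
  "smooth_function \<phi> \<longleftrightarrow>
     (\<forall>vs x. set vs \<subseteq> Basis \<longrightarrow> iter_partial_deriv vs \<phi> differentiable (at x))"

definition test_function :: "('a::euclidean_space \<Rightarrow> 'b::real_normed_vector) \<Rightarrow> bool" where
  "test_function \<phi> \<longleftrightarrow> smooth_function \<phi> \<and> compact (closure {x. \<phi> x \<noteq> 0})"

definition schwartz :: "('a::euclidean_space \<Rightarrow> 'b::real_normed_vector) \<Rightarrow> bool" where
  "schwartz \<phi> \<longleftrightarrow> smooth_function \<phi> \<and>
     (\<forall>(k::nat) vs. set vs \<subseteq> Basis \<longrightarrow>
        bounded (range (\<lambda>x. norm x ^ k *\<^sub>R iter_partial_deriv vs \<phi> x)))"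

definition fourier :: "('a::euclidean_space \<Rightarrow> complex) \<Rightarrow> 'a \<Rightarrow> complex" where
  "fourier \<phi> \<xi> = (LINT x|lborel. exp (- (2 * of_real pi * \<i> * of_real (x \<bullet> \<xi>))) * \<phi> x)"

definition fourier_measure :: "'a::euclidean_space measure \<Rightarrow> 'a \<Rightarrow> complex" where
  "fourier_measure M \<xi> = (LINT x|M. exp (- (2 * of_real pi * \<i> * of_real (x \<bullet> \<xi>))))"

definition tempered_measure :: "'a::euclidean_space measure \<Rightarrow> bool" where
  "tempered_measure \<mu> \<longleftrightarrow> sets \<mu> = sets borel \<and>
     (\<exists>m::nat. 1 \<le> m \<and> (\<integral>\<^sup>+ \<xi>. ennreal (1 / (1 + (norm \<xi>)\<^sup>2) ^ m) \<partial>\<mu>) < \<infinity>)"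

text \<open>
  Since \<open>\<mu>\<close> may be infinite, \<open>f(x) = \<integral> exp(- 2 \<pi> i x\<bullet>\<xi>) \<mu>(d\<xi>)\<close> is an identity of tempered
  distributions. The first conjunct says that the function \<open>f\<close> defines a tempered distribution.
\<close>
definition is_fourier_transform_of ::
  "('a::euclidean_space \<Rightarrow> real) \<Rightarrow> 'a measure \<Rightarrow> bool" where
  "is_fourier_transform_of f \<mu> \<longleftrightarrow>
     (\<forall>\<phi> :: 'a \<Rightarrow> complex. schwartz \<phi> \<longrightarrow>
        integrable lborel (\<lambda>x. of_real (f x) * \<phi> x) \<and>
        (LINT x|lborel. of_real (f x) * \<phi> x) = (LINT \<xi>|\<mu>. fourier \<phi> \<xi>))"

text \<open>
  The function \<open>f\<close> lives on the complement of the origin: the value \<open>f 0\<close> is arbitrary, and it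
  never matters below because \<open>f\<close> is only integrated against Lebesgue measure.
\<close>
definition spatial_covariance ::
  "('a::euclidean_space \<Rightarrow> real) \<Rightarrow> 'a measure \<Rightarrow> bool" where
  "spatial_covariance f \<mu> \<longleftrightarrow>
     continuous_on (- {0}) f \<and> (\<forall>x. x \<noteq> 0 \<longrightarrow> 0 \<le> f x) \<and>
     tempered_measure \<mu> \<and> is_fourier_transform_of f \<mu>"

definition cov_form ::
  "('a::euclidean_space \<Rightarrow> real) \<Rightarrow> ('a \<Rightarrow> real) \<Rightarrow> ('a \<Rightarrow> real) \<Rightarrow> real" where
  "cov_form f \<phi> \<psi> = (LINT x|lborel. LINT y|lborel. \<phi> x * f (x - y) * \<psi> y)"

text \<open>
  A type cannot depend on \<open>f\<close>, so the completion is given by its characterisation up to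
  isometric isomorphism: the type \<open>'h\<close> is a real Hilbert space and \<open>\<iota>\<close> is a linear isometry
  of the (real) Schwartz space onto a dense subset. As usual, functions of
  zero seminorm are identified, i.e. \<open>\<iota>\<close> need not be injective.
\<close>
definition schwartz_completion ::
  "('a::euclidean_space \<Rightarrow> real) \<Rightarrow> (('a \<Rightarrow> real) \<Rightarrow> 'h::{real_inner,complete_space}) \<Rightarrow> bool" where
  "schwartz_completion f \<iota> \<longleftrightarrow>
     (\<forall>\<phi> \<psi> a b. schwartz \<phi> \<longrightarrow> schwartz \<psi> \<longrightarrow>
        \<iota> (\<lambda>x. a * \<phi> x + b * \<psi> x) = a *\<^sub>R \<iota> \<phi> + b *\<^sub>R \<iota> \<psi>) \<and>
     (\<forall>\<phi> \<psi>. schwartz \<phi> \<longrightarrow> schwartz \<psi> \<longrightarrow> \<iota> \<phi> \<bullet> \<iota> \<psi> = cov_form f \<phi> \<psi>) \<and>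
     closure (\<iota> ` Collect schwartz) = UNIV"

text \<open>
  \<open>square_integrable M g\<close>: \<open>g\<close> represents an element of \<open>L\<^sup>2(M; 'h)\<close>. Borel measurability
  amounts to strong measurability, since \<open>\<H>\<close> is separable.
\<close>
definition square_integrable :: "'c measure \<Rightarrow> ('c \<Rightarrow> 'h::real_normed_vector) \<Rightarrow> bool" where
  "square_integrable M g \<longleftrightarrow>
     g \<in> borel_measurable M \<and> integrable M (\<lambda>x. (norm (g x))\<^sup>2)"

abbreviation time_measure :: "real \<Rightarrow> real measure" where
  "time_measure T \<equiv> restrict_space lborel {0..T}"

text \<open>Degenerate Gaussians are allowed.\<close>
definition centered_gaussian :: "'w measure \<Rightarrow> ('w \<Rightarrow> real) \<Rightarrow> bool" where
  "centered_gaussian P X \<longleftrightarrow> X \<in> borel_measurable P \<and>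
     ((AE \<omega> in P. X \<omega> = 0) \<or> (\<exists>\<sigma>>0. distributed P lborel X (normal_density 0 \<sigma>)))"

definition centered_gaussian_family ::
  "'w measure \<Rightarrow> 'i set \<Rightarrow> ('i \<Rightarrow> 'w \<Rightarrow> real) \<Rightarrow> bool" where
  "centered_gaussian_family P I X \<longleftrightarrow>
     (\<forall>J c. finite J \<longrightarrow> J \<subseteq> I \<longrightarrow> centered_gaussian P (\<lambda>\<omega>. \<Sum>i\<in>J. c i * X i \<omega>))"

definition gaussian_noise ::
  "'w measure \<Rightarrow> ('a::euclidean_space \<Rightarrow> real) \<Rightarrow> ((real \<times> 'a \<Rightarrow> real) \<Rightarrow> 'w \<Rightarrow> real) \<Rightarrow> bool" where
  "gaussian_noise P f W \<longleftrightarrow>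
     centered_gaussian_family P (Collect test_function) W \<and>
     (\<forall>\<phi> \<psi>. test_function \<phi> \<longrightarrow> test_function \<psi> \<longrightarrow>
        (LINT \<omega>|P. W \<phi> \<omega> * W \<psi> \<omega>) =
        (LINT t:{0..}|lborel. cov_form f (\<lambda>x. \<phi> (t, x)) (\<lambda>x. \<psi> (t, x))))"

text \<open>
  The isometric extension of \<open>W\<close> to \<open>L\<^sup>2([0,T]; \<H>)\<close>. The covariance identity makes it
  linear and compatible with equality almost everywhere, up to \<open>P\<close>-null sets; together with the
  agreement with \<open>W\<close> it determines \<open>W\<^sub>T\<close> almost surely.
\<close>
definition noise_extension ::
  "'w measure \<Rightarrow> real \<Rightarrow> (('a::euclidean_space \<Rightarrow> real) \<Rightarrow> 'h::{real_inner,complete_space}) \<Rightarrow>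
   ((real \<times> 'a \<Rightarrow> real) \<Rightarrow> 'w \<Rightarrow> real) \<Rightarrow> ((real \<Rightarrow> 'h) \<Rightarrow> 'w \<Rightarrow> real) \<Rightarrow> bool" where
  "noise_extension P T \<iota> W W\<^sub>T \<longleftrightarrow>
     centered_gaussian_family P (Collect (square_integrable (time_measure T))) W\<^sub>T \<and>
     (\<forall>g\<^sub>1 g\<^sub>2. square_integrable (time_measure T) g\<^sub>1 \<longrightarrow>
        square_integrable (time_measure T) g\<^sub>2 \<longrightarrow>
        (LINT \<omega>|P. W\<^sub>T g\<^sub>1 \<omega> * W\<^sub>T g\<^sub>2 \<omega>) = (LINT t|time_measure T. g\<^sub>1 t \<bullet> g\<^sub>2 t)) \<and>
     (\<forall>\<phi>. test_function \<phi> \<longrightarrow> (\<forall>t x. t \<notin> {0..T} \<longrightarrow> \<phi> (t, x) = 0) \<longrightarrow>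
        (AE \<omega> in P. W\<^sub>T (\<lambda>t. \<iota> (\<lambda>x. \<phi> (t, x))) \<omega> = W \<phi> \<omega>))"

definition noise_filtration ::
  "'w measure \<Rightarrow> ((real \<Rightarrow> 'h::real_normed_vector) \<Rightarrow> 'w \<Rightarrow> real) \<Rightarrow> real \<Rightarrow> 'w measure" where
  "noise_filtration P W\<^sub>T t = sigma (space P)
     (null_sets P \<union>
      {W\<^sub>T (\<lambda>r. indicator {0..s} r *\<^sub>R h) -` B \<inter> space P | h s B.
         0 \<le> s \<and> s \<le> t \<and> B \<in> sets borel})"

definition predictable_sigma ::
  "'w measure \<Rightarrow> (real \<Rightarrow> 'w measure) \<Rightarrow> real \<Rightarrow> ('w \<times> real) measure" where
  "predictable_sigma P \<F> T = sigma (space P \<times> {0..T})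
     {A \<times> {s<..t} | A s t. 0 \<le> s \<and> s < t \<and> t \<le> T \<and> A \<in> sets (\<F> s)}"

definition predictable_field ::
  "'w measure \<Rightarrow> (real \<Rightarrow> 'w measure) \<Rightarrow> real \<Rightarrow>
   (real \<Rightarrow> 'a::euclidean_space \<Rightarrow> 'w \<Rightarrow> real) \<Rightarrow> bool" where
  "predictable_field P \<F> T Z \<longleftrightarrow>
     (\<lambda>((\<omega>, t), x). Z t x \<omega>) \<in> borel_measurable (predictable_sigma P \<F> T \<Otimes>\<^sub>M borel)"

text \<open>
  The coefficients \<open>a, b, c\<close> stand for the operator
  \<open>L = (\<Sum>u v. a\<^sub>u\<^sub>v \<partial>\<^sub>u \<partial>\<^sub>v) + (\<Sum>u. b\<^sub>u \<partial>\<^sub>u) + c\<close> on space-time, with indices ranging over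
  the coordinate directions of \<open>real \<times> 'a\<close>; constant coefficients are a special case. As \<open>a\<close> is
  not required to be symmetric, having order two means that its symmetric part is not zero.
\<close>
definition second_order_operator ::
  "('e::euclidean_space \<Rightarrow> 'e \<Rightarrow> 'e \<Rightarrow> real) \<Rightarrow> ('e \<Rightarrow> 'e \<Rightarrow> real) \<Rightarrow> ('e \<Rightarrow> real) \<Rightarrow> bool" where
  "second_order_operator a b c \<longleftrightarrow>
     (\<forall>u\<in>Basis. \<forall>v\<in>Basis. smooth_function (a u v)) \<and>
     (\<forall>u\<in>Basis. smooth_function (b u)) \<and> smooth_function c \<and>
     (\<exists>u\<in>Basis. \<exists>v\<in>Basis. \<exists>z. a u v z + a v u z \<noteq> 0)"

definition formal_adjoint ::
  "('e::euclidean_space \<Rightarrow> 'e \<Rightarrow> 'e \<Rightarrow> real) \<Rightarrow> ('e \<Rightarrow> 'e \<Rightarrow> real) \<Rightarrow> ('e \<Rightarrow> real) \<Rightarrow>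
   ('e \<Rightarrow> real) \<Rightarrow> 'e \<Rightarrow> real" where
  "formal_adjoint a b c \<phi> z =
     (\<Sum>u\<in>Basis. \<Sum>v\<in>Basis. partial_deriv u (partial_deriv v (\<lambda>w. a u v w * \<phi> w)) z) -
     (\<Sum>u\<in>Basis. partial_deriv u (\<lambda>w. b u w * \<phi> w) z) + c z * \<phi> z"

definition time_kernel :: "(real \<Rightarrow> 'a::euclidean_space measure) \<Rightarrow> bool" where
  "time_kernel \<Gamma> \<longleftrightarrow> (\<forall>t\<ge>0. sets (\<Gamma> t) = sets borel) \<and>
     (\<forall>A\<in>sets borel. (\<lambda>t. emeasure (\<Gamma> t) A) \<in> borel_measurable (restrict_space borel {0..}))"

text \<open>
  \<open>L \<Gamma> = \<delta>\<^sub>0\<close> in the sense of distributions on \<open>real \<times> 'a\<close>, where the measure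
  \<open>\<Gamma>(t,dx) dt\<close> is carried by \<open>t \<ge> 0\<close>.
\<close>
definition fundamental_solution ::
  "(real \<times> 'a::euclidean_space \<Rightarrow> real \<times> 'a \<Rightarrow> real \<times> 'a \<Rightarrow> real) \<Rightarrow>
   (real \<times> 'a \<Rightarrow> real \<times> 'a \<Rightarrow> real) \<Rightarrow> (real \<times> 'a \<Rightarrow> real) \<Rightarrow>
   (real \<Rightarrow> 'a measure) \<Rightarrow> bool" where
  "fundamental_solution a b c \<Gamma> \<longleftrightarrow>
     (\<forall>\<phi>. test_function \<phi> \<longrightarrow>
        (LINT t:{0..}|lborel. (LINT x|\<Gamma> t. formal_adjoint a b c \<phi> (t, x))) = \<phi> (0, 0))"

definition hypothesis_A ::
  "(real \<times> 'a::euclidean_space \<Rightarrow> real \<times> 'a \<Rightarrow> real \<times> 'a \<Rightarrow> real) \<Rightarrow>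
   (real \<times> 'a \<Rightarrow> real \<times> 'a \<Rightarrow> real) \<Rightarrow> (real \<times> 'a \<Rightarrow> real) \<Rightarrow>
   'a measure \<Rightarrow> (real \<Rightarrow> 'a measure) \<Rightarrow> bool" where
  "hypothesis_A a b c \<mu> \<Gamma> \<longleftrightarrow>
     second_order_operator a b c \<and> time_kernel \<Gamma> \<and> fundamental_solution a b c \<Gamma> \<and>
     (\<forall>T>0. (SUP t\<in>{0..T}. emeasure (\<Gamma> t) UNIV) < \<infinity> \<and>
        (\<integral>\<^sup>+ t\<in>{0..T}. (\<integral>\<^sup>+ \<xi>. ennreal ((cmod (fourier_measure (\<Gamma> t) \<xi>))\<^sup>2) \<partial>\<mu>) \<partial>lborel) < \<infinity>)"

definition represents_G ::
  "'w measure \<Rightarrow> (real \<Rightarrow> 'w measure) \<Rightarrow> real \<Rightarrow> ('a::euclidean_space \<Rightarrow> real) \<Rightarrow>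
   (('a \<Rightarrow> real) \<Rightarrow> 'h::{real_inner,complete_space}) \<Rightarrow> (real \<Rightarrow> 'a measure) \<Rightarrow>
   (real \<Rightarrow> 'a \<Rightarrow> 'w \<Rightarrow> real) \<Rightarrow> ('w \<times> real \<Rightarrow> 'h) \<Rightarrow> bool" where
  "represents_G P \<F> T f \<iota> \<Gamma> Z G \<longleftrightarrow>
     (\<forall>\<phi> s t B. schwartz \<phi> \<longrightarrow> 0 \<le> s \<longrightarrow> s < t \<longrightarrow> t \<le> T \<longrightarrow> B \<in> sets (\<F> s) \<longrightarrow>
        (LINT \<omega>|P. indicator B \<omega> * (LINT r:{s..t}|lborel. G (\<omega>, r) \<bullet> \<iota> \<phi>)) =
        (LINT \<omega>|P. indicator B \<omega> *
           (LINT r:{s..t}|lborel. (LINT x|\<Gamma> r. LINT y|lborel. Z r x \<omega> * f (x - y) * \<phi> y))))"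

end

theory Submission
  imports Defs
begin

text \<open>
The Fourier transform turns the Hilbert space \<open>\<H>\<close> into a subspace of \<open>L\<^sup>2(\<mu>)\<close>: for real Schwartz
functions, \<open>\<langle>\<phi>,\<psi>\<rangle>\<close> is the integral of the transform of \<open>\<phi>\<close> against the conjugate transform of \<open>\<psi>\<close>.
A finite signed measure \<open>\<nu>\<close> whose transform is square integrable for \<open>\<mu>\<close> therefore is an element of
\<open>\<H>\<close>, and its inner product with \<open>\<phi>\<close> is the integral of \<open>f * \<phi>\<close> against \<open>\<nu>\<close>. It remains to see that
for almost every \<open>(\<omega>,t)\<close> this applies to \<open>\<nu> = Z(t,\<cdot>,\<omega>) \<Gamma>(t)\<close>, with a norm that is square integrable
in \<open>(\<omega>,t)\<close>, and that the resulting element of \<open>\<H>\<close> depends predictably on \<open>(\<omega>,t)\<close>.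

The norm is controlled by comparison with \<open>\<Gamma>(t)\<close> itself. Formally, the expected squared norm of
\<open>\<nu>\<close> is the double integral of \<open>E[Z(t,x) Z(t,y)] f(x - y)\<close> for \<open>\<Gamma>(t,dx) \<Gamma>(t,dy)\<close>. As \<open>f\<close> is non-negative
and \<open>E[Z(t,x) Z(t,y)]\<close> is at most \<open>C\<^sub>Z\<close>, replacing \<open>Z\<close> by 1 costs a factor \<open>C\<^sub>Z\<close> only, and what is left is
the quantity whose time integral Hypothesis A makes finite. Since \<open>f\<close> may be singular at the origin,
the argument is carried out for the bounded function \<open>f * g\<^sub>\<sigma>\<close>, where \<open>g\<^sub>\<sigma>\<close> is a Gaussian density; its
transform is a damping factor on the side of \<open>\<mu>\<close>, which Fatou's lemma removes as \<open>\<sigma>\<close> tends to 0. This is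
\<open>expected_damped_energy_le\<close> and \<open>expected_energy_le\<close>.

For predictability the element is constructed explicitly, as an iterated pointwise limit. For simple
functions \<open>s\<^sub>i\<close> converging to the identity, the finite sums of the translates \<open>g\<^sub>\<sigma>(\<cdot> - q)\<close> with weights
\<open>\<nu>(s\<^sub>i = q)\<close> are combinations of fixed vectors of \<open>\<H>\<close> with real predictable coefficients. Their
transforms converge in \<open>L\<^sup>2(\<mu>)\<close>, as \<open>i\<close> tends to infinity, to the damped transform of \<open>\<nu>\<close>, and then, as
\<open>\<sigma>\<close> tends to 0, to the transform of \<open>\<nu>\<close>; by the isometry the sums themselves converge in \<open>\<H>\<close>
(\<open>spectral_discretize_limit\<close>). The coefficients are measurable because \<open>\<Gamma>\<close> is a kernel in time
(\<open>kernel_integral_measurable_real\<close>). The limit has the right inner products for each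
\<open>(\<omega>,t)\<close> outside a null set, so its defining identity holds before any integration in time or
expectation is taken (\<open>spectral_inner_eq_pairing\<close>).
\<close>

section \<open>Schwartz functions\<close>

lemma iter_partial_deriv_Nil [simp]: "iter_partial_deriv [] \<phi> = \<phi>"
  by (simp add: iter_partial_deriv_def)

lemma iter_partial_deriv_Cons [simp]:
  "iter_partial_deriv (v # vs) \<phi> = partial_deriv v (iter_partial_deriv vs \<phi>)"
  by (simp add: iter_partial_deriv_def)

lemma smooth_functionD:
  "smooth_function \<phi> \<Longrightarrow> set vs \<subseteq> Basis \<Longrightarrow> iter_partial_deriv vs \<phi> differentiable (at x)"
  by (simp add: smooth_function_def)

lemma partial_derivI:
  "(\<phi> has_derivative D) (at x) \<Longrightarrow> partial_deriv v \<phi> x = D v"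
  by (metis frechet_derivative_at partial_deriv_def)

lemma iter_partial_deriv_lincomb:
  fixes \<phi> \<psi> :: "'a::euclidean_space \<Rightarrow> real"
  assumes "smooth_function \<phi>" "smooth_function \<psi>" "set vs \<subseteq> Basis"
  shows "iter_partial_deriv vs (\<lambda>x. a * \<phi> x + b * \<psi> x) =
         (\<lambda>x. a * iter_partial_deriv vs \<phi> x + b * iter_partial_deriv vs \<psi> x)"
  using assms(3)
proof (induction vs)
  case (Cons v vs)
  have "partial_deriv v (\<lambda>x. a * iter_partial_deriv vs \<phi> x + b * iter_partial_deriv vs \<psi> x) x =
        a * partial_deriv v (iter_partial_deriv vs \<phi>) x + b * partial_deriv v (iter_partial_deriv vs \<psi>) x" for x
  proof -
    have d: "(iter_partial_deriv vs \<phi> has_derivative frechet_derivative (iter_partial_deriv vs \<phi>) (at x)) (at x)"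
            "(iter_partial_deriv vs \<psi> has_derivative frechet_derivative (iter_partial_deriv vs \<psi>) (at x)) (at x)"
      using smooth_functionD[OF assms(1)] smooth_functionD[OF assms(2)] Cons.prems
      by (simp_all flip: frechet_derivative_works)
    show ?thesis
      by (subst partial_derivI) (auto intro!: derivative_eq_intros d simp: partial_deriv_def)
  qed
  then show ?case using Cons by auto
qed simp

lemma schwartz_lincomb:
  fixes \<phi> \<psi> :: "'a::euclidean_space \<Rightarrow> real"
  assumes "schwartz \<phi>" "schwartz \<psi>"
  shows "schwartz (\<lambda>x. a * \<phi> x + b * \<psi> x)"
proof -
  have s: "smooth_function \<phi>" "smooth_function \<psi>" using assms by (auto simp: schwartz_def)
  show ?thesis unfolding schwartz_def
  proof (intro conjI allI impI)
    show "smooth_function (\<lambda>x. a * \<phi> x + b * \<psi> x)"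
      unfolding smooth_function_def using s
      by (auto simp: iter_partial_deriv_lincomb intro!: derivative_intros smooth_functionD)
    fix k :: nat and vs :: "'a list" assume vs: "set vs \<subseteq> Basis"
    have "bounded (range (\<lambda>x. norm x ^ k *\<^sub>R iter_partial_deriv vs \<phi> x))"
         "bounded (range (\<lambda>x. norm x ^ k *\<^sub>R iter_partial_deriv vs \<psi> x))"
      using assms vs by (auto simp: schwartz_def)
    then have "bounded (range (\<lambda>x. a * (norm x ^ k *\<^sub>R iter_partial_deriv vs \<phi> x) +
        b * (norm x ^ k *\<^sub>R iter_partial_deriv vs \<psi> x)))"
      using bounded_scaling[where c=a] bounded_scaling[where c=b]
      by (intro bounded_plus_comp) (fastforce simp: image_image)+
    then show "bounded (range (\<lambda>x. norm x ^ k *\<^sub>R iter_partial_deriv vs (\<lambda>x. a * \<phi> x + b * \<psi> x) x))"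
      by (simp add: iter_partial_deriv_lincomb[OF s vs] algebra_simps)
  qed
qed

lemma schwartz_zero: "schwartz (\<lambda>x. 0 :: real)"
proof -
  have "iter_partial_deriv vs (\<lambda>x::'a. 0::real) = (\<lambda>x. 0)" for vs
    by (induction vs) (auto intro!: ext partial_derivI[where D="\<lambda>_. 0", simplified])
  then show ?thesis by (simp add: schwartz_def smooth_function_def)
qed

lemma schwartz_sum:
  fixes \<phi> :: "'i \<Rightarrow> 'a::euclidean_space \<Rightarrow> real"
  assumes "\<And>i. i \<in> I \<Longrightarrow> schwartz (\<phi> i)"
  shows "schwartz (\<lambda>x. \<Sum>i\<in>I. c i * \<phi> i x)"
  using assms
proof (induction I rule: infinite_finite_induct)
  case (insert i I)
  then show ?case using schwartz_lincomb[of "\<phi> i" "\<lambda>x. \<Sum>i\<in>I. c i * \<phi> i x" "c i" 1] by simp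
qed (simp_all add: schwartz_zero)

lemma one_plus_power_le:
  fixes t :: real assumes "0 \<le> t" shows "(1 + t) ^ n \<le> 2 ^ n * (1 + t ^ n)"
proof -
  have "(1 + t) ^ n \<le> (2 * max 1 t) ^ n" using assms by (intro power_mono) auto
  also have "\<dots> = 2 ^ n * max 1 (t ^ n)"
  proof (cases "t \<le> 1")
    case True
    then have "max 1 (t ^ n) = 1" using power_le_one[OF assms, of n] by simp
    then show ?thesis using True by (simp add: max_def power_mult_distrib)
  next
    case False
    then show ?thesis using one_le_power[of t n] by (simp add: max_def power_mult_distrib)
  qed
  also have "\<dots> \<le> 2 ^ n * (1 + t ^ n)" using assms by (intro mult_left_mono) auto
  finally show ?thesis .
qed

text \<open>
Weighting by powers of \<open>1 + |x|\<^sup>2\<close> instead of \<open>|x|\<close> merges the bounds near the origin and near infinity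
into one, which can serve as an integrable majorant.
\<close>
lemma schwartz_bound:
  fixes \<phi> :: "'a::euclidean_space \<Rightarrow> 'b::real_normed_vector"
  assumes "schwartz \<phi>" "set vs \<subseteq> Basis"
  obtains C where "0 \<le> C" "\<And>x. norm (iter_partial_deriv vs \<phi> x) \<le> C / (1 + (norm x)\<^sup>2) ^ n"
proof -
  have "\<And>k. bounded (range (\<lambda>x. norm x ^ k *\<^sub>R iter_partial_deriv vs \<phi> x))"
    using assms by (auto simp: schwartz_def)
  from this[of 0] this[of "2 * n"] obtain A B where
    A: "\<And>x. norm (iter_partial_deriv vs \<phi> x) \<le> A" and
    B: "\<And>x. norm x ^ (2 * n) * norm (iter_partial_deriv vs \<phi> x) \<le> B"
    by (auto simp: bounded_iff)
  have "0 \<le> A" using A[of 0] norm_ge_zero order_trans by blast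
  have "0 \<le> B" using B[of 0] by (meson mult_nonneg_nonneg norm_ge_zero order_trans zero_le_power)
  show ?thesis
  proof (rule that[of "2 ^ n * (A + B)"])
    fix x :: 'a
    let ?N = "norm (iter_partial_deriv vs \<phi> x)"
    have "(1 + (norm x)\<^sup>2) ^ n * ?N \<le> 2 ^ n * (1 + norm x ^ (2 * n)) * ?N"
      using one_plus_power_le[of "(norm x)\<^sup>2" n] by (intro mult_right_mono) (auto simp: power_mult)
    also have "\<dots> = 2 ^ n * (?N + norm x ^ (2 * n) * ?N)" by (simp add: algebra_simps)
    also have "\<dots> \<le> 2 ^ n * (A + B)" using A[of x] B[of x] by (intro mult_left_mono add_mono) auto
    finally show "?N \<le> 2 ^ n * (A + B) / (1 + (norm x)\<^sup>2) ^ n"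
      by (simp add: pos_le_divide_eq add_pos_nonneg mult.commute)
  qed (use \<open>0 \<le> A\<close> \<open>0 \<le> B\<close> in auto)
qed

lemma norm_le_one_plus_square:
  fixes x :: "'a::real_normed_vector"
  shows "norm x \<le> 1 + (norm x)\<^sup>2"
proof -
  have "2 * norm x \<le> 1 + (norm x)\<^sup>2" using sum_squares_bound[of "norm x" 1] by simp
  then show ?thesis using norm_ge_zero[of x] by linarith
qed

lemma schwartzI:
  fixes \<phi> :: "'a::euclidean_space \<Rightarrow> 'b::real_normed_vector"
  assumes "smooth_function \<phi>"
    and "\<And>vs n. set vs \<subseteq> Basis \<Longrightarrow> \<exists>C. \<forall>x. norm (iter_partial_deriv vs \<phi> x) \<le> C / (1 + (norm x)\<^sup>2) ^ n"
  shows "schwartz \<phi>"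
  unfolding schwartz_def
proof (intro conjI allI impI assms(1))
  fix k :: nat and vs :: "'a list" assume "set vs \<subseteq> Basis"
  then obtain C where C: "\<And>x. norm (iter_partial_deriv vs \<phi> x) \<le> C / (1 + (norm x)\<^sup>2) ^ k"
    using assms(2)[of vs k] by blast
  have "norm (norm x ^ k *\<^sub>R iter_partial_deriv vs \<phi> x) \<le> C" for x
  proof -
    have "norm x ^ k * norm (iter_partial_deriv vs \<phi> x) \<le> (1 + (norm x)\<^sup>2) ^ k * (C / (1 + (norm x)\<^sup>2) ^ k)"
      by (intro mult_mono power_mono C norm_le_one_plus_square) auto
    also have "\<dots> = C" by (simp add: add_nonneg_eq_0_iff)
    finally show ?thesis by simp
  qed
  then show "bounded (range (\<lambda>x. norm x ^ k *\<^sub>R iter_partial_deriv vs \<phi> x))"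
    by (auto simp: bounded_iff)
qed

text \<open>
Peetre's inequality for the weight \<open>1 + |x|\<^sup>2\<close>: it makes rapid decay insensitive to translations.
\<close>
lemma norm_shift_bound:
  fixes x y :: "'a::real_normed_vector"
  shows "1 + (norm (x + y))\<^sup>2 \<le> 2 * (1 + (norm y)\<^sup>2) * (1 + (norm x)\<^sup>2)"
proof -
  have "(norm (x + y))\<^sup>2 \<le> (norm x + norm y)\<^sup>2" by (intro power_mono norm_triangle_ineq) auto
  also have "\<dots> \<le> 2 * (norm x)\<^sup>2 + 2 * (norm y)\<^sup>2"
    using zero_le_power2[of "norm x - norm y"] by (simp add: power2_eq_square algebra_simps)
  finally have "1 + (norm (x + y))\<^sup>2 \<le> 2 + 2 * (norm x)\<^sup>2 + 2 * (norm y)\<^sup>2 + 2 * ((norm y)\<^sup>2 * (norm x)\<^sup>2)"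
    by (smt (verit) mult_nonneg_nonneg zero_le_power2)
  then show ?thesis by (simp add: algebra_simps)
qed

text \<open>
The affine map and the linear map \<open>L\<close> cover at once the translates \<open>\<phi>(\<cdot> - q)\<close> and the complex-valued
reflections \<open>\<phi>(x - \<cdot>)\<close>, to which the identity relating \<open>f\<close> and \<open>\<mu>\<close> is applied.
\<close>
lemma iter_partial_deriv_affine:
  fixes \<phi> :: "'a::euclidean_space \<Rightarrow> real" and L :: "real \<Rightarrow> 'b::real_normed_vector"
  assumes "smooth_function \<phi>" "bounded_linear L" "set vs \<subseteq> Basis"
  shows "iter_partial_deriv vs (\<lambda>z. L (\<phi> (c *\<^sub>R z + x))) =
         (\<lambda>z. c ^ length vs *\<^sub>R L (iter_partial_deriv vs \<phi> (c *\<^sub>R z + x)))"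
  using assms(3)
proof (induction vs)
  case (Cons v vs)
  interpret L: bounded_linear L by fact
  have "partial_deriv v (\<lambda>z. c ^ length vs *\<^sub>R L (iter_partial_deriv vs \<phi> (c *\<^sub>R z + x))) z =
        c ^ Suc (length vs) *\<^sub>R L (partial_deriv v (iter_partial_deriv vs \<phi>) (c *\<^sub>R z + x))" for z
  proof -
    let ?D = "frechet_derivative (iter_partial_deriv vs \<phi>) (at (c *\<^sub>R z + x))"
    have d: "(iter_partial_deriv vs \<phi> has_derivative ?D) (at (c *\<^sub>R z + x))"
      using smooth_functionD[OF assms(1)] Cons.prems by (simp flip: frechet_derivative_works)
    have lin: "?D (c *\<^sub>R v) = c *\<^sub>R ?D v"
      using has_derivative_linear[OF d] by (simp add: linear_cmul)
    have a: "((\<lambda>z. c *\<^sub>R z + x) has_derivative (\<lambda>h. c *\<^sub>R h)) (at z)"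
      by (auto intro!: derivative_eq_intros)
    have "((\<lambda>z. c ^ length vs *\<^sub>R L (iter_partial_deriv vs \<phi> (c *\<^sub>R z + x))) has_derivative
        (\<lambda>h. c ^ length vs *\<^sub>R L (?D (c *\<^sub>R h)))) (at z)"
      using has_derivative_scaleR_right[OF L.has_derivative[OF has_derivative_compose[OF a d]]] .
    then show ?thesis
      by (subst partial_derivI, assumption) (simp add: lin partial_deriv_def L.scaleR del: real_scaleR_def)
  qed
  then show ?case using Cons by auto
qed simp

lemma divide_le_mult_divide:
  fixes A B C D :: real
  assumes "0 \<le> C" "0 < A" "0 < D" "D \<le> B * A"
  shows "C / A \<le> C * B / D"
  using mult_left_mono[OF assms(4,1)] assms(2,3) by (simp add: field_simps)

lemma schwartz_affine:
  fixes \<phi> :: "'a::euclidean_space \<Rightarrow> real" and L :: "real \<Rightarrow> 'b::real_normed_vector"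
  assumes \<phi>: "schwartz \<phi>" and L: "bounded_linear L" and c: "\<bar>c\<bar> = 1"
  shows "schwartz (\<lambda>z. L (\<phi> (c *\<^sub>R z + x)))"
proof (rule schwartzI)
  interpret L: bounded_linear L by fact
  have s: "smooth_function \<phi>" using \<phi> by (simp add: schwartz_def)
  show "smooth_function (\<lambda>z. L (\<phi> (c *\<^sub>R z + x)))"
    unfolding smooth_function_def
  proof (intro allI impI)
    fix vs :: "'a list" and z assume vs: "set vs \<subseteq> Basis"
    have "iter_partial_deriv vs \<phi> differentiable (at (c *\<^sub>R z + x))"
      using smooth_functionD[OF s vs] .
    then have d: "(iter_partial_deriv vs \<phi> has_derivative frechet_derivative (iter_partial_deriv vs \<phi>) (at (c *\<^sub>R z + x))) (at (c *\<^sub>R z + x))"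
      by (simp flip: frechet_derivative_works)
    have a: "((\<lambda>z. c *\<^sub>R z + x) has_derivative (\<lambda>h. c *\<^sub>R h)) (at z)"
      by (auto intro!: derivative_eq_intros)
    show "iter_partial_deriv vs (\<lambda>z. L (\<phi> (c *\<^sub>R z + x))) differentiable (at z)"
      unfolding iter_partial_deriv_affine[OF s L vs]
      using has_derivative_scaleR_right[OF L.has_derivative[OF has_derivative_compose[OF a d]]]
      by (rule differentiableI)
  qed
  fix vs :: "'a list" and n :: nat assume vs: "set vs \<subseteq> Basis"
  obtain K where K: "0 \<le> K" "\<And>r. norm (L r) \<le> norm r * K" using L.nonneg_bounded by blast
  obtain C where C: "0 \<le> C" "\<And>x. norm (iter_partial_deriv vs \<phi> x) \<le> C / (1 + (norm x)\<^sup>2) ^ n"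
    using schwartz_bound[OF \<phi> vs] by metis
  let ?B = "(2 * (1 + (norm x)\<^sup>2)) ^ n"
  show "\<exists>C. \<forall>z. norm (iter_partial_deriv vs (\<lambda>z. L (\<phi> (c *\<^sub>R z + x))) z) \<le> C / (1 + (norm z)\<^sup>2) ^ n"
  proof (intro exI allI)
    fix z :: 'a
    have "norm (c *\<^sub>R z) = norm z" using c by simp
    then have "1 + (norm z)\<^sup>2 \<le> 2 * (1 + (norm x)\<^sup>2) * (1 + (norm (c *\<^sub>R z + x))\<^sup>2)"
      using norm_shift_bound[of "c *\<^sub>R z + x" "- x"] by (metis add.right_neutral add.assoc add.right_inverse norm_minus_cancel)
    then have "(1 + (norm z)\<^sup>2) ^ n \<le> ?B * (1 + (norm (c *\<^sub>R z + x))\<^sup>2) ^ n"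
      unfolding power_mult_distrib[symmetric] by (intro power_mono) auto
    then have *: "C / (1 + (norm (c *\<^sub>R z + x))\<^sup>2) ^ n \<le> C * ?B / (1 + (norm z)\<^sup>2) ^ n"
      using C(1) by (intro divide_le_mult_divide) (auto intro!: zero_less_power add_pos_nonneg)
    have "norm (iter_partial_deriv vs (\<lambda>z. L (\<phi> (c *\<^sub>R z + x))) z) = norm (L (iter_partial_deriv vs \<phi> (c *\<^sub>R z + x)))"
      using c by (simp add: iter_partial_deriv_affine[OF s L vs] power_abs)
    also have "\<dots> \<le> norm (iter_partial_deriv vs \<phi> (c *\<^sub>R z + x)) * K" by (rule K)
    also have "\<dots> \<le> (C * ?B / (1 + (norm z)\<^sup>2) ^ n) * K"
      using C(2)[of "c *\<^sub>R z + x"] * K(1) by (intro mult_right_mono) auto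
    finally show "norm (iter_partial_deriv vs (\<lambda>z. L (\<phi> (c *\<^sub>R z + x))) z) \<le> (C * ?B * K) / (1 + (norm z)\<^sup>2) ^ n"
      by simp
  qed
qed

lemma schwartz_translate:
  fixes \<phi> :: "'a::euclidean_space \<Rightarrow> real"
  assumes "schwartz \<phi>" shows "schwartz (\<lambda>z. \<phi> (z - x))"
  using schwartz_affine[OF assms bounded_linear_ident, of 1 "- x"] by simp

lemma schwartz_reflect_complex:
  fixes \<phi> :: "'a::euclidean_space \<Rightarrow> real"
  assumes "schwartz \<phi>" shows "schwartz (\<lambda>z. complex_of_real (\<phi> (x - z)))"
  using schwartz_affine[OF assms bounded_linear_of_real, of "-1" x] by simp

lemma schwartz_partial_deriv:
  fixes \<phi> :: "'a::euclidean_space \<Rightarrow> 'b::real_normed_vector"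
  assumes "schwartz \<phi>" "b \<in> Basis" shows "schwartz (partial_deriv b \<phi>)"
proof -
  have *: "iter_partial_deriv vs (partial_deriv b \<phi>) = iter_partial_deriv (vs @ [b]) \<phi>" for vs
    by (simp add: iter_partial_deriv_def)
  show ?thesis using assms unfolding schwartz_def smooth_function_def * by simp
qed

lemma schwartz_differentiable: "schwartz \<phi> \<Longrightarrow> \<phi> differentiable (at x)"
  using smooth_functionD[of \<phi> "[]"] by (simp add: schwartz_def)

lemma schwartz_continuous: "schwartz \<phi> \<Longrightarrow> continuous_on A \<phi>"
  by (meson continuous_at_imp_continuous_on differentiable_imp_continuous_within schwartz_differentiable)

lemma schwartz_borel_measurable:
  fixes \<phi> :: "'a::euclidean_space \<Rightarrow> 'b::real_normed_vector"
  shows "schwartz \<phi> \<Longrightarrow> \<phi> \<in> borel_measurable borel"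
  by (intro borel_measurable_continuous_onI schwartz_continuous)

lemma real_polynomial_bound:
  fixes p :: "'a::euclidean_space \<Rightarrow> real"
  assumes "real_polynomial_function p"
  shows "\<exists>C n. 0 \<le> C \<and> (\<forall>x. \<bar>p x\<bar> \<le> C * (1 + (norm x)\<^sup>2) ^ n)"
  using assms
proof induction
  case (linear p)
  obtain K where K: "0 \<le> K" "\<And>x. norm (p x) \<le> norm x * K"
    using linear bounded_linear.nonneg_bounded by blast
  have "\<bar>p x\<bar> \<le> K * (1 + (norm x)\<^sup>2) ^ 1" for x
  proof -
    show ?thesis using K(2)[of x] K(1) norm_le_one_plus_square[of x] by (smt (verit) mult.commute mult_left_mono power_one_right real_norm_def)
  qed
  then show ?case using K(1) by blast
next
  case (const c)
  have "\<bar>c\<bar> \<le> \<bar>c\<bar> * (1 + (norm x)\<^sup>2) ^ 0" for x :: 'a by simp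
  then show ?case using abs_ge_zero by blast
next
  case (add p q)
  then obtain C n D m where C: "0 \<le> C" "\<And>x. \<bar>p x\<bar> \<le> C * (1 + (norm x)\<^sup>2) ^ n"
    and D: "0 \<le> D" "\<And>x. \<bar>q x\<bar> \<le> D * (1 + (norm x)\<^sup>2) ^ m" by blast
  have "\<bar>p x + q x\<bar> \<le> (C + D) * (1 + (norm x)\<^sup>2) ^ (n + m)" for x
  proof -
    have "C * (1 + (norm x)\<^sup>2) ^ n \<le> C * (1 + (norm x)\<^sup>2) ^ (n + m)"
         "D * (1 + (norm x)\<^sup>2) ^ m \<le> D * (1 + (norm x)\<^sup>2) ^ (n + m)"
      using C(1) D(1) by (auto intro!: mult_left_mono power_increasing)
    then show ?thesis using C(2)[of x] D(2)[of x] unfolding distrib_right by linarith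
  qed
  then show ?case using C(1) D(1) by (meson add_nonneg_nonneg)
next
  case (mult p q)
  then obtain C n D m where C: "0 \<le> C" "\<And>x. \<bar>p x\<bar> \<le> C * (1 + (norm x)\<^sup>2) ^ n"
    and D: "0 \<le> D" "\<And>x. \<bar>q x\<bar> \<le> D * (1 + (norm x)\<^sup>2) ^ m" by blast
  have "\<bar>p x * q x\<bar> \<le> (C * D) * (1 + (norm x)\<^sup>2) ^ (n + m)" for x
  proof -
    have "\<bar>p x\<bar> * \<bar>q x\<bar> \<le> (C * (1 + (norm x)\<^sup>2) ^ n) * (D * (1 + (norm x)\<^sup>2) ^ m)"
      using C D by (intro mult_mono) auto
    then show ?thesis by (simp add: abs_mult power_add algebra_simps)
  qed
  then show ?case using C(1) D(1) by (meson mult_nonneg_nonneg)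
qed

lemma real_polynomial_has_derivative:
  fixes p :: "'a::euclidean_space \<Rightarrow> real"
  assumes "real_polynomial_function p"
  shows "\<exists>D. (\<forall>x. (p has_derivative D x) (at x)) \<and> (\<forall>v. real_polynomial_function (\<lambda>x. D x v))"
  using assms
proof induction
  case (linear p)
  then show ?case by (intro exI[of _ "\<lambda>_. p"]) (auto intro: bounded_linear_imp_has_derivative)
next
  case (const c)
  show ?case by (intro exI[of _ "\<lambda>_ _. 0"]) auto
next
  case (add p q)
  then obtain D E where "\<forall>x. (p has_derivative D x) (at x)" "\<forall>v. real_polynomial_function (\<lambda>x. D x v)"
    "\<forall>x. (q has_derivative E x) (at x)" "\<forall>v. real_polynomial_function (\<lambda>x. E x v)" by blast
  then show ?case by (intro exI[of _ "\<lambda>x v. D x v + E x v"]) (auto intro: has_derivative_add)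
next
  case (mult p q)
  then obtain D E where "\<forall>x. (p has_derivative D x) (at x)" "\<forall>v. real_polynomial_function (\<lambda>x. D x v)"
    "\<forall>x. (q has_derivative E x) (at x)" "\<forall>v. real_polynomial_function (\<lambda>x. E x v)" by blast
  then show ?case using mult.hyps
    by (intro exI[of _ "\<lambda>x v. p x * E x v + D x v * q x"]) (auto intro!: has_derivative_mult real_polynomial_function.intros(3) real_polynomial_function.intros(4))
qed

text \<open>
Polynomial multiples of a Gaussian are stable under differentiation, so no explicit derivative has to be
computed.
\<close>
lemma iter_partial_deriv_gaussian:
  fixes a :: real
  shows "\<exists>p :: 'a::euclidean_space \<Rightarrow> real. real_polynomial_function p \<and>
     iter_partial_deriv vs (\<lambda>x::'a. c * exp (- a * (norm x)\<^sup>2)) = (\<lambda>x. p x * exp (- a * (norm x)\<^sup>2))"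
proof (induction vs)
  case Nil
  show ?case by (intro exI[of _ "\<lambda>_. c"]) auto
next
  case (Cons v vs)
  then obtain p :: "'a \<Rightarrow> real" where p: "real_polynomial_function p"
    "iter_partial_deriv vs (\<lambda>x::'a. c * exp (- a * (norm x)\<^sup>2)) = (\<lambda>x. p x * exp (- a * (norm x)\<^sup>2))" by blast
  from real_polynomial_has_derivative[OF p(1)] obtain D where
    D: "\<And>x. (p has_derivative D x) (at x)" "\<And>v. real_polynomial_function (\<lambda>x. D x v)" by blast
  have "partial_deriv v (\<lambda>x. p x * exp (- a * (norm x)\<^sup>2)) x =
        (D x v + (- 2 * a) * (x \<bullet> v) * p x) * exp (- a * (norm x)\<^sup>2)" for x
    unfolding power2_norm_eq_inner
    by (subst partial_derivI) (auto intro!: derivative_eq_intros D simp: algebra_simps inner_commute)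
  moreover have "real_polynomial_function (\<lambda>x. D x v + (- 2 * a) * (x \<bullet> v) * p x)"
    by (rule real_polynomial_function.intros(3)[OF D(2)])
       (intro real_polynomial_function.intros(4)[OF _ p(1)] real_polynomial_function.intros(4)
         real_polynomial_function.intros(2) real_polynomial_function.intros(1) bounded_linear_inner_left)
  ultimately show ?case using p(2) by auto
qed

lemma schwartz_gaussian:
  fixes a c :: real
  assumes "0 < a"
  shows "schwartz (\<lambda>x::'a::euclidean_space. c * exp (- a * (norm x)\<^sup>2))"
proof (rule schwartzI)
  show "smooth_function (\<lambda>x::'a. c * exp (- a * (norm x)\<^sup>2))"
    unfolding smooth_function_def
  proof (intro allI impI)
    fix vs :: "'a list" and x :: 'a
    obtain p :: "'a \<Rightarrow> real" where p: "real_polynomial_function p"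
      "iter_partial_deriv vs (\<lambda>x::'a. c * exp (- a * (norm x)\<^sup>2)) = (\<lambda>x. p x * exp (- a * (norm x)\<^sup>2))"
      using iter_partial_deriv_gaussian by blast
    from real_polynomial_has_derivative[OF p(1)] obtain D where
      D: "\<And>x. (p has_derivative D x) (at x)" by blast
    have "((\<lambda>x. p x * exp (- a * (x \<bullet> x))) has_derivative
       (\<lambda>h. p x * (exp (- a * (x \<bullet> x)) * (- a * (x \<bullet> h + h \<bullet> x))) + D x h * exp (- a * (x \<bullet> x)))) (at x)"
      by (auto intro!: derivative_eq_intros D)
    then show "iter_partial_deriv vs (\<lambda>x::'a. c * exp (- a * (norm x)\<^sup>2)) differentiable (at x)"
      unfolding p(2) by (simp only: power2_norm_eq_inner) (rule differentiableI)
  qed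
  fix vs :: "'a list" and n :: nat
  obtain p :: "'a \<Rightarrow> real" where p: "real_polynomial_function p"
    "iter_partial_deriv vs (\<lambda>x::'a. c * exp (- a * (norm x)\<^sup>2)) = (\<lambda>x. p x * exp (- a * (norm x)\<^sup>2))"
    using iter_partial_deriv_gaussian by blast
  obtain C m where C: "0 \<le> C" "\<And>x. \<bar>p x\<bar> \<le> C * (1 + (norm x)\<^sup>2) ^ m"
    using real_polynomial_bound[OF p(1)] by blast
  let ?K = "exp a * fact (n + m) / a ^ (n + m)"
  show "\<exists>C. \<forall>x. norm (iter_partial_deriv vs (\<lambda>x::'a. c * exp (- a * (norm x)\<^sup>2)) x) \<le> C / (1 + (norm x)\<^sup>2) ^ n"
  proof (intro exI allI)
    fix x :: 'a
    let ?y = "1 + (norm x)\<^sup>2"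
    have y: "?y > 0" by (simp add: add_pos_nonneg)
    \<comment> \<open>A single term of the exponential series beats the polynomial factor.\<close>
    have "(a * ?y) ^ (n + m) / fact (n + m) \<le> exp (a * ?y)"
    proof -
      have "(\<Sum>k\<in>{n + m}. (a * ?y) ^ k /\<^sub>R fact k) \<le> exp (a * ?y)"
        unfolding exp_def using assms y
        by (intro sum_le_suminf summable_exp_generic) auto
      then show ?thesis by (simp add: divide_inverse mult.commute)
    qed
    then have e: "exp (- a * (norm x)\<^sup>2) * ?y ^ (n + m) \<le> ?K"
    proof -
      have "exp (a * ?y) = exp a * exp (a * (norm x)\<^sup>2)" by (simp add: distrib_left exp_add)
      then have "a ^ (n + m) * ?y ^ (n + m) \<le> exp a * exp (a * (norm x)\<^sup>2) * fact (n + m)"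
        using \<open>(a * ?y) ^ (n + m) / fact (n + m) \<le> exp (a * ?y)\<close>
        by (simp only: power_mult_distrib) (simp add: divide_le_eq)
      then have "exp (- a * (norm x)\<^sup>2) * (a ^ (n + m) * ?y ^ (n + m)) \<le> exp a * fact (n + m)"
        by (simp add: exp_minus divide_simps) (simp add: mult_ac)
      then show ?thesis using assms by (simp add: pos_le_divide_eq mult_ac)
    qed
    have "\<bar>p x\<bar> * exp (- a * (norm x)\<^sup>2) * ?y ^ n \<le> (C * ?y ^ m) * exp (- a * (norm x)\<^sup>2) * ?y ^ n"
      using C y by (intro mult_right_mono) auto
    also have "\<dots> = C * (exp (- a * (norm x)\<^sup>2) * ?y ^ (n + m))" by (simp add: power_add)
    also have "\<dots> \<le> C * ?K" using C(1) e by (intro mult_left_mono)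
    finally have "\<bar>p x\<bar> * exp (- a * (norm x)\<^sup>2) \<le> C * ?K / ?y ^ n"
      unfolding pos_le_divide_eq[OF zero_less_power[OF y]] .
    then show "norm (iter_partial_deriv vs (\<lambda>x::'a. c * exp (- a * (norm x)\<^sup>2)) x) \<le> C * ?K / ?y ^ n"
      unfolding p(2) by (simp add: abs_mult)
  qed
qed

section \<open>Fourier transforms and their decay\<close>

definition chi :: "'a::euclidean_space \<Rightarrow> 'a \<Rightarrow> complex" where
  "chi x \<xi> = exp (- (2 * of_real pi * \<i> * of_real (x \<bullet> \<xi>)))"

text \<open>
The Fourier transform of the signed measure with density \<open>z\<close> with respect to \<open>M\<close>. The measure \<open>M\<close> is
Lebesgue measure when \<open>z\<close> is a Schwartz function, and \<open>\<Gamma> t\<close> when \<open>z\<close> is a realization of \<open>Z\<close> at time \<open>t\<close>.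
Since the character has modulus one, integrability does not depend on the frequency, and \<open>FT M z\<close>
vanishes identically if \<open>z\<close> is not integrable.
\<close>
definition FT :: "'a::euclidean_space measure \<Rightarrow> ('a \<Rightarrow> real) \<Rightarrow> 'a \<Rightarrow> complex" where
  "FT M z \<xi> = (LINT x|M. chi x \<xi> * of_real (z x))"

lemma fourier_measure_eq_FT: "fourier_measure M = FT M (\<lambda>_. 1)"
  by (simp add: fun_eq_iff fourier_measure_def FT_def chi_def)

lemma norm_chi [simp]: "cmod (chi x \<xi>) = 1"
  by (simp add: chi_def norm_exp_eq_Re)

lemma chi_add: "chi (x + y) \<xi> = chi x \<xi> * chi y \<xi>"
  by (simp add: chi_def inner_add_left distrib_left exp_add[symmetric])

lemma chi_minus: "chi (- x) \<xi> = cnj (chi x \<xi>)"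
  by (simp add: chi_def exp_cnj)

lemma chi_diff: "chi (x - y) \<xi> = chi x \<xi> * cnj (chi y \<xi>)"
  using chi_add[of x "- y" \<xi>] by (simp add: chi_minus)

lemma continuous_on_chi: "continuous_on A (\<lambda>x. chi x \<xi>)"
  unfolding chi_def by (intro continuous_intros)

lemma borel_measurable_chi [measurable (raw)]:
  assumes [measurable]: "g \<in> borel_measurable M" "h \<in> borel_measurable M"
  shows "(\<lambda>x. chi (g x) (h x)) \<in> borel_measurable M"
  unfolding chi_def by measurable

lemma FT_measurable [measurable]:
  assumes [measurable]: "sigma_finite_measure M" "z \<in> borel_measurable M" and s[measurable_cong]: "sets M = sets borel"
  shows "FT M z \<in> borel_measurable borel"
proof -
  interpret sigma_finite_measure M by fact
  show ?thesis unfolding FT_def by measurable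
qed

lemma norm_FT_le: "cmod (FT M z \<xi>) \<le> (LINT x|M. \<bar>z x\<bar>)"
  unfolding FT_def by (rule order_trans[OF integral_norm_bound]) (simp add: norm_mult)

lemma integrable_chi_mult:
  assumes "integrable M z" "sets M = sets borel"
  shows "integrable M (\<lambda>x. chi x \<xi> * of_real (z x))"
proof (rule Bochner_Integration.integrable_bound[OF assms(1)])
  have [measurable]: "z \<in> borel_measurable M" using assms(1) by simp
  note [measurable_cong] = assms(2)
  show "(\<lambda>x. chi x \<xi> * complex_of_real (z x)) \<in> borel_measurable M" by measurable
qed (simp add: norm_mult)

lemma lborel_integral_translate:
  fixes g :: "'a::euclidean_space \<Rightarrow> 'b::{banach, second_countable_topology}"
  assumes [measurable]: "g \<in> borel_measurable borel"
  shows "(LINT x|lborel. g (x + c)) = (LINT x|lborel. g x)"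
proof -
  have "(LINT x|lborel. g x) = (LINT x|distr lborel borel ((+) c). g x)"
    by (simp add: lborel_distr_plus)
  also have "\<dots> = (LINT x|lborel. g (c + x))" by (subst integral_distr) auto
  finally show ?thesis by (simp add: add.commute)
qed

lemma lborel_distr_reflect: "distr lborel borel (\<lambda>x. c - x) = (lborel :: 'a::euclidean_space measure)"
  using lborel_affine[of "-1" c] by (simp add: density_1)

lemma lborel_integral_reflect:
  fixes g :: "'a::euclidean_space \<Rightarrow> 'b::{banach, second_countable_topology}"
  assumes [measurable]: "g \<in> borel_measurable borel"
  shows "(LINT x|lborel. g (c - x)) = (LINT x|lborel. g x)"
proof -
  have "(LINT x|lborel. g x) = (LINT x|distr lborel borel (\<lambda>x. c - x). g x)"
    by (simp add: lborel_distr_reflect)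
  also have "\<dots> = (LINT x|lborel. g (c - x))" by (subst integral_distr) auto
  finally show ?thesis by simp
qed

text \<open>
Lebesgue measure on a Euclidean space is the image of a product measure, so integrals of products of
functions of one coordinate each factor.
\<close>
lemma lborel_prod:
  fixes g :: "'a::euclidean_space \<Rightarrow> real \<Rightarrow> 'b::{real_normed_field,banach,second_countable_topology}"
  assumes "\<And>b. b \<in> Basis \<Longrightarrow> integrable lborel (g b)"
  shows lborel_integrable_prod: "integrable lborel (\<lambda>x::'a. \<Prod>b\<in>Basis. g b (x \<bullet> b))"
    and lborel_integral_prod: "(LINT x::'a|lborel. (\<Prod>b\<in>Basis. g b (x \<bullet> b))) = (\<Prod>b\<in>Basis. LINT t|lborel. g b t)"
proof -
  interpret product_sigma_finite "\<lambda>_::'a. lborel::real measure"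
    by standard
  have m: "(\<lambda>x::'a. \<Prod>b\<in>Basis. g b (x \<bullet> b)) \<in> borel_measurable borel"
  proof (intro borel_measurable_prod)
    fix b :: 'a assume "b \<in> Basis"
    then have [measurable]: "g b \<in> borel_measurable borel" using assms by fastforce
    show "(\<lambda>x::'a. g b (x \<bullet> b)) \<in> borel_measurable borel" by measurable
  qed
  have c: "(\<Prod>b\<in>Basis. g b ((\<Sum>b'\<in>Basis. y b' *\<^sub>R b') \<bullet> b)) = (\<Prod>b\<in>Basis. g b (y b))" for y :: "'a \<Rightarrow> real"
    by (intro prod.cong refl) simp
  show "integrable lborel (\<lambda>x::'a. \<Prod>b\<in>Basis. g b (x \<bullet> b))"
    by (subst lborel_eq, subst integrable_distr_eq[OF _ m])
       (auto simp: c assms intro!: product_integrable_prod)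
  show "(LINT x::'a|lborel. (\<Prod>b\<in>Basis. g b (x \<bullet> b))) = (\<Prod>b\<in>Basis. LINT t|lborel. g b t)"
    by (subst lborel_eq, subst integral_distr[OF _ m])
       (auto simp: c assms intro!: product_integral_prod)
qed

lemma integrable_one_div_one_plus_square: "integrable lborel (\<lambda>x::real. 1 / (1 + x\<^sup>2))"
proof -
  have "set_integrable lborel {0<..} (\<lambda>x::real. 1 / (1 + x\<^sup>2))"
    using integrable_I0i_1_div_plus_square by (simp add: interval_lebesgue_integrable_def zero_ereal_def)
  then have i: "integrable lborel (\<lambda>x::real. indicator {0<..} x * (1 / (1 + x\<^sup>2)))"
    by (simp add: set_integrable_def)
  have j: "integrable lborel (\<lambda>x::real. indicator {0<..} (- x) * (1 / (1 + x\<^sup>2)))"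
    using lborel_integrable_real_affine[OF i, of "-1" 0] by simp
  have "AE x::real in lborel. x \<noteq> 0" using AE_lborel_singleton[of 0] by simp
  then have "AE x::real in lborel. 1 / (1 + x\<^sup>2) = indicator {0<..} x * (1 / (1 + x\<^sup>2)) + indicator {0<..} (- x) * (1 / (1 + x\<^sup>2))"
    by eventually_elim (auto simp: indicator_def)
  with Bochner_Integration.integrable_add[OF i j] show ?thesis
    by (subst integrable_cong_AE) auto
qed

lemma integrable_one_plus_norm_square:
  "integrable lborel (\<lambda>x::'a::euclidean_space. C / (1 + (norm x)\<^sup>2) ^ DIM('a))"
proof -
  \<comment> \<open>Each factor \<open>1 + |x|\<^sup>2\<close> is paired with one coordinate.\<close>
  have "integrable lborel (\<lambda>x::'a. C * (\<Prod>b\<in>Basis. 1 / (1 + (x \<bullet> b)\<^sup>2)))"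
    by (intro integrable_mult_right lborel_integrable_prod integrable_one_div_one_plus_square)
  then show ?thesis
  proof (rule Bochner_Integration.integrable_bound)
    show "AE x::'a in lborel. norm (C / (1 + (norm x)\<^sup>2) ^ DIM('a)) \<le> norm (C * (\<Prod>b\<in>Basis. 1 / (1 + (x \<bullet> b)\<^sup>2)))"
    proof (rule AE_I2)
      fix x :: 'a
      have "(\<Prod>b\<in>(Basis::'a set). 1 / (1 + (norm x)\<^sup>2)) \<le> (\<Prod>b\<in>Basis. 1 / (1 + (x \<bullet> b)\<^sup>2))"
        by (intro prod_mono conjI frac_le add_left_mono)
           (auto simp: Basis_le_norm abs_le_square_iff[symmetric] intro!: add_pos_nonneg)
      then have *: "1 / (1 + (norm x)\<^sup>2) ^ DIM('a) \<le> \<bar>\<Prod>b\<in>Basis. 1 / (1 + (x \<bullet> b)\<^sup>2)\<bar>"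
        by (simp add: power_one_over)
      have "norm (C / (1 + (norm x)\<^sup>2) ^ DIM('a)) = \<bar>C\<bar> * (1 / (1 + (norm x)\<^sup>2) ^ DIM('a))"
        by (simp add: add_nonneg_nonneg)
      also have "\<dots> \<le> \<bar>C\<bar> * \<bar>\<Prod>b\<in>Basis. 1 / (1 + (x \<bullet> b)\<^sup>2)\<bar>"
        by (intro mult_left_mono * abs_ge_zero)
      finally show "norm (C / (1 + (norm x)\<^sup>2) ^ DIM('a)) \<le> norm (C * (\<Prod>b\<in>Basis. 1 / (1 + (x \<bullet> b)\<^sup>2)))"
        by (simp add: abs_mult)
    qed
  qed measurable
qed

lemma schwartz_integrable:
  fixes \<phi> :: "'a::euclidean_space \<Rightarrow> 'b::{banach, second_countable_topology}"
  assumes "schwartz \<phi>"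
  shows "integrable lborel \<phi>"
proof -
  obtain C where C: "0 \<le> C" "\<And>x. norm (\<phi> x) \<le> C / (1 + (norm x)\<^sup>2) ^ DIM('a)"
    using schwartz_bound[OF assms, of "[]"] by auto
  show ?thesis
    by (rule Bochner_Integration.integrable_bound[OF integrable_one_plus_norm_square[of C]])
       (use C schwartz_borel_measurable[OF assms] in \<open>auto intro!: AE_I2 simp: add_nonneg_nonneg\<close>)
qed

lemma schwartz_has_line_derivative:
  fixes \<phi> :: "'a::euclidean_space \<Rightarrow> real"
  assumes "schwartz \<phi>"
  shows "((\<lambda>s. \<phi> (x + s *\<^sub>R b)) has_real_derivative partial_deriv b \<phi> (x + s *\<^sub>R b)) (at s)"
proof -
  let ?D = "frechet_derivative \<phi> (at (x + s *\<^sub>R b))"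
  have d: "(\<phi> has_derivative ?D) (at (x + s *\<^sub>R b))"
    using schwartz_differentiable[OF assms] by (simp flip: frechet_derivative_works)
  have a: "((\<lambda>s. x + s *\<^sub>R b) has_derivative (\<lambda>h. h *\<^sub>R b)) (at s)"
    by (auto intro!: derivative_eq_intros)
  have "((\<lambda>s. \<phi> (x + s *\<^sub>R b)) has_derivative (\<lambda>h. ?D (h *\<^sub>R b))) (at s)"
    using has_derivative_compose[OF a d] .
  moreover have "?D (h *\<^sub>R b) = partial_deriv b \<phi> (x + s *\<^sub>R b) * h" for h
    using has_derivative_linear[OF d] by (simp add: linear_cmul partial_deriv_def)
  ultimately show ?thesis by (simp add: has_field_derivative_def)
qed

text \<open>
Translation invariance of Lebesgue measure replaces integration by parts: translating \<open>\<phi>\<close> by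
\<open>t b\<close> multiplies its transform by an exponential, and the identity is differentiated at \<open>t = 0\<close> under
the integral sign.
\<close>
lemma FT_partial_deriv:
  fixes \<phi> :: "'a::euclidean_space \<Rightarrow> real"
  assumes \<phi>: "schwartz \<phi>" and b: "b \<in> Basis"
  shows "FT lborel (partial_deriv b \<phi>) \<xi> = 2 * of_real pi * \<i> * of_real (b \<bullet> \<xi>) * FT lborel \<phi> \<xi>"
proof (rule LIMSEQ_unique)
  define t :: "nat \<Rightarrow> real" where "t n = 1 / real (Suc n)" for n
  have t: "0 < t n" "t n \<le> 1" for n by (auto simp: t_def)
  have t0: "t \<longlonglongrightarrow> 0" unfolding t_def by (rule LIMSEQ_Suc[OF lim_1_over_n])
  have t_at: "filterlim t (at 0) sequentially"
    using t0 t(1) by (auto simp: filterlim_at eventually_sequentially dest: less_imp_neq[symmetric])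
  define D where "D n x = (\<phi> (x + t n *\<^sub>R b) - \<phi> x) / t n" for n x
  note [measurable] = schwartz_borel_measurable[OF \<phi>] schwartz_borel_measurable[OF schwartz_partial_deriv[OF \<phi> b]]
  obtain C where C: "0 \<le> C" "\<And>x. norm (partial_deriv b \<phi> x) \<le> C / (1 + (norm x)\<^sup>2) ^ DIM('a)"
    using schwartz_bound[OF schwartz_partial_deriv[OF \<phi> b], of "[]"] by auto
  \<comment> \<open>The mean value theorem and Peetre's inequality give a majorant of the difference quotients. The
    point moves by at most 1, whence the constant 4.\<close>
  have bound: "\<bar>D n x\<bar> \<le> C * 4 ^ DIM('a) / (1 + (norm x)\<^sup>2) ^ DIM('a)" for n x
  proof -
    obtain z where z: "0 < z" "z < t n" "\<phi> (x + t n *\<^sub>R b) - \<phi> (x + 0 *\<^sub>R b) = (t n - 0) * partial_deriv b \<phi> (x + z *\<^sub>R b)"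
      using MVT2[OF t(1)[of n] schwartz_has_line_derivative[OF \<phi>, of x b]] by blast
    then have "\<bar>D n x\<bar> = norm (partial_deriv b \<phi> (x + z *\<^sub>R b))"
      using t(1)[of n] by (simp add: D_def)
    also have "\<dots> \<le> C / (1 + (norm (x + z *\<^sub>R b))\<^sup>2) ^ DIM('a)" by (rule C)
    also have "\<dots> \<le> C * 4 ^ DIM('a) / (1 + (norm x)\<^sup>2) ^ DIM('a)"
    proof (rule divide_le_mult_divide[OF C(1)])
      have "norm (- (z *\<^sub>R b)) \<le> 1" using z t(2)[of n] b by simp
      then have "2 * (1 + (norm (- (z *\<^sub>R b)))\<^sup>2) \<le> 4" by (simp add: power_le_one)
      then have "2 * (1 + (norm (- (z *\<^sub>R b)))\<^sup>2) * (1 + (norm (x + z *\<^sub>R b))\<^sup>2) \<le> 4 * (1 + (norm (x + z *\<^sub>R b))\<^sup>2)"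
        by (intro mult_right_mono) auto
      then have "1 + (norm x)\<^sup>2 \<le> 4 * (1 + (norm (x + z *\<^sub>R b))\<^sup>2)"
        using norm_shift_bound[of "x + z *\<^sub>R b" "- (z *\<^sub>R b)"] by simp
      then show "(1 + (norm x)\<^sup>2) ^ DIM('a) \<le> 4 ^ DIM('a) * (1 + (norm (x + z *\<^sub>R b))\<^sup>2) ^ DIM('a)"
        unfolding power_mult_distrib[symmetric] by (intro power_mono) auto
    qed (auto intro!: zero_less_power add_pos_nonneg)
    finally show ?thesis .
  qed
  have lim: "(\<lambda>n. D n x) \<longlonglongrightarrow> partial_deriv b \<phi> x" for x
  proof -
    have "((\<lambda>h. (\<phi> (x + (0 + h) *\<^sub>R b) - \<phi> (x + 0 *\<^sub>R b)) / h) \<longlongrightarrow> partial_deriv b \<phi> (x + 0 *\<^sub>R b)) (at 0)"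
      using DERIV_D[OF schwartz_has_line_derivative[OF \<phi>, of x b 0]] by simp
    from filterlim_compose[OF this t_at] show ?thesis by (simp add: D_def)
  qed
  show "(\<lambda>n. LINT x|lborel. chi x \<xi> * of_real (D n x)) \<longlonglongrightarrow> FT lborel (partial_deriv b \<phi>) \<xi>"
    unfolding FT_def
  proof (rule integral_dominated_convergence[where w = "\<lambda>x. C * 4 ^ DIM('a) / (1 + (norm x)\<^sup>2) ^ DIM('a)"])
    show "integrable lborel (\<lambda>x::'a. C * 4 ^ DIM('a) / (1 + (norm x)\<^sup>2) ^ DIM('a))"
      by (rule integrable_one_plus_norm_square)
    show "(\<lambda>x. chi x \<xi> * complex_of_real (D n x)) \<in> borel_measurable lborel" for n
      unfolding D_def by measurable
  qed (auto intro!: AE_I2 tendsto_intros lim simp: norm_mult bound)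
  have i: "integrable lborel (\<lambda>x. chi x \<xi> * of_real (\<phi> x))" for \<xi>
    by (intro integrable_chi_mult schwartz_integrable \<phi>) simp
  have sch: "schwartz (\<lambda>x. \<phi> (x + y))" for y using schwartz_translate[OF \<phi>, of "- y"] by simp
  have j: "integrable lborel (\<lambda>x. chi x \<xi> * of_real (\<phi> (x + y)))" for \<xi> y
    by (intro integrable_chi_mult schwartz_integrable sch) simp
  have "(LINT x|lborel. chi x \<xi> * of_real (D n x)) =
        ((exp (of_real (t n) * (2 * of_real pi * \<i> * of_real (b \<bullet> \<xi>))) - 1) / of_real (t n)) * FT lborel \<phi> \<xi>" for n
  proof -
    let ?y = "t n *\<^sub>R b"
    have "(LINT x|lborel. chi x \<xi> * of_real (D n x)) =
       (LINT x|lborel. (chi x \<xi> * of_real (\<phi> (x + ?y)) - chi x \<xi> * of_real (\<phi> x)) / of_real (t n))"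
      by (intro Bochner_Integration.integral_cong) (auto simp: D_def field_simps)
    also have "\<dots> = ((LINT x|lborel. chi x \<xi> * of_real (\<phi> (x + ?y))) - FT lborel \<phi> \<xi>) / of_real (t n)"
      using i j by (simp add: FT_def)
    also have "(LINT x|lborel. chi x \<xi> * of_real (\<phi> (x + ?y))) = (LINT x|lborel. chi (- ?y) \<xi> * (chi (x + ?y) \<xi> * of_real (\<phi> (x + ?y))))"
      by (intro Bochner_Integration.integral_cong) (auto simp: chi_add[symmetric])
    also have "\<dots> = chi (- ?y) \<xi> * FT lborel \<phi> \<xi>"
      unfolding FT_def using i lborel_integral_translate[of "\<lambda>x. chi x \<xi> * of_real (\<phi> x)" ?y]
      by (subst integral_mult_right_zero) auto
    also have "chi (- ?y) \<xi> = exp (of_real (t n) * (2 * of_real pi * \<i> * of_real (b \<bullet> \<xi>)))"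
      by (simp add: chi_def mult_ac)
    finally show ?thesis by (simp add: diff_divide_distrib left_diff_distrib)
  qed
  moreover have "(\<lambda>n. ((exp (of_real (t n) * c) - 1) / of_real (t n)) * FT lborel \<phi> \<xi>) \<longlonglongrightarrow> c * FT lborel \<phi> \<xi>" for c
  proof (intro tendsto_intros)
    have "((\<lambda>z. exp (z * c)) has_field_derivative c) (at 0)"
      by (auto intro!: derivative_eq_intros)
    then have d: "((\<lambda>h. (exp (h * c) - 1) / h) \<longlongrightarrow> c) (at 0)" by (auto dest!: DERIV_D)
    have "filterlim (\<lambda>n. complex_of_real (t n)) (at 0) sequentially"
      using tendsto_of_real[OF t0, where 'a=complex] t(1) by (auto simp: filterlim_at eventually_sequentially dest: less_imp_neq[symmetric])
    from filterlim_compose[OF d this]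
    show "(\<lambda>n. ((exp (of_real (t n) * c) - 1) / of_real (t n))) \<longlonglongrightarrow> c" .
  qed
  ultimately show "(\<lambda>n. LINT x|lborel. chi x \<xi> * of_real (D n x)) \<longlonglongrightarrow> 2 * of_real pi * \<i> * of_real (b \<bullet> \<xi>) * FT lborel \<phi> \<xi>"
    by presburger
qed

text \<open>
The induction runs over all Schwartz functions at once: one factor \<open>|\<xi>|\<close> is bounded by the sum of the
\<open>|\<xi> \<bullet> b|\<close>, and each of these is traded for a partial derivative.
\<close>
lemma FT_schwartz_decay_norm:
  fixes \<phi> :: "'a::euclidean_space \<Rightarrow> real"
  assumes "schwartz \<phi>"
  shows "\<exists>C. \<forall>\<xi>. norm \<xi> ^ k * cmod (FT lborel \<phi> \<xi>) \<le> C"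
  using assms
proof (induction k arbitrary: \<phi>)
  case 0
  then show ?case using norm_FT_le by auto
next
  case (Suc k)
  have "\<exists>C. \<forall>\<xi>. norm \<xi> ^ k * cmod (FT lborel (partial_deriv b \<phi>) \<xi>) \<le> C" if "b \<in> Basis" for b
    using Suc that schwartz_partial_deriv by blast
  then obtain C where C: "\<And>b \<xi>. b \<in> Basis \<Longrightarrow> norm \<xi> ^ k * cmod (FT lborel (partial_deriv b \<phi>) \<xi>) \<le> C b"
    by metis
  have "norm \<xi> ^ Suc k * cmod (FT lborel \<phi> \<xi>) \<le> (\<Sum>b\<in>Basis. C b)" for \<xi>
  proof -
    have "norm \<xi> * (norm \<xi> ^ k * cmod (FT lborel \<phi> \<xi>)) \<le> (\<Sum>b\<in>Basis. \<bar>\<xi> \<bullet> b\<bar>) * (norm \<xi> ^ k * cmod (FT lborel \<phi> \<xi>))"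
      by (intro mult_right_mono norm_le_l1) auto
    also have "\<dots> = (\<Sum>b\<in>Basis. \<bar>\<xi> \<bullet> b\<bar> * (norm \<xi> ^ k * cmod (FT lborel \<phi> \<xi>)))"
      by (simp add: sum_distrib_right)
    also have "\<dots> \<le> (\<Sum>b\<in>Basis. C b)"
    proof (rule sum_mono)
      fix b :: 'a assume b: "b \<in> Basis"
      have "\<bar>\<xi> \<bullet> b\<bar> * (norm \<xi> ^ k * cmod (FT lborel \<phi> \<xi>)) \<le> (2 * pi) * (\<bar>\<xi> \<bullet> b\<bar> * (norm \<xi> ^ k * cmod (FT lborel \<phi> \<xi>)))"
        using pi_ge_two mult_right_mono[of 1 "2 * pi" "\<bar>\<xi> \<bullet> b\<bar> * (norm \<xi> ^ k * cmod (FT lborel \<phi> \<xi>))"] by simp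
      also have "\<dots> = norm \<xi> ^ k * cmod (FT lborel (partial_deriv b \<phi>) \<xi>)"
        by (simp add: FT_partial_deriv[OF Suc.prems b] norm_mult inner_commute)
      finally show "\<bar>\<xi> \<bullet> b\<bar> * (norm \<xi> ^ k * cmod (FT lborel \<phi> \<xi>)) \<le> C b" using C[OF b, of \<xi>] by linarith
    qed
    finally show ?thesis by (simp add: mult.assoc)
  qed
  then show ?case by blast
qed

lemma FT_schwartz_decay:
  fixes \<phi> :: "'a::euclidean_space \<Rightarrow> real"
  assumes "schwartz \<phi>"
  obtains C where "0 \<le> C" "\<And>\<xi>. cmod (FT lborel \<phi> \<xi>) \<le> C * (1 / (1 + (norm \<xi>)\<^sup>2) ^ m)"
proof -
  obtain A where A: "\<And>\<xi>. norm \<xi> ^ 0 * cmod (FT lborel \<phi> \<xi>) \<le> A"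
    using FT_schwartz_decay_norm[OF assms] by blast
  obtain B where B: "\<And>\<xi>. norm \<xi> ^ (2 * m) * cmod (FT lborel \<phi> \<xi>) \<le> B"
    using FT_schwartz_decay_norm[OF assms] by blast
  have "0 \<le> A" by (rule order_trans[OF _ A[of 0]]) simp
  have "0 \<le> B" by (rule order_trans[OF _ B[of 0]]) simp
  show ?thesis
  proof (rule that[of "2 ^ m * (A + B)"])
    fix \<xi> :: 'a
    let ?N = "cmod (FT lborel \<phi> \<xi>)"
    have "(1 + (norm \<xi>)\<^sup>2) ^ m * ?N \<le> 2 ^ m * (1 + norm \<xi> ^ (2 * m)) * ?N"
      using one_plus_power_le[of "(norm \<xi>)\<^sup>2" m] by (intro mult_right_mono) (auto simp: power_mult)
    also have "\<dots> = 2 ^ m * (?N + norm \<xi> ^ (2 * m) * ?N)" by (simp add: algebra_simps)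
    also have "\<dots> \<le> 2 ^ m * (A + B)" using A[of \<xi>] B[of \<xi>] by (intro mult_left_mono add_mono) auto
    finally show "?N \<le> 2 ^ m * (A + B) * (1 / (1 + (norm \<xi>)\<^sup>2) ^ m)"
      by (simp add: pos_le_divide_eq add_pos_nonneg mult.commute)
  qed (use \<open>0 \<le> A\<close> \<open>0 \<le> B\<close> in auto)
qed

text \<open>
Scaling reduces this to the characteristic function of the standard normal distribution.
\<close>
lemma fourier_normal_density:
  assumes "0 < \<sigma>"
  shows "(LINT x|lborel. exp (- (2 * of_real pi * \<i> * of_real (x * t))) * of_real (normal_density 0 \<sigma> x)) =
         complex_of_real (exp (- 2 * pi\<^sup>2 * \<sigma>\<^sup>2 * t\<^sup>2))"
proof -
  let ?g = "\<lambda>x. exp (- (2 * of_real pi * \<i> * of_real (x * t))) * complex_of_real (normal_density 0 \<sigma> x)"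
  have "(LINT x|lborel. ?g x) = \<bar>\<sigma>\<bar> *\<^sub>R (LINT x|lborel. ?g (0 + \<sigma> * x))"
    by (rule lborel_integral_real_affine) (use assms in auto)
  also have "\<dots> = (LINT x|lborel. of_real \<sigma> * ?g (0 + \<sigma> * x))"
    using assms by (simp add: scaleR_conv_of_real)
  also have "\<dots> = (LINT x|lborel. std_normal_density x *\<^sub>R iexp ((- 2 * pi * \<sigma> * t) * x))"
    using assms by (intro Bochner_Integration.integral_cong)
      (auto simp: normal_density_def scaleR_conv_of_real real_sqrt_mult field_simps power_mult_distrib)
  also have "\<dots> = char std_normal_distribution (- 2 * pi * \<sigma> * t)"
    unfolding char_def by (subst integral_density) (auto simp: scaleR_conv_of_real)
  also have "\<dots> = complex_of_real (exp (- 2 * pi\<^sup>2 * \<sigma>\<^sup>2 * t\<^sup>2))"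
    unfolding char_std_normal_distribution by (simp add: power2_eq_square)
  finally show ?thesis .
qed

definition gauss :: "real \<Rightarrow> 'a::euclidean_space \<Rightarrow> real" where
  "gauss \<sigma> x = (\<Prod>b\<in>Basis. normal_density 0 \<sigma> (x \<bullet> b))"

text \<open>
The product form of \<open>gauss\<close> gives its Fourier transform, the radial form that it is a Schwartz function.
\<close>
lemma gauss_eq:
  fixes x :: "'a::euclidean_space"
  shows "gauss \<sigma> x = (1 / sqrt (2 * pi * \<sigma>\<^sup>2)) ^ DIM('a) * exp (- (1 / (2 * \<sigma>\<^sup>2)) * (norm x)\<^sup>2)"
proof -
  have "(\<Prod>b\<in>Basis. exp (- (x \<bullet> b)\<^sup>2 / (2 * \<sigma>\<^sup>2))) = exp (\<Sum>b\<in>Basis. - (x \<bullet> b)\<^sup>2 / (2 * \<sigma>\<^sup>2))"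
    by (simp add: exp_sum)
  also have "(\<Sum>b\<in>Basis. - (x \<bullet> b)\<^sup>2 / (2 * \<sigma>\<^sup>2)) = - (1 / (2 * \<sigma>\<^sup>2)) * (norm x)\<^sup>2"
    unfolding power2_norm_eq_inner euclidean_inner[of x x]
    by (simp add: sum_divide_distrib sum_negf power2_eq_square)
  finally show ?thesis
    by (simp add: gauss_def normal_density_def prod_dividef power_one_over)
qed

lemma schwartz_gauss:
  assumes "0 < \<sigma>" shows "schwartz (gauss \<sigma> :: 'a::euclidean_space \<Rightarrow> real)"
proof -
  have "schwartz (\<lambda>x::'a. (1 / sqrt (2 * pi * \<sigma>\<^sup>2)) ^ DIM('a) * exp (- (1 / (2 * \<sigma>\<^sup>2)) * (norm x)\<^sup>2))"
    using assms by (intro schwartz_gaussian) simp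
  then show ?thesis unfolding gauss_eq[symmetric] .
qed

lemma gauss_nonneg: "0 \<le> gauss \<sigma> x"
  by (simp add: gauss_def prod_nonneg)

lemma FT_gauss:
  fixes \<xi> :: "'a::euclidean_space"
  assumes "0 < \<sigma>"
  shows "FT lborel (gauss \<sigma>) \<xi> = of_real (exp (- 2 * pi\<^sup>2 * \<sigma>\<^sup>2 * (norm \<xi>)\<^sup>2))"
proof -
  let ?g = "\<lambda>b t. exp (- (2 * of_real pi * \<i> * of_real (t * (\<xi> \<bullet> b)))) * complex_of_real (normal_density 0 \<sigma> t)"
  have "FT lborel (gauss \<sigma>) \<xi> = (LINT x|lborel. (\<Prod>b\<in>Basis. ?g b (x \<bullet> b)))"
    unfolding FT_def
  proof (intro Bochner_Integration.integral_cong refl)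
    fix x :: 'a
    have "chi x \<xi> = (\<Prod>b\<in>Basis. exp (- (2 * of_real pi * \<i> * of_real ((x \<bullet> b) * (\<xi> \<bullet> b)))))"
      unfolding chi_def euclidean_inner[of x \<xi>] by (simp add: exp_sum[symmetric] sum_negf sum_distrib_left)
    then show "chi x \<xi> * of_real (gauss \<sigma> x) = (\<Prod>b\<in>Basis. ?g b (x \<bullet> b))"
      by (simp add: gauss_def prod.distrib)
  qed
  also have "\<dots> = (\<Prod>b\<in>Basis. LINT t|lborel. ?g b t)"
  proof (rule lborel_integral_prod)
    fix b :: 'a
    show "integrable lborel (?g b)"
      by (rule Bochner_Integration.integrable_bound[OF integrable_normal_moment[OF assms, of 0 0, simplified]])
         (auto simp: norm_mult norm_exp_eq_Re)
  qed
  also have "\<dots> = (\<Prod>b\<in>Basis. complex_of_real (exp (- 2 * pi\<^sup>2 * \<sigma>\<^sup>2 * (\<xi> \<bullet> b)\<^sup>2)))"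
    using fourier_normal_density[OF assms] by (intro prod.cong) auto
  also have "\<dots> = of_real (\<Prod>b\<in>Basis. exp (- 2 * pi\<^sup>2 * \<sigma>\<^sup>2 * (\<xi> \<bullet> b)\<^sup>2))" by simp
  also have "(\<Prod>b\<in>Basis. exp (- 2 * pi\<^sup>2 * \<sigma>\<^sup>2 * (\<xi> \<bullet> b)\<^sup>2)) = exp (- 2 * pi\<^sup>2 * \<sigma>\<^sup>2 * (norm \<xi>)\<^sup>2)"
    unfolding power2_norm_eq_inner euclidean_inner[of \<xi> \<xi>]
    by (simp add: exp_sum[symmetric] sum_negf sum_distrib_left power2_eq_square)
  finally show ?thesis .
qed

lemma FT_translate:
  fixes \<phi> :: "'a::euclidean_space \<Rightarrow> real"
  assumes [measurable]: "\<phi> \<in> borel_measurable borel"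
  shows "FT lborel (\<lambda>z. \<phi> (z - q)) \<xi> = chi q \<xi> * FT lborel \<phi> \<xi>"
proof -
  have "FT lborel (\<lambda>z. \<phi> (z - q)) \<xi> = (LINT x|lborel. chi (x + q) \<xi> * of_real (\<phi> ((x + q) - q)))"
    unfolding FT_def by (rule lborel_integral_translate[symmetric]) measurable
  also have "\<dots> = (LINT x|lborel. chi q \<xi> * (chi x \<xi> * of_real (\<phi> x)))"
    by (intro Bochner_Integration.integral_cong) (auto simp: chi_add)
  finally show ?thesis unfolding FT_def by simp
qed

section \<open>The spectral measure and its energy\<close>

text \<open>
The integrable weight is bounded below on every ball.
\<close>
lemma tempered_measure_sigma_finite:
  assumes "tempered_measure \<mu>"
  shows "sigma_finite_measure \<mu>"
proof -
  obtain m :: nat where s: "sets \<mu> = sets borel" and m: "(\<integral>\<^sup>+ \<xi>. ennreal (1 / (1 + (norm \<xi>)\<^sup>2) ^ m) \<partial>\<mu>) < \<infinity>"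
    using assms by (auto simp: tempered_measure_def)
  note [measurable_cong] = s
  have sp: "space \<mu> = UNIV" using sets_eq_imp_space_eq[OF s] by simp
  have fin: "emeasure \<mu> (cball 0 (real n)) < \<infinity>" for n
  proof -
    have "emeasure \<mu> (cball 0 (real n)) = (\<integral>\<^sup>+ \<xi>. indicator (cball 0 (real n)) \<xi> \<partial>\<mu>)"
      by (simp add: s)
    also have "\<dots> \<le> (\<integral>\<^sup>+ \<xi>. ennreal ((1 + (real n)\<^sup>2) ^ m) * ennreal (1 / (1 + (norm \<xi>)\<^sup>2) ^ m) \<partial>\<mu>)"
    proof (rule nn_integral_mono)
      fix \<xi> :: 'a
      have "1 \<le> (1 + (real n)\<^sup>2) ^ m * (1 / (1 + (norm \<xi>)\<^sup>2) ^ m)" if "norm \<xi> \<le> real n"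
      proof -
        have "(1 + (norm \<xi>)\<^sup>2) ^ m \<le> (1 + (real n)\<^sup>2) ^ m"
          using that by (intro power_mono add_left_mono) auto
        then show ?thesis by (simp add: pos_le_divide_eq add_pos_nonneg)
      qed
      then show "indicator (cball 0 (real n)) \<xi> \<le> ennreal ((1 + (real n)\<^sup>2) ^ m) * ennreal (1 / (1 + (norm \<xi>)\<^sup>2) ^ m)"
        by (auto simp: indicator_def ennreal_mult[symmetric] simp del: ennreal_1 simp: ennreal_1[symmetric])
    qed
    also have "\<dots> < \<infinity>"
      using m by (subst nn_integral_cmult) (auto simp: ennreal_mult_less_top)
    finally show ?thesis .
  qed
  show ?thesis
  proof
    show "\<exists>A. countable A \<and> A \<subseteq> sets \<mu> \<and> \<Union> A = space \<mu> \<and> (\<forall>a\<in>A. emeasure \<mu> a \<noteq> \<infinity>)"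
    proof (intro exI[of _ "range (\<lambda>n. cball 0 (real n))"] conjI)
      show "\<Union> (range (\<lambda>n. cball (0::'a) (real n))) = space \<mu>"
        using real_arch_simple by (auto simp: sp)
    qed (use fin in \<open>auto simp: s less_top[symmetric]\<close>)
  qed
qed

text \<open>
Fubini's theorem in the form in which the Parseval identities below use it: the kernel is a character,
and the two remaining factors depend on one variable each.
\<close>
lemma integral_swap_kernel:
  fixes u :: "'b \<Rightarrow> complex" and v :: "'c \<Rightarrow> complex"
  assumes "sigma_finite_measure M1" "sigma_finite_measure M2"
    and u: "integrable M1 u" and v: "integrable M2 v"
    and k [measurable]: "(\<lambda>(x, y). k x y) \<in> borel_measurable (M1 \<Otimes>\<^sub>M M2)"
    and b: "\<And>x y. cmod (k x y) \<le> 1"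
  shows "(LINT y|M2. (LINT x|M1. k x y * u x) * v y) = (LINT x|M1. u x * (LINT y|M2. k x y * v y))"
proof -
  interpret M1: sigma_finite_measure M1 by fact
  interpret M2: sigma_finite_measure M2 by fact
  interpret pair_sigma_finite M1 M2 ..
  have [measurable]: "u \<in> borel_measurable M1" "v \<in> borel_measurable M2" using u v by auto
  have "integrable (M1 \<Otimes>\<^sub>M M2) (\<lambda>(x, y). k x y * u x * v y)"
  proof (rule integrableI_bounded)
    have "(\<integral>\<^sup>+ p. ennreal (norm (case p of (x, y) \<Rightarrow> k x y * u x * v y)) \<partial>(M1 \<Otimes>\<^sub>M M2)) \<le>
          (\<integral>\<^sup>+ p. ennreal (cmod (u (fst p))) * ennreal (cmod (v (snd p))) \<partial>(M1 \<Otimes>\<^sub>M M2))"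
    proof (rule nn_integral_mono)
      fix p
      have "cmod (k (fst p) (snd p)) * (cmod (u (fst p)) * cmod (v (snd p))) \<le> 1 * (cmod (u (fst p)) * cmod (v (snd p)))"
        by (intro mult_right_mono b) auto
      then show "ennreal (norm (case p of (x, y) \<Rightarrow> k x y * u x * v y)) \<le> ennreal (cmod (u (fst p))) * ennreal (cmod (v (snd p)))"
        by (auto simp: case_prod_beta norm_mult ennreal_mult[symmetric] mult.assoc intro!: ennreal_leI)
    qed
    also have "\<dots> = (\<integral>\<^sup>+ x. \<integral>\<^sup>+ y. ennreal (cmod (u x)) * ennreal (cmod (v y)) \<partial>M2 \<partial>M1)"
      by (subst M2.nn_integral_fst[symmetric]) auto
    also have "\<dots> = (\<integral>\<^sup>+ x. ennreal (cmod (u x)) \<partial>M1) * (\<integral>\<^sup>+ y. ennreal (cmod (v y)) \<partial>M2)"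
      by (simp add: nn_integral_cmult nn_integral_multc)
    also have "\<dots> < \<infinity>" using u v by (simp add: integrable_iff_bounded ennreal_mult_less_top)
    finally show "(\<integral>\<^sup>+ p. ennreal (norm (case p of (x, y) \<Rightarrow> k x y * u x * v y)) \<partial>(M1 \<Otimes>\<^sub>M M2)) < \<infinity>" .
  qed measurable
  from Fubini_integral[OF this]
  have "(LINT y|M2. LINT x|M1. k x y * u x * v y) = (LINT x|M1. LINT y|M2. u x * (k x y * v y))"
    by (simp add: mult_ac)
  then show ?thesis by (simp only: integral_mult_left_zero integral_mult_right_zero)
qed

definition conv :: "('a::euclidean_space \<Rightarrow> real) \<Rightarrow> ('a \<Rightarrow> real) \<Rightarrow> 'a \<Rightarrow> real" where
  "conv f \<phi> x = (LINT y|lborel. f (x - y) * \<phi> y)"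

lemma ennreal_norm_integral_le:
  fixes g :: "'b \<Rightarrow> 'c::{banach, second_countable_topology}"
  shows "ennreal (norm (LINT x|M. g x)) \<le> (\<integral>\<^sup>+ x. ennreal (norm (g x)) \<partial>M)"
  by (cases "integrable M g") (auto simp: integral_norm_bound_ennreal not_integrable_integral_eq)

lemma cnj_FT: "cnj (FT M z \<xi>) = (LINT x|M. cnj (chi x \<xi>) * of_real (z x))"
  using Bochner_Integration.integral_cnj[of M "\<lambda>x. chi x \<xi> * of_real (z x)"] by (simp add: FT_def)

lemma FT_nonintegrable:
  assumes "z \<in> borel_measurable M" "sets M = sets borel" "\<not> integrable M z"
  shows "FT M z \<xi> = 0"
proof -
  note [measurable_cong] = assms(2)
  have [measurable]: "z \<in> borel_measurable M" by fact
  have "\<not> integrable M (\<lambda>x. chi x \<xi> * complex_of_real (z x))"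
  proof
    assume "integrable M (\<lambda>x. chi x \<xi> * complex_of_real (z x))"
    from Bochner_Integration.integrable_bound[OF this, of z] assms show False by (auto simp: norm_mult)
  qed
  then show ?thesis by (simp add: FT_def not_integrable_integral_eq)
qed

locale spectral_measure =
  fixes f :: "'a::euclidean_space \<Rightarrow> real" and \<mu> :: "'a measure"
  assumes cov: "spatial_covariance f \<mu>"
begin

lemma sets_mu [measurable_cong]: "sets \<mu> = sets borel"
  using cov by (simp add: spatial_covariance_def tempered_measure_def)

lemma space_mu [simp]: "space \<mu> = UNIV"
  using sets_eq_imp_space_eq[OF sets_mu] by simp

sublocale sigma_finite_measure \<mu>
  using cov by (intro tempered_measure_sigma_finite) (simp add: spatial_covariance_def)

lemma f_nonneg: "x \<noteq> 0 \<Longrightarrow> 0 \<le> f x"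
  using cov by (simp add: spatial_covariance_def)

lemma f_measurable [measurable]: "f \<in> borel_measurable borel"
proof -
  have c: "continuous_on (- {0}) f" using cov by (simp add: spatial_covariance_def)
  have "(\<lambda>x. if x \<in> - {0} then f x else f 0) \<in> borel_measurable borel"
    using c by (intro borel_measurable_continuous_on_if) auto
  moreover have "(\<lambda>x. if x \<in> - {0} then f x else f 0) = f" by auto
  ultimately show ?thesis by simp
qed

lemma FT_schwartz_measurable [measurable]: "schwartz \<phi> \<Longrightarrow> FT lborel \<phi> \<in> borel_measurable borel"
  by (rule FT_measurable) (auto intro: schwartz_borel_measurable lborel.sigma_finite_measure_axioms)

lemma FT_schwartz_integrable:
  assumes "schwartz \<phi>" shows "integrable \<mu> (FT lborel \<phi>)"
proof -
  obtain m :: nat where m: "(\<integral>\<^sup>+ \<xi>. ennreal (1 / (1 + (norm \<xi>)\<^sup>2) ^ m) \<partial>\<mu>) < \<infinity>"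
    using cov by (auto simp: spatial_covariance_def tempered_measure_def)
  obtain C where C: "0 \<le> C" "\<And>\<xi>. cmod (FT lborel \<phi> \<xi>) \<le> C * (1 / (1 + (norm \<xi>)\<^sup>2) ^ m)"
    using FT_schwartz_decay[OF assms, of m] by blast
  note [measurable] = FT_schwartz_measurable[OF assms]
  have w: "integrable \<mu> (\<lambda>\<xi>. C * (1 / (1 + (norm \<xi>)\<^sup>2) ^ m))"
    using m by (intro integrable_mult_right integrableI_bounded) (auto simp: add_nonneg_nonneg)
  show ?thesis
    by (rule Bochner_Integration.integrable_bound[OF w]) (use C in \<open>auto simp: add_nonneg_nonneg\<close>)
qed

lemma FT_schwartz_square_integrable:
  assumes "schwartz \<phi>" shows "integrable \<mu> (\<lambda>\<xi>. (cmod (FT lborel \<phi> \<xi>))\<^sup>2)"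
proof -
  note [measurable] = FT_schwartz_measurable[OF assms]
  have "integrable \<mu> (\<lambda>\<xi>. (LINT x|lborel. \<bar>\<phi> x\<bar>) * cmod (FT lborel \<phi> \<xi>))"
    using FT_schwartz_integrable[OF assms] by simp
  then show ?thesis
    by (rule Bochner_Integration.integrable_bound)
       (auto intro!: AE_I2 mult_right_mono norm_FT_le simp: power2_eq_square)
qed

text \<open>
The function \<open>f\<close> is the Fourier transform of \<open>\<mu>\<close> in the sense of distributions only, but its convolution
with a Schwartz function is one pointwise: apply the identity to the reflected translate of \<open>\<phi>\<close>.
Reflection conjugates the transform because \<open>\<phi>\<close> is real.
\<close>
lemma conv_eq_FT:
  assumes "schwartz \<phi>"
  shows "complex_of_real (conv f \<phi> x) = (LINT \<xi>|\<mu>. chi x \<xi> * cnj (FT lborel \<phi> \<xi>))"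
proof -
  note [measurable] = schwartz_borel_measurable[OF assms]
  have "conv f \<phi> x = (LINT y|lborel. (\<lambda>z. f z * \<phi> (x - z)) (x - y))" by (simp add: conv_def)
  also have "\<dots> = (LINT z|lborel. f z * \<phi> (x - z))" by (subst lborel_integral_reflect) measurable
  finally have "complex_of_real (conv f \<phi> x) = (LINT z|lborel. of_real (f z) * of_real (\<phi> (x - z)))"
    by (simp add: integral_complex_of_real[symmetric])
  also have "\<dots> = (LINT \<xi>|\<mu>. fourier (\<lambda>z. of_real (\<phi> (x - z))) \<xi>)"
    using cov schwartz_reflect_complex[OF assms] by (simp add: spatial_covariance_def is_fourier_transform_of_def)
  also have "fourier (\<lambda>z. of_real (\<phi> (x - z))) = (\<lambda>\<xi>. chi x \<xi> * cnj (FT lborel \<phi> \<xi>))"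
  proof (rule ext)
    fix \<xi>
    have "fourier (\<lambda>z. of_real (\<phi> (x - z))) \<xi> = (LINT z|lborel. chi z \<xi> * of_real (\<phi> (x - z)))"
      by (simp add: fourier_def chi_def)
    also have "\<dots> = (LINT y|lborel. (\<lambda>z. chi z \<xi> * of_real (\<phi> (x - z))) (x - y))"
      by (rule lborel_integral_reflect[symmetric]) measurable
    also have "\<dots> = (LINT y|lborel. chi x \<xi> * cnj (chi y \<xi> * of_real (\<phi> y)))"
      by (simp add: chi_diff mult_ac)
    finally show "fourier (\<lambda>z. of_real (\<phi> (x - z))) \<xi> = chi x \<xi> * cnj (FT lborel \<phi> \<xi>)"
      by (simp add: cnj_FT)
  qed
  finally show ?thesis .
qed

lemma conv_measurable [measurable]:
  assumes "schwartz \<phi>" shows "conv f \<phi> \<in> borel_measurable borel"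
proof -
  note [measurable] = schwartz_borel_measurable[OF assms]
  show ?thesis unfolding conv_def by measurable
qed

text \<open>
Parseval's identity between the kernel \<open>f\<close> and its spectral measure. For Lebesgue measure \<open>M\<close> it is the
isometry of the Schwartz space into \<open>L\<^sup>2(\<mu>)\<close>; for \<open>M = \<Gamma> t\<close> it expresses the pairing of
\<open>Z(t,\<cdot>) \<Gamma>(t)\<close> with a Schwartz function.
\<close>
lemma pairing_eq_FT:
  assumes M: "sigma_finite_measure M" and s [measurable_cong]: "sets M = sets borel"
    and z: "integrable M z" and \<phi>: "schwartz \<phi>"
  shows "(LINT x|M. z x * conv f \<phi> x) = Re (LINT \<xi>|\<mu>. FT M z \<xi> * cnj (FT lborel \<phi> \<xi>))"
proof -
  have "(LINT \<xi>|\<mu>. FT M z \<xi> * cnj (FT lborel \<phi> \<xi>)) =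
        (LINT x|M. of_real (z x) * (LINT \<xi>|\<mu>. chi x \<xi> * cnj (FT lborel \<phi> \<xi>)))"
    unfolding FT_def[of M]
    by (rule integral_swap_kernel[OF M sigma_finite_measure_axioms])
       (use z FT_schwartz_integrable[OF \<phi>] in \<open>auto intro!: integrable_cnj\<close>)
  also have "\<dots> = of_real (LINT x|M. z x * conv f \<phi> x)"
    by (simp add: conv_eq_FT[OF \<phi>, symmetric] integral_complex_of_real[symmetric])
  finally show ?thesis by simp
qed

lemma cov_form_eq_FT:
  assumes "schwartz \<phi>" "schwartz \<psi>"
  shows "cov_form f \<phi> \<psi> = Re (LINT \<xi>|\<mu>. FT lborel \<phi> \<xi> * cnj (FT lborel \<psi> \<xi>))"
  unfolding pairing_eq_FT[OF lborel.sigma_finite_measure_axioms sets_lborel schwartz_integrable[OF assms(1)] assms(2), symmetric]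
  by (simp add: cov_form_def conv_def mult.assoc)

definition damp :: "real \<Rightarrow> 'a \<Rightarrow> real" where
  "damp \<sigma> \<xi> = exp (- 2 * pi\<^sup>2 * \<sigma>\<^sup>2 * (norm \<xi>)\<^sup>2)"

lemma damp_bounds: "0 < damp \<sigma> \<xi>" "damp \<sigma> \<xi> \<le> 1"
  by (auto simp: damp_def)

lemma damp_measurable [measurable]: "damp \<sigma> \<in> borel_measurable borel"
  unfolding damp_def by measurable

lemma FT_gauss_damp: "0 < \<sigma> \<Longrightarrow> FT lborel (gauss \<sigma>) \<xi> = of_real (damp \<sigma> \<xi>)"
  by (simp add: FT_gauss damp_def)

lemma damp_integrable:
  assumes "0 < \<sigma>" shows "integrable \<mu> (damp \<sigma>)"
  using integrable_norm[OF FT_schwartz_integrable[OF schwartz_gauss[OF assms]]] assms damp_bounds(1)[of \<sigma>]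
  by (simp add: FT_gauss_damp abs_of_pos)

lemma damp_tendsto:
  assumes "\<sigma> \<longlonglongrightarrow> 0" shows "(\<lambda>n. damp (\<sigma> n) \<xi>) \<longlonglongrightarrow> 1"
proof -
  have "(\<lambda>n. exp (- 2 * pi\<^sup>2 * (\<sigma> n)\<^sup>2 * (norm \<xi>)\<^sup>2)) \<longlonglongrightarrow> exp (- 2 * pi\<^sup>2 * 0\<^sup>2 * (norm \<xi>)\<^sup>2)"
    by (intro tendsto_intros assms)
  then show ?thesis by (simp add: damp_def)
qed

lemma conv_gauss:
  assumes "0 < \<sigma>"
  shows "complex_of_real (conv f (gauss \<sigma>) x) = (LINT \<xi>|\<mu>. chi x \<xi> * of_real (damp \<sigma> \<xi>))"
  using conv_eq_FT[OF schwartz_gauss[OF assms]] by (simp add: FT_gauss_damp[OF assms])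

lemma conv_gauss_nonneg: "0 \<le> conv f (gauss \<sigma>) x"
  unfolding conv_def
proof (rule integral_nonneg_AE)
  have "AE y in lborel. y \<noteq> x" by (rule AE_lborel_singleton)
  then show "AE y in lborel. 0 \<le> f (x - y) * gauss \<sigma> y"
    by eventually_elim (auto intro!: mult_nonneg_nonneg f_nonneg gauss_nonneg)
qed

lemma conv_gauss_le:
  assumes "0 < \<sigma>" shows "conv f (gauss \<sigma>) x \<le> (LINT \<xi>|\<mu>. damp \<sigma> \<xi>)"
proof -
  have "norm (complex_of_real (conv f (gauss \<sigma>) x)) \<le> (LINT \<xi>|\<mu>. norm (chi x \<xi> * complex_of_real (damp \<sigma> \<xi>)))"
    unfolding conv_gauss[OF assms] by (rule integral_norm_bound)
  then show ?thesis using damp_bounds(1)[of \<sigma>] by (simp add: norm_mult abs_of_pos)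
qed

text \<open>
With a Gaussian factor the energy integral of a signed measure becomes an absolutely convergent double
integral with a bounded kernel. Both applications of Fubini's theorem keep the damping factor on the side
of the frequency, where it provides integrability for \<open>\<mu>\<close>.
\<close>
lemma damped_energy_eq:
  assumes \<sigma>: "0 < \<sigma>" and M: "sigma_finite_measure M" and s [measurable_cong]: "sets M = sets borel"
    and z: "integrable M z"
  shows "(LINT \<xi>|\<mu>. damp \<sigma> \<xi> * (cmod (FT M z \<xi>))\<^sup>2) = (LINT x|M. LINT y|M. z x * z y * conv f (gauss \<sigma>) (y - x))"
proof -
  note SF = sigma_finite_measure_axioms
  have [measurable]: "z \<in> borel_measurable M" using z by simp
  have [measurable]: "FT M z \<in> borel_measurable borel" using FT_measurable[OF M _ s] by simp
  have zc: "integrable M (\<lambda>x. complex_of_real (z x))" using z by simp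
  have i0: "integrable \<mu> (\<lambda>\<xi>. complex_of_real (damp \<sigma> \<xi>))" using damp_integrable[OF \<sigma>] by simp
  have "integrable \<mu> (\<lambda>\<xi>. (LINT x|M. \<bar>z x\<bar>) * damp \<sigma> \<xi>)" using damp_integrable[OF \<sigma>] by simp
  then have i1: "integrable \<mu> (\<lambda>\<xi>. of_real (damp \<sigma> \<xi>) * FT M z \<xi>)"
  proof (rule Bochner_Integration.integrable_bound)
    show "AE \<xi> in \<mu>. cmod (of_real (damp \<sigma> \<xi>) * FT M z \<xi>) \<le> norm ((LINT x|M. \<bar>z x\<bar>) * damp \<sigma> \<xi>)"
    proof (rule AE_I2)
      fix \<xi>
      have "damp \<sigma> \<xi> * cmod (FT M z \<xi>) \<le> damp \<sigma> \<xi> * (LINT x|M. \<bar>z x\<bar>)"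
        using damp_bounds(1)[of \<sigma> \<xi>] by (intro mult_left_mono norm_FT_le) auto
      then show "cmod (of_real (damp \<sigma> \<xi>) * FT M z \<xi>) \<le> norm ((LINT x|M. \<bar>z x\<bar>) * damp \<sigma> \<xi>)"
        using damp_bounds(1)[of \<sigma> \<xi>] by (simp add: norm_mult abs_of_pos mult.commute)
    qed
  qed measurable
  have i2: "integrable \<mu> (\<lambda>\<xi>. cnj (chi x \<xi>) * of_real (damp \<sigma> \<xi>))" for x
    by (rule Bochner_Integration.integrable_bound[OF i0]) (auto simp: norm_mult chi_minus[symmetric])
  have "complex_of_real (LINT \<xi>|\<mu>. damp \<sigma> \<xi> * (cmod (FT M z \<xi>))\<^sup>2) =
        (LINT \<xi>|\<mu>. of_real (damp \<sigma> \<xi>) * (FT M z \<xi> * cnj (FT M z \<xi>)))"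
    by (simp only: integral_complex_of_real[symmetric] of_real_mult complex_norm_square)
  also have "\<dots> = (LINT \<xi>|\<mu>. (LINT x|M. cnj (chi x \<xi>) * of_real (z x)) * (of_real (damp \<sigma> \<xi>) * FT M z \<xi>))"
    by (simp add: cnj_FT mult_ac)
  also have "\<dots> = (LINT x|M. of_real (z x) * (LINT \<xi>|\<mu>. cnj (chi x \<xi>) * (of_real (damp \<sigma> \<xi>) * FT M z \<xi>)))"
    by (rule integral_swap_kernel[OF M SF zc i1]) (auto simp: chi_minus[symmetric])
  also have "\<dots> = (LINT x|M. of_real (z x) * (LINT y|M. of_real (z y) * of_real (conv f (gauss \<sigma>) (y - x))))"
  proof -
    have "(LINT \<xi>|\<mu>. cnj (chi x \<xi>) * (of_real (damp \<sigma> \<xi>) * FT M z \<xi>)) =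
       (LINT y|M. of_real (z y) * of_real (conv f (gauss \<sigma>) (y - x)))" for x
    proof -
      have "(LINT \<xi>|\<mu>. cnj (chi x \<xi>) * (of_real (damp \<sigma> \<xi>) * FT M z \<xi>)) =
            (LINT \<xi>|\<mu>. (LINT y|M. chi y \<xi> * of_real (z y)) * (cnj (chi x \<xi>) * of_real (damp \<sigma> \<xi>)))"
        by (simp add: FT_def mult_ac)
      also have "\<dots> = (LINT y|M. of_real (z y) * (LINT \<xi>|\<mu>. chi y \<xi> * (cnj (chi x \<xi>) * of_real (damp \<sigma> \<xi>))))"
        by (rule integral_swap_kernel[OF M SF zc i2[of x]]) auto
      finally show "(LINT \<xi>|\<mu>. cnj (chi x \<xi>) * (of_real (damp \<sigma> \<xi>) * FT M z \<xi>)) =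
         (LINT y|M. of_real (z y) * of_real (conv f (gauss \<sigma>) (y - x)))"
        by (simp add: conv_gauss[OF \<sigma>] chi_diff mult.assoc)
    qed
    then show ?thesis by simp
  qed
  also have "\<dots> = of_real (LINT x|M. LINT y|M. z x * z y * conv f (gauss \<sigma>) (y - x))"
    by (simp add: integral_complex_of_real[symmetric] mult.assoc)
  finally show ?thesis using of_real_eq_iff by blast
qed

lemma damped_energy_integrable:
  assumes \<sigma>: "0 < \<sigma>" and M: "sigma_finite_measure M" and s [measurable_cong]: "sets M = sets borel"
    and [measurable]: "z \<in> borel_measurable M"
  shows "integrable \<mu> (\<lambda>\<xi>. damp \<sigma> \<xi> * (cmod (FT M z \<xi>))\<^sup>2)"
proof -
  have [measurable]: "FT M z \<in> borel_measurable borel" using FT_measurable[OF M _ s] by simp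
  have "integrable \<mu> (\<lambda>\<xi>. (LINT x|M. \<bar>z x\<bar>)\<^sup>2 * damp \<sigma> \<xi>)" using damp_integrable[OF \<sigma>] by simp
  then show ?thesis
  proof (rule Bochner_Integration.integrable_bound)
    show "AE \<xi> in \<mu>. norm (damp \<sigma> \<xi> * (cmod (FT M z \<xi>))\<^sup>2) \<le> norm ((LINT x|M. \<bar>z x\<bar>)\<^sup>2 * damp \<sigma> \<xi>)"
    proof (rule AE_I2)
      fix \<xi>
      have "damp \<sigma> \<xi> * (cmod (FT M z \<xi>))\<^sup>2 \<le> damp \<sigma> \<xi> * (LINT x|M. \<bar>z x\<bar>)\<^sup>2"
        using damp_bounds(1)[of \<sigma> \<xi>] by (intro mult_left_mono power_mono norm_FT_le) auto
      then show "norm (damp \<sigma> \<xi> * (cmod (FT M z \<xi>))\<^sup>2) \<le> norm ((LINT x|M. \<bar>z x\<bar>)\<^sup>2 * damp \<sigma> \<xi>)"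
        using damp_bounds(1)[of \<sigma> \<xi>] by (simp add: abs_mult abs_of_pos mult.commute)
    qed
  qed measurable
qed

text \<open>
The non-negativity of \<open>f\<close> enters here: absolute values may be taken inside the double integral without
touching the kernel. For the density 1 nothing is lost, as \<open>damped_energy_finite_measure\<close> states, and so
the two lemmas together compare a random density with a constant one.
\<close>
lemma damped_energy_le:
  assumes \<sigma>: "0 < \<sigma>" and M: "sigma_finite_measure M" and s [measurable_cong]: "sets M = sets borel"
    and z [measurable]: "z \<in> borel_measurable M"
  shows "(\<integral>\<^sup>+ \<xi>. ennreal (damp \<sigma> \<xi> * (cmod (FT M z \<xi>))\<^sup>2) \<partial>\<mu>) \<le>
         (\<integral>\<^sup>+ x. \<integral>\<^sup>+ y. ennreal (\<bar>z x\<bar> * \<bar>z y\<bar> * conv f (gauss \<sigma>) (y - x)) \<partial>M \<partial>M)"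
proof (cases "integrable M z")
  case True
  have "(\<integral>\<^sup>+ \<xi>. ennreal (damp \<sigma> \<xi> * (cmod (FT M z \<xi>))\<^sup>2) \<partial>\<mu>) =
        ennreal (LINT \<xi>|\<mu>. damp \<sigma> \<xi> * (cmod (FT M z \<xi>))\<^sup>2)"
    by (rule nn_integral_eq_integral[OF damped_energy_integrable[OF \<sigma> M s z]]) (simp add: damp_bounds less_imp_le)
  also have "\<dots> \<le> ennreal (norm (LINT x|M. LINT y|M. z x * z y * conv f (gauss \<sigma>) (y - x)))"
    unfolding damped_energy_eq[OF \<sigma> M s True] by (intro ennreal_leI) simp
  also have "\<dots> \<le> (\<integral>\<^sup>+ x. ennreal (norm (LINT y|M. z x * z y * conv f (gauss \<sigma>) (y - x))) \<partial>M)"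
    by (rule ennreal_norm_integral_le)
  also have "\<dots> \<le> (\<integral>\<^sup>+ x. \<integral>\<^sup>+ y. ennreal (norm (z x * z y * conv f (gauss \<sigma>) (y - x))) \<partial>M \<partial>M)"
    by (intro nn_integral_mono ennreal_norm_integral_le)
  finally show ?thesis by (simp add: abs_mult conv_gauss_nonneg)
qed (simp add: FT_nonintegrable[OF z s])

lemma damped_energy_finite_measure:
  assumes \<sigma>: "0 < \<sigma>" and M: "finite_measure M" and s [measurable_cong]: "sets M = sets borel"
  shows "(\<integral>\<^sup>+ x. \<integral>\<^sup>+ y. ennreal (conv f (gauss \<sigma>) (y - x)) \<partial>M \<partial>M) =
         (\<integral>\<^sup>+ \<xi>. ennreal (damp \<sigma> \<xi> * (cmod (FT M (\<lambda>_. 1) \<xi>))\<^sup>2) \<partial>\<mu>)"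
proof -
  interpret M: finite_measure M by fact
  note [measurable] = conv_measurable[OF schwartz_gauss[OF \<sigma>]]
  let ?K = "LINT \<xi>|\<mu>. damp \<sigma> \<xi>"
  have i: "integrable M (\<lambda>y. conv f (gauss \<sigma>) (y - x))" for x
    by (rule M.integrable_const_bound[where B="?K"])
       (auto simp: abs_of_nonneg conv_gauss_nonneg conv_gauss_le[OF \<sigma>])
  have j: "integrable M (\<lambda>x. LINT y|M. conv f (gauss \<sigma>) (y - x))"
  proof (rule M.integrable_const_bound[where B="measure M (space M) * ?K"])
    have "(LINT y|M. conv f (gauss \<sigma>) (y - x)) \<le> (LINT y|M. ?K)" for x
      by (intro integral_mono i) (auto simp: conv_gauss_le[OF \<sigma>])
    then show "AE x in M. norm (LINT y|M. conv f (gauss \<sigma>) (y - x)) \<le> measure M (space M) * ?K"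
      by (auto simp: integral_nonneg conv_gauss_nonneg)
  qed measurable
  have "(\<integral>\<^sup>+ x. \<integral>\<^sup>+ y. ennreal (conv f (gauss \<sigma>) (y - x)) \<partial>M \<partial>M) =
        ennreal (LINT x|M. LINT y|M. conv f (gauss \<sigma>) (y - x))"
    by (simp add: nn_integral_eq_integral i j conv_gauss_nonneg integral_nonneg)
  also have "\<dots> = ennreal (LINT \<xi>|\<mu>. damp \<sigma> \<xi> * (cmod (FT M (\<lambda>_. 1) \<xi>))\<^sup>2)"
    using damped_energy_eq[OF \<sigma> M.sigma_finite_measure_axioms s, of "\<lambda>_. 1"] by simp
  also have "\<dots> = (\<integral>\<^sup>+ \<xi>. ennreal (damp \<sigma> \<xi> * (cmod (FT M (\<lambda>_. 1) \<xi>))\<^sup>2) \<partial>\<mu>)"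
    by (rule nn_integral_eq_integral[symmetric, OF damped_energy_integrable[OF \<sigma> M.sigma_finite_measure_axioms s]])
       (simp_all add: damp_bounds less_imp_le)
  finally show ?thesis .
qed

text \<open>
The squared norm of \<open>L\<^sup>2(\<mu>)\<close>; extended values allow statements about it before finiteness is known.
\<close>
definition energy :: "('a \<Rightarrow> complex) \<Rightarrow> ennreal" where
  "energy \<Phi> = (\<integral>\<^sup>+ \<xi>. ennreal ((cmod (\<Phi> \<xi>))\<^sup>2) \<partial>\<mu>)"

text \<open>
By the arithmetic-geometric mean inequality the expectation of \<open>|z(x)| |z(y)|\<close> is at most \<open>C\<close>,
uniformly in \<open>x\<close> and \<open>y\<close>; it remains to integrate against a kernel that is non-negative.
\<close>
lemma expected_damped_energy_le:
  fixes z :: "'w \<Rightarrow> 'a \<Rightarrow> real"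
  assumes \<sigma>: "0 < \<sigma>" and P: "prob_space P" and M: "finite_measure M" and s [measurable_cong]: "sets M = sets borel"
    and z: "(\<lambda>(\<omega>, x). z \<omega> x) \<in> borel_measurable (P \<Otimes>\<^sub>M borel)"
    and C: "\<And>x. (\<integral>\<^sup>+ \<omega>. ennreal ((z \<omega> x)\<^sup>2) \<partial>P) \<le> C"
  shows "(\<integral>\<^sup>+ \<omega>. \<integral>\<^sup>+ \<xi>. ennreal (damp \<sigma> \<xi> * (cmod (FT M (z \<omega>) \<xi>))\<^sup>2) \<partial>\<mu> \<partial>P) \<le> C * energy (FT M (\<lambda>_. 1))"
proof -
  interpret P: prob_space P by fact
  interpret M: finite_measure M by fact
  interpret pair_sigma_finite P M ..
  note [measurable] = conv_measurable[OF schwartz_gauss[OF \<sigma>]]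
  have [measurable (raw)]: "(\<lambda>w. z (h w) (k w)) \<in> borel_measurable N"
    if "h \<in> measurable N P" "k \<in> borel_measurable N" for h k N
    using measurable_compose[OF measurable_Pair[OF that] z] by simp
  have sec: "z \<omega> \<in> borel_measurable M" if "\<omega> \<in> space P" for \<omega>
    using that by measurable
  let ?f = "conv f (gauss \<sigma>)"
  have "(\<integral>\<^sup>+ \<omega>. \<integral>\<^sup>+ \<xi>. ennreal (damp \<sigma> \<xi> * (cmod (FT M (z \<omega>) \<xi>))\<^sup>2) \<partial>\<mu> \<partial>P) \<le>
        (\<integral>\<^sup>+ \<omega>. \<integral>\<^sup>+ x. \<integral>\<^sup>+ y. ennreal (\<bar>z \<omega> x\<bar> * \<bar>z \<omega> y\<bar> * ?f (y - x)) \<partial>M \<partial>M \<partial>P)"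
    by (intro nn_integral_mono damped_energy_le[OF \<sigma> M.sigma_finite_measure_axioms s] sec)
  also have "\<dots> = (\<integral>\<^sup>+ x. \<integral>\<^sup>+ \<omega>. \<integral>\<^sup>+ y. ennreal (\<bar>z \<omega> x\<bar> * \<bar>z \<omega> y\<bar> * ?f (y - x)) \<partial>M \<partial>P \<partial>M)"
    by (rule Fubini'[symmetric]) measurable
  also have "\<dots> = (\<integral>\<^sup>+ x. \<integral>\<^sup>+ y. \<integral>\<^sup>+ \<omega>. ennreal (\<bar>z \<omega> x\<bar> * \<bar>z \<omega> y\<bar> * ?f (y - x)) \<partial>P \<partial>M \<partial>M)"
    by (intro nn_integral_cong Fubini'[symmetric]) measurable
  also have "\<dots> \<le> (\<integral>\<^sup>+ x. \<integral>\<^sup>+ y. C * ennreal (?f (y - x)) \<partial>M \<partial>M)"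
  proof (intro nn_integral_mono)
    fix x y
    have "(\<integral>\<^sup>+ \<omega>. ennreal (\<bar>z \<omega> x\<bar> * \<bar>z \<omega> y\<bar> * ?f (y - x)) \<partial>P) \<le>
          (\<integral>\<^sup>+ \<omega>. (ennreal (1/2) * (ennreal ((z \<omega> x)\<^sup>2) + ennreal ((z \<omega> y)\<^sup>2))) * ennreal (?f (y - x)) \<partial>P)"
    proof (intro nn_integral_mono)
      fix \<omega>
      have "\<bar>z \<omega> x\<bar> * \<bar>z \<omega> y\<bar> \<le> 1/2 * ((z \<omega> x)\<^sup>2 + (z \<omega> y)\<^sup>2)"
        using zero_le_power2[of "\<bar>z \<omega> x\<bar> - \<bar>z \<omega> y\<bar>"] by (simp add: power2_diff)
      then have "\<bar>z \<omega> x\<bar> * \<bar>z \<omega> y\<bar> * ?f (y - x) \<le> 1/2 * ((z \<omega> x)\<^sup>2 + (z \<omega> y)\<^sup>2) * ?f (y - x)"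
        by (intro mult_right_mono conv_gauss_nonneg)
      then show "ennreal (\<bar>z \<omega> x\<bar> * \<bar>z \<omega> y\<bar> * ?f (y - x)) \<le>
        (ennreal (1/2) * (ennreal ((z \<omega> x)\<^sup>2) + ennreal ((z \<omega> y)\<^sup>2))) * ennreal (?f (y - x))"
        by (subst ennreal_plus[symmetric], simp, simp, subst ennreal_mult[symmetric], simp, simp,
            subst ennreal_mult[symmetric]) (auto simp: conv_gauss_nonneg intro!: ennreal_leI)
    qed
    also have "\<dots> = (ennreal (1/2) * ((\<integral>\<^sup>+ \<omega>. ennreal ((z \<omega> x)\<^sup>2) \<partial>P) + (\<integral>\<^sup>+ \<omega>. ennreal ((z \<omega> y)\<^sup>2) \<partial>P))) * ennreal (?f (y - x))"
      by (simp add: nn_integral_multc nn_integral_cmult nn_integral_add)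
    also have "\<dots> \<le> (ennreal (1/2) * (C + C)) * ennreal (?f (y - x))"
      by (intro mult_right_mono mult_left_mono add_mono C) auto
    also have "ennreal (1/2) * (C + C) = C"
    proof -
      have "ennreal (1/2) * (C + C) = (ennreal (1/2) + ennreal (1/2)) * C"
        by (simp only: distrib_left distrib_right)
      also have "ennreal (1/2) + ennreal (1/2) = 1"
        by (subst ennreal_plus[symmetric]) simp_all
      finally show ?thesis by simp
    qed
    finally show "(\<integral>\<^sup>+ \<omega>. ennreal (\<bar>z \<omega> x\<bar> * \<bar>z \<omega> y\<bar> * ?f (y - x)) \<partial>P) \<le> C * ennreal (?f (y - x))" .
  qed
  also have "\<dots> = C * (\<integral>\<^sup>+ x. \<integral>\<^sup>+ y. ennreal (?f (y - x)) \<partial>M \<partial>M)"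
    by (simp add: nn_integral_cmult)
  also have "\<dots> = C * (\<integral>\<^sup>+ \<xi>. ennreal (damp \<sigma> \<xi> * (cmod (FT M (\<lambda>_. 1) \<xi>))\<^sup>2) \<partial>\<mu>)"
    unfolding damped_energy_finite_measure[OF \<sigma> M s] ..
  also have "\<dots> \<le> C * energy (FT M (\<lambda>_. 1))"
    unfolding energy_def using damp_bounds(1)[of \<sigma>]
    by (intro mult_left_mono nn_integral_mono ennreal_leI mult_left_le_one_le) (auto simp: damp_bounds less_imp_le)
  finally show ?thesis .
qed

text \<open>
Fatou's lemma, in frequency and then in probability, removes the damping factor.
\<close>
lemma expected_energy_le:
  fixes z :: "'w \<Rightarrow> 'a \<Rightarrow> real"
  assumes P: "prob_space P" and M: "finite_measure M" and s [measurable_cong]: "sets M = sets borel"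
    and z [measurable]: "(\<lambda>(\<omega>, x). z \<omega> x) \<in> borel_measurable (P \<Otimes>\<^sub>M borel)"
    and C: "\<And>x. (\<integral>\<^sup>+ \<omega>. ennreal ((z \<omega> x)\<^sup>2) \<partial>P) \<le> C"
  shows "(\<integral>\<^sup>+ \<omega>. energy (FT M (z \<omega>)) \<partial>P) \<le> C * energy (FT M (\<lambda>_. 1))"
proof -
  interpret P: prob_space P by fact
  interpret M: finite_measure M by fact
  define \<sigma> :: "nat \<Rightarrow> real" where "\<sigma> n = 1 / real (Suc n)" for n
  have \<sigma>: "0 < \<sigma> n" for n by (simp add: \<sigma>_def)
  have "\<sigma> \<longlonglongrightarrow> 0" unfolding \<sigma>_def by (rule LIMSEQ_Suc[OF lim_1_over_n])
  have F [measurable]: "(\<lambda>(\<omega>, \<xi>). FT M (z \<omega>) \<xi>) \<in> borel_measurable (P \<Otimes>\<^sub>M \<mu>)"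
  proof -
    have [measurable]: "(\<lambda>p. z (fst (fst p)) (snd p)) \<in> borel_measurable ((P \<Otimes>\<^sub>M \<mu>) \<Otimes>\<^sub>M M)"
      by (rule measurable_compose[OF _ z, of "\<lambda>p. (fst (fst p), snd p)", simplified]) measurable
    show ?thesis unfolding FT_def case_prod_beta by measurable
  qed
  have [measurable]: "FT M (z \<omega>) \<in> borel_measurable \<mu>" if "\<omega> \<in> space P" for \<omega>
    using measurable_Pair2[OF F that] by simp
  let ?e = "\<lambda>n \<omega> \<xi>. ennreal (damp (\<sigma> n) \<xi> * (cmod (FT M (z \<omega>) \<xi>))\<^sup>2)"
  have lim: "(\<lambda>n. ?e n \<omega> \<xi>) \<longlonglongrightarrow> ennreal ((cmod (FT M (z \<omega>) \<xi>))\<^sup>2)" for \<omega> \<xi>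
    using tendsto_mult_right[OF damp_tendsto[OF \<open>\<sigma> \<longlonglongrightarrow> 0\<close>, of \<xi>], where c="(cmod (FT M (z \<omega>) \<xi>))\<^sup>2"]
    by (intro tendsto_ennrealI) simp
  have "(\<integral>\<^sup>+ \<omega>. energy (FT M (z \<omega>)) \<partial>P) = (\<integral>\<^sup>+ \<omega>. \<integral>\<^sup>+ \<xi>. liminf (\<lambda>n. ?e n \<omega> \<xi>) \<partial>\<mu> \<partial>P)"
    unfolding energy_def by (simp add: lim_imp_Liminf[OF _ lim])
  also have "\<dots> \<le> (\<integral>\<^sup>+ \<omega>. liminf (\<lambda>n. \<integral>\<^sup>+ \<xi>. ?e n \<omega> \<xi> \<partial>\<mu>) \<partial>P)"
    by (intro nn_integral_mono nn_integral_liminf) measurable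
  also have "\<dots> \<le> liminf (\<lambda>n. \<integral>\<^sup>+ \<omega>. \<integral>\<^sup>+ \<xi>. ?e n \<omega> \<xi> \<partial>\<mu> \<partial>P)"
    by (intro nn_integral_liminf) measurable
  also have "\<dots> \<le> C * energy (FT M (\<lambda>_. 1))"
    by (intro Liminf_le always_eventually allI expected_damped_energy_le \<sigma> P M s z C) simp
  finally show ?thesis .
qed

end

section \<open>Approximation in the space of square integrable spectra\<close>

lemma borel_measurable_cnj [measurable (raw)]:
  "g \<in> borel_measurable M \<Longrightarrow> (\<lambda>x. cnj (g x)) \<in> borel_measurable M"
  by (rule borel_measurable_continuous_on[OF continuous_on_cnj[OF continuous_on_id]])

lemma FT_lincomb:
  fixes \<phi> \<psi> :: "'a::euclidean_space \<Rightarrow> real"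
  assumes "schwartz \<phi>" "schwartz \<psi>"
  shows "FT lborel (\<lambda>x. a * \<phi> x + b * \<psi> x) \<xi> = of_real a * FT lborel \<phi> \<xi> + of_real b * FT lborel \<psi> \<xi>"
proof -
  have i: "integrable lborel (\<lambda>x. chi x \<xi> * complex_of_real (\<phi> x))" "integrable lborel (\<lambda>x. chi x \<xi> * complex_of_real (\<psi> x))"
    by (intro integrable_chi_mult schwartz_integrable assms sets_lborel)+
  have "FT lborel (\<lambda>x. a * \<phi> x + b * \<psi> x) \<xi> =
     (LINT x|lborel. of_real a * (chi x \<xi> * of_real (\<phi> x)) + of_real b * (chi x \<xi> * of_real (\<psi> x)))"
    unfolding FT_def by (intro Bochner_Integration.integral_cong) (auto simp: algebra_simps)
  also have "\<dots> = of_real a * FT lborel \<phi> \<xi> + of_real b * FT lborel \<psi> \<xi>"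
    unfolding FT_def using i by (subst Bochner_Integration.integral_add) auto
  finally show ?thesis .
qed

lemma FT_sum:
  fixes \<phi> :: "'i \<Rightarrow> 'a::euclidean_space \<Rightarrow> real"
  assumes "\<And>i. i \<in> I \<Longrightarrow> schwartz (\<phi> i)"
  shows "FT lborel (\<lambda>x. \<Sum>i\<in>I. c i * \<phi> i x) \<xi> = (\<Sum>i\<in>I. of_real (c i) * FT lborel (\<phi> i) \<xi>)"
  using assms
proof (induction I rule: infinite_finite_induct)
  case (insert i I)
  then show ?case
    using FT_lincomb[of "\<phi> i" "\<lambda>x. \<Sum>i\<in>I. c i * \<phi> i x" "c i" 1 \<xi>] schwartz_sum[of I \<phi> c] by simp
qed (simp_all add: FT_def)

context spectral_measure
begin

lemma energy_triangle:
  assumes [measurable]: "A \<in> borel_measurable borel" "B \<in> borel_measurable borel" "C \<in> borel_measurable borel"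
  shows "energy (\<lambda>\<xi>. A \<xi> - C \<xi>) \<le> 2 * energy (\<lambda>\<xi>. A \<xi> - B \<xi>) + 2 * energy (\<lambda>\<xi>. B \<xi> - C \<xi>)"
proof -
  have "energy (\<lambda>\<xi>. A \<xi> - C \<xi>) \<le> (\<integral>\<^sup>+ \<xi>. 2 * ennreal ((cmod (A \<xi> - B \<xi>))\<^sup>2) + 2 * ennreal ((cmod (B \<xi> - C \<xi>))\<^sup>2) \<partial>\<mu>)"
    unfolding energy_def
  proof (rule nn_integral_mono)
    fix \<xi>
    let ?a = "cmod (A \<xi> - B \<xi>)" and ?b = "cmod (B \<xi> - C \<xi>)"
    have "(cmod (A \<xi> - C \<xi>))\<^sup>2 \<le> (?a + ?b)\<^sup>2"
      using norm_triangle_ineq[of "A \<xi> - B \<xi>" "B \<xi> - C \<xi>"] by (intro power_mono) auto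
    also have "\<dots> \<le> 2 * ?a\<^sup>2 + 2 * ?b\<^sup>2"
      using zero_le_power2[of "?a - ?b"] by (simp add: power2_eq_square algebra_simps)
    finally have "ennreal ((cmod (A \<xi> - C \<xi>))\<^sup>2) \<le> ennreal (2 * ?a\<^sup>2 + 2 * ?b\<^sup>2)" by (rule ennreal_leI)
    then show "ennreal ((cmod (A \<xi> - C \<xi>))\<^sup>2) \<le> 2 * ennreal (?a\<^sup>2) + 2 * ennreal (?b\<^sup>2)"
      by (simp add: ennreal_mult)
  qed
  also have "\<dots> = 2 * energy (\<lambda>\<xi>. A \<xi> - B \<xi>) + 2 * energy (\<lambda>\<xi>. B \<xi> - C \<xi>)"
    unfolding energy_def by (simp add: nn_integral_add nn_integral_cmult)
  finally show ?thesis .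
qed

lemma energy_commute: "energy (\<lambda>\<xi>. A \<xi> - B \<xi>) = energy (\<lambda>\<xi>. B \<xi> - A \<xi>)"
  by (simp add: energy_def norm_minus_commute)

lemma integrable_energy_mult:
  assumes [measurable]: "A \<in> borel_measurable borel" "B \<in> borel_measurable borel"
    and f: "energy A < \<infinity>" "energy B < \<infinity>"
  shows "integrable \<mu> (\<lambda>\<xi>. A \<xi> * cnj (B \<xi>))"
proof -
  have "integrable \<mu> (\<lambda>\<xi>. (cmod (A \<xi>))\<^sup>2 + (cmod (B \<xi>))\<^sup>2)"
    using f by (intro Bochner_Integration.integrable_add) (auto simp: energy_def intro!: integrableI_bounded)
  then show ?thesis
  proof (rule Bochner_Integration.integrable_bound)
    show "AE \<xi> in \<mu>. cmod (A \<xi> * cnj (B \<xi>)) \<le> norm ((cmod (A \<xi>))\<^sup>2 + (cmod (B \<xi>))\<^sup>2)"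
    proof (rule AE_I2)
      fix \<xi>
      have "cmod (A \<xi>) * cmod (B \<xi>) \<le> (cmod (A \<xi>))\<^sup>2 + (cmod (B \<xi>))\<^sup>2"
        using sum_squares_bound[of "cmod (A \<xi>)" "cmod (B \<xi>)"] zero_le_power2[of "cmod (A \<xi>)"] zero_le_power2[of "cmod (B \<xi>)"]
        by linarith
      then show "cmod (A \<xi> * cnj (B \<xi>)) \<le> norm ((cmod (A \<xi>))\<^sup>2 + (cmod (B \<xi>))\<^sup>2)"
        by (simp add: norm_mult)
    qed
  qed measurable
qed

lemma energy_FT_schwartz_finite: "schwartz \<phi> \<Longrightarrow> energy (FT lborel \<phi>) < \<infinity>"
  using FT_schwartz_square_integrable[of \<phi>] by (simp add: energy_def integrable_iff_bounded)

text \<open>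
The Cauchy-Schwarz inequality in \<open>L\<^sup>2(\<mu>)\<close>.
\<close>
lemma inner_energy_bound:
  assumes [measurable]: "A \<in> borel_measurable borel" "B \<in> borel_measurable borel"
  shows "ennreal ((cmod (LINT \<xi>|\<mu>. A \<xi> * cnj (B \<xi>)))\<^sup>2) \<le> energy A * energy B"
proof -
  have "ennreal (cmod (LINT \<xi>|\<mu>. A \<xi> * cnj (B \<xi>))) \<le> (\<integral>\<^sup>+ \<xi>. ennreal (cmod (A \<xi>)) * ennreal (cmod (B \<xi>)) \<partial>\<mu>)"
    by (rule order_trans[OF ennreal_norm_integral_le]) (simp add: norm_mult ennreal_mult)
  then have "(ennreal (cmod (LINT \<xi>|\<mu>. A \<xi> * cnj (B \<xi>))))\<^sup>2 \<le> (\<integral>\<^sup>+ \<xi>. ennreal (cmod (A \<xi>)) * ennreal (cmod (B \<xi>)) \<partial>\<mu>)\<^sup>2"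
    by (intro power_mono) auto
  also have "\<dots> \<le> (\<integral>\<^sup>+ \<xi>. (ennreal (cmod (A \<xi>)))\<^sup>2 \<partial>\<mu>) * (\<integral>\<^sup>+ \<xi>. (ennreal (cmod (B \<xi>)))\<^sup>2 \<partial>\<mu>)"
    by (rule Cauchy_Schwarz_nn_integral) measurable
  finally show ?thesis by (simp add: energy_def ennreal_power)
qed

lemma energy_damp_tendsto:
  assumes [measurable]: "\<Phi> \<in> borel_measurable borel" and fin: "energy \<Phi> < \<infinity>" and \<sigma>: "\<sigma> \<longlonglongrightarrow> 0"
  shows "(\<lambda>n. energy (\<lambda>\<xi>. of_real (damp (\<sigma> n) \<xi>) * \<Phi> \<xi> - \<Phi> \<xi>)) \<longlonglongrightarrow> 0"
proof -
  have "(\<lambda>n. \<integral>\<^sup>+ \<xi>. ennreal ((cmod (of_real (damp (\<sigma> n) \<xi>) * \<Phi> \<xi> - \<Phi> \<xi>))\<^sup>2) \<partial>\<mu>) \<longlonglongrightarrow> (\<integral>\<^sup>+ \<xi>. 0 \<partial>\<mu>)"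
  proof (rule nn_integral_dominated_convergence[where w="\<lambda>\<xi>. ennreal ((cmod (\<Phi> \<xi>))\<^sup>2)"])
    show "AE \<xi> in \<mu>. ennreal ((cmod (of_real (damp (\<sigma> n) \<xi>) * \<Phi> \<xi> - \<Phi> \<xi>))\<^sup>2) \<le> ennreal ((cmod (\<Phi> \<xi>))\<^sup>2)" for n
    proof (intro AE_I2 ennreal_leI power_mono)
      fix \<xi>
      have "cmod (of_real (damp (\<sigma> n) \<xi>) * \<Phi> \<xi> - \<Phi> \<xi>) = cmod (of_real (damp (\<sigma> n) \<xi> - 1) * \<Phi> \<xi>)"
        by (simp add: algebra_simps)
      also have "\<dots> = \<bar>damp (\<sigma> n) \<xi> - 1\<bar> * cmod (\<Phi> \<xi>)" by (simp only: norm_mult norm_of_real)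
      also have "\<dots> \<le> cmod (\<Phi> \<xi>)"
        using damp_bounds[of "\<sigma> n" \<xi>] by (intro mult_left_le_one_le) auto
      finally show "cmod (of_real (damp (\<sigma> n) \<xi>) * \<Phi> \<xi> - \<Phi> \<xi>) \<le> cmod (\<Phi> \<xi>)" .
    qed auto
    show "AE \<xi> in \<mu>. (\<lambda>n. ennreal ((cmod (of_real (damp (\<sigma> n) \<xi>) * \<Phi> \<xi> - \<Phi> \<xi>))\<^sup>2)) \<longlonglongrightarrow> 0"
    proof (rule AE_I2)
      fix \<xi>
      have "(\<lambda>n. (cmod (of_real (damp (\<sigma> n) \<xi>) * \<Phi> \<xi> - \<Phi> \<xi>))\<^sup>2) \<longlonglongrightarrow> (cmod (of_real 1 * \<Phi> \<xi> - \<Phi> \<xi>))\<^sup>2"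
        by (intro tendsto_intros damp_tendsto \<sigma>)
      from tendsto_ennrealI[OF this]
      show "(\<lambda>n. ennreal ((cmod (of_real (damp (\<sigma> n) \<xi>) * \<Phi> \<xi> - \<Phi> \<xi>))\<^sup>2)) \<longlonglongrightarrow> 0" by simp
    qed
  qed (use fin in \<open>auto simp: energy_def\<close>)
  then show ?thesis by (simp add: energy_def)
qed

end

definition cell_mass :: "'a::euclidean_space measure \<Rightarrow> ('a \<Rightarrow> real) \<Rightarrow> ('a \<Rightarrow> 'a) \<Rightarrow> 'a \<Rightarrow> real" where
  "cell_mass M z s q = (LINT x|M. indicator (s -` {q}) x * z x)"

text \<open>
The signed measure with density \<open>z\<close> is first concentrated on the finitely many values of the simple
function \<open>s\<close> and then smoothed by a Gaussian. It depends on the signed measure through finitely many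
real numbers only.
\<close>
definition discretize :: "('a::euclidean_space \<Rightarrow> 'a) \<Rightarrow> real \<Rightarrow> 'a measure \<Rightarrow> ('a \<Rightarrow> real) \<Rightarrow> 'a \<Rightarrow> real" where
  "discretize s \<sigma> M z y = (\<Sum>q\<in>range s. cell_mass M z s q * gauss \<sigma> (y - q))"

lemma schwartz_discretize: "0 < \<sigma> \<Longrightarrow> schwartz (discretize s \<sigma> M z)"
  unfolding discretize_def[abs_def] by (intro schwartz_sum schwartz_translate schwartz_gauss)

context spectral_measure
begin

text \<open>
Concentrating the measure on the values of \<open>s\<close> amounts to evaluating the character at \<open>s x\<close> in place of
\<open>x\<close>; smoothing multiplies by the damping factor.
\<close>
lemma FT_discretize:
  assumes \<sigma>: "0 < \<sigma>" and s: "simple_function borel s" and M [measurable_cong]: "sets M = sets borel" and z: "integrable M z"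
  shows "FT lborel (discretize s \<sigma> M z) \<xi> = of_real (damp \<sigma> \<xi>) * (LINT x|M. chi (s x) \<xi> * of_real (z x))"
proof -
  have fin: "finite (range s)" using s by (simp add: simple_function_def)
  have [measurable]: "s \<in> borel_measurable borel" using s by (rule borel_measurable_simple_function)
  have [measurable]: "s -` {q} \<in> sets borel" for q
    using measurable_sets[of s borel borel "{q}"] by simp
  have i: "integrable M (\<lambda>x. chi q \<xi> * complex_of_real (indicator (s -` {q}) x * z x))" for q
  proof (rule Bochner_Integration.integrable_bound[OF z])
    have [measurable]: "z \<in> borel_measurable M" using z by simp
    show "(\<lambda>x. chi q \<xi> * complex_of_real (indicator (s -` {q}) x * z x)) \<in> borel_measurable M" by measurable
  qed (auto intro!: AE_I2 simp: norm_mult indicator_def)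
  have "FT lborel (discretize s \<sigma> M z) \<xi> = (\<Sum>q\<in>range s. of_real (cell_mass M z s q) * FT lborel (\<lambda>y. gauss \<sigma> (y - q)) \<xi>)"
    unfolding discretize_def[abs_def] by (intro FT_sum schwartz_translate schwartz_gauss \<sigma>)
  also have "\<dots> = (\<Sum>q\<in>range s. of_real (cell_mass M z s q) * (chi q \<xi> * of_real (damp \<sigma> \<xi>)))"
    by (simp add: FT_translate[OF schwartz_borel_measurable[OF schwartz_gauss[OF \<sigma>]]] FT_gauss_damp[OF \<sigma>])
  also have "\<dots> = of_real (damp \<sigma> \<xi>) * (\<Sum>q\<in>range s. chi q \<xi> * of_real (cell_mass M z s q))"
    by (simp add: sum_distrib_left mult_ac)
  also have "(\<Sum>q\<in>range s. chi q \<xi> * of_real (cell_mass M z s q)) =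
     (\<Sum>q\<in>range s. LINT x|M. chi q \<xi> * complex_of_real (indicator (s -` {q}) x * z x))"
    by (simp only: cell_mass_def integral_mult_right_zero integral_complex_of_real)
  also have "\<dots> = (LINT x|M. (\<Sum>q\<in>range s. chi q \<xi> * complex_of_real (indicator (s -` {q}) x * z x)))"
    by (rule Bochner_Integration.integral_sum[symmetric]) (rule i)
  also have "\<dots> = (LINT x|M. chi (s x) \<xi> * of_real (z x))"
  proof (intro Bochner_Integration.integral_cong refl)
    fix x
    have "(\<Sum>q\<in>range s. chi q \<xi> * complex_of_real (indicator (s -` {q}) x * z x)) =
          (\<Sum>q\<in>range s. if q = s x then chi (s x) \<xi> * of_real (z x) else 0)"
      by (intro sum.cong) (auto simp: indicator_def)
    also have "\<dots> = chi (s x) \<xi> * of_real (z x)" using fin by (simp add: sum.delta)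
    finally show "(\<Sum>q\<in>range s. chi q \<xi> * complex_of_real (indicator (s -` {q}) x * z x)) = chi (s x) \<xi> * of_real (z x)" .
  qed
  finally show ?thesis .
qed

text \<open>
The width \<open>\<sigma>\<close> stays fixed, so that the damping factor times a constant is a majorant that is integrable
for the possibly infinite measure \<open>\<mu>\<close>. How fast the inner integrals converge depends on the signed
measure; for this reason the limits in \<open>s\<close> and in \<open>\<sigma>\<close> are taken one after the other.
\<close>
lemma energy_discretize_tendsto:
  assumes \<sigma>: "0 < \<sigma>" and s: "\<And>i. simple_function borel (s i)" "\<And>x. (\<lambda>i. s i x) \<longlonglongrightarrow> x"
    and MF: "sigma_finite_measure M" and M [measurable_cong]: "sets M = sets borel" and z: "integrable M z"
  shows "(\<lambda>i. energy (\<lambda>\<xi>. FT lborel (discretize (s i) \<sigma> M z) \<xi> - of_real (damp \<sigma> \<xi>) * FT M z \<xi>)) \<longlonglongrightarrow> 0"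
proof -
  have [measurable]: "s i \<in> borel_measurable borel" for i using s(1) by (rule borel_measurable_simple_function)
  have [measurable]: "z \<in> borel_measurable M" using z by simp
  have [measurable]: "FT M z \<in> borel_measurable borel" using FT_measurable[OF MF _ M] by simp
  let ?K = "2 * (LINT x|M. \<bar>z x\<bar>)"
  let ?D = "\<lambda>i \<xi>. (LINT x|M. chi (s i x) \<xi> * of_real (z x)) - FT M z \<xi>"
  have [measurable]: "FT lborel (discretize (s i) \<sigma> M z) \<in> borel_measurable borel" for i
    by (intro FT_schwartz_measurable schwartz_discretize \<sigma>)
  have eq: "FT lborel (discretize (s i) \<sigma> M z) \<xi> - of_real (damp \<sigma> \<xi>) * FT M z \<xi> = of_real (damp \<sigma> \<xi>) * ?D i \<xi>" for i \<xi>
    by (simp add: FT_discretize[OF \<sigma> s(1) M z] right_diff_distrib)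
  have b: "cmod (?D i \<xi>) \<le> ?K" for i \<xi>
  proof -
    have "cmod (LINT x|M. chi (s i x) \<xi> * of_real (z x)) \<le> (LINT x|M. \<bar>z x\<bar>)"
      by (rule order_trans[OF integral_norm_bound]) (simp add: norm_mult)
    then show ?thesis using norm_triangle_ineq4[of "LINT x|M. chi (s i x) \<xi> * of_real (z x)" "FT M z \<xi>"] norm_FT_le[of M z \<xi>]
      by linarith
  qed
  have lim: "(\<lambda>i. ?D i \<xi>) \<longlonglongrightarrow> 0" for \<xi>
  proof -
    have "(\<lambda>i. LINT x|M. chi (s i x) \<xi> * of_real (z x)) \<longlonglongrightarrow> FT M z \<xi>"
      unfolding FT_def
    proof (rule integral_dominated_convergence[where w="\<lambda>x. \<bar>z x\<bar>"])
      show "AE x in M. (\<lambda>i. chi (s i x) \<xi> * complex_of_real (z x)) \<longlonglongrightarrow> chi x \<xi> * complex_of_real (z x)"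
        by (intro AE_I2 tendsto_mult tendsto_const continuous_on_tendsto_compose[OF continuous_on_chi[of UNIV]] s) auto
    qed (use z in \<open>auto simp: norm_mult\<close>)
    then show ?thesis by (simp add: LIM_zero_iff)
  qed
  have "(\<lambda>i. \<integral>\<^sup>+ \<xi>. ennreal ((cmod (FT lborel (discretize (s i) \<sigma> M z) \<xi> - of_real (damp \<sigma> \<xi>) * FT M z \<xi>))\<^sup>2) \<partial>\<mu>) \<longlonglongrightarrow> (\<integral>\<^sup>+ \<xi>. 0 \<partial>\<mu>)"
  proof (rule nn_integral_dominated_convergence[where w="\<lambda>\<xi>. ennreal (?K\<^sup>2 * damp \<sigma> \<xi>)"])
    show "AE \<xi> in \<mu>. ennreal ((cmod (FT lborel (discretize (s i) \<sigma> M z) \<xi> - of_real (damp \<sigma> \<xi>) * FT M z \<xi>))\<^sup>2) \<le> ennreal (?K\<^sup>2 * damp \<sigma> \<xi>)" for i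
    proof (intro AE_I2 ennreal_leI)
      fix \<xi>
      have "(cmod (of_real (damp \<sigma> \<xi>) * ?D i \<xi>))\<^sup>2 = (cmod (?D i \<xi>))\<^sup>2 * (damp \<sigma> \<xi>)\<^sup>2"
        by (simp add: norm_mult power_mult_distrib)
      also have "\<dots> \<le> ?K\<^sup>2 * damp \<sigma> \<xi>"
        using damp_bounds[of \<sigma> \<xi>] b[of i \<xi>]
        by (intro mult_mono power_mono) (auto simp: power2_eq_square mult_left_le_one_le)
      finally show "(cmod (FT lborel (discretize (s i) \<sigma> M z) \<xi> - of_real (damp \<sigma> \<xi>) * FT M z \<xi>))\<^sup>2 \<le> ?K\<^sup>2 * damp \<sigma> \<xi>"
        unfolding eq .
    qed
    show "AE \<xi> in \<mu>. (\<lambda>i. ennreal ((cmod (FT lborel (discretize (s i) \<sigma> M z) \<xi> - of_real (damp \<sigma> \<xi>) * FT M z \<xi>))\<^sup>2)) \<longlonglongrightarrow> 0"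
    proof (rule AE_I2)
      fix \<xi>
      have "(\<lambda>i. (cmod (of_real (damp \<sigma> \<xi>) * ?D i \<xi>))\<^sup>2) \<longlonglongrightarrow> (cmod (of_real (damp \<sigma> \<xi>) * 0))\<^sup>2"
        by (intro tendsto_intros lim)
      from tendsto_ennrealI[OF this]
      show "(\<lambda>i. ennreal ((cmod (FT lborel (discretize (s i) \<sigma> M z) \<xi> - of_real (damp \<sigma> \<xi>) * FT M z \<xi>))\<^sup>2)) \<longlonglongrightarrow> 0"
        unfolding eq by simp
    qed
    have "integrable \<mu> (\<lambda>\<xi>. ?K\<^sup>2 * damp \<sigma> \<xi>)" using damp_integrable[OF \<sigma>] by simp
    then show "(\<integral>\<^sup>+ \<xi>. ennreal (?K\<^sup>2 * damp \<sigma> \<xi>) \<partial>\<mu>) < \<infinity>"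
      using damp_bounds(1)[of \<sigma>] by (subst nn_integral_eq_integral) (auto simp: less_imp_le)
  qed auto
  then show ?thesis by (simp add: energy_def)
qed

end

section \<open>Elements of the completion and their spectra\<close>

locale spectral_completion = spectral_measure f \<mu>
  for f :: "'a::euclidean_space \<Rightarrow> real" and \<mu> :: "'a measure" +
  fixes \<iota> :: "('a \<Rightarrow> real) \<Rightarrow> 'h::{real_inner,complete_space}"
  assumes completion: "schwartz_completion f \<iota>"
begin

lemma iota_lincomb:
  "schwartz \<phi> \<Longrightarrow> schwartz \<psi> \<Longrightarrow> \<iota> (\<lambda>x. a * \<phi> x + b * \<psi> x) = a *\<^sub>R \<iota> \<phi> + b *\<^sub>R \<iota> \<psi>"
  using completion by (simp add: schwartz_completion_def)

lemma iota_inner: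
  "schwartz \<phi> \<Longrightarrow> schwartz \<psi> \<Longrightarrow> \<iota> \<phi> \<bullet> \<iota> \<psi> = Re (LINT \<xi>|\<mu>. FT lborel \<phi> \<xi> * cnj (FT lborel \<psi> \<xi>))"
  using completion by (simp add: schwartz_completion_def cov_form_eq_FT)

lemma iota_sum:
  assumes "\<And>i. i \<in> I \<Longrightarrow> schwartz (\<phi> i)"
  shows "\<iota> (\<lambda>x. \<Sum>i\<in>I. c i * \<phi> i x) = (\<Sum>i\<in>I. c i *\<^sub>R \<iota> (\<phi> i))"
  using assms
proof (induction I rule: infinite_finite_induct)
  case (insert i I)
  then show ?case
    using iota_lincomb[of "\<phi> i" "\<lambda>x. \<Sum>i\<in>I. c i * \<phi> i x" "c i" 1] schwartz_sum[of I \<phi> c] by simp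
qed (use iota_lincomb[OF schwartz_zero schwartz_zero, of 0 0] in simp_all)

lemma norm_iota_diff:
  assumes "schwartz \<phi>" "schwartz \<psi>"
  shows "ennreal ((norm (\<iota> \<phi> - \<iota> \<psi>))\<^sup>2) = energy (\<lambda>\<xi>. FT lborel \<phi> \<xi> - FT lborel \<psi> \<xi>)"
proof -
  define d where "d = (\<lambda>x. 1 * \<phi> x + (- 1) * \<psi> x)"
  have d: "schwartz d" unfolding d_def by (intro schwartz_lincomb assms)
  have "\<iota> \<phi> - \<iota> \<psi> = \<iota> d" unfolding d_def by (subst iota_lincomb) (simp_all add: assms)
  then have "(norm (\<iota> \<phi> - \<iota> \<psi>))\<^sup>2 = Re (LINT \<xi>|\<mu>. FT lborel d \<xi> * cnj (FT lborel d \<xi>))"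
    by (simp add: power2_norm_eq_inner iota_inner d)
  also have "\<dots> = (LINT \<xi>|\<mu>. (cmod (FT lborel d \<xi>))\<^sup>2)"
    by (simp only: complex_norm_square[symmetric] integral_complex_of_real Re_complex_of_real)
  finally have "ennreal ((norm (\<iota> \<phi> - \<iota> \<psi>))\<^sup>2) = energy (FT lborel d)"
    unfolding energy_def by (simp add: nn_integral_eq_integral FT_schwartz_square_integrable[OF d])
  moreover have "FT lborel d = (\<lambda>\<xi>. FT lborel \<phi> \<xi> - FT lborel \<psi> \<xi>)"
    unfolding d_def by (rule ext, subst FT_lincomb) (simp_all add: assms)
  ultimately show ?thesis by simp
qed

text \<open>
The graph of the extension of the Fourier transform to the completion: \<open>\<Phi>\<close> is the transform of the
vector \<open>h\<close>. A relation is convenient because \<open>\<Phi>\<close> is determined up to \<open>\<mu>\<close>-null sets only.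
\<close>
definition spectral :: "'h \<Rightarrow> ('a \<Rightarrow> complex) \<Rightarrow> bool" where
  "spectral h \<Phi> \<longleftrightarrow> \<Phi> \<in> borel_measurable borel \<and>
     (\<exists>u. (\<forall>n. schwartz (u n)) \<and> (\<lambda>n. \<iota> (u n)) \<longlonglongrightarrow> h \<and>
          (\<lambda>n. energy (\<lambda>\<xi>. FT lborel (u n) \<xi> - \<Phi> \<xi>)) \<longlonglongrightarrow> 0)"

lemma spectral_iota: "schwartz u \<Longrightarrow> spectral (\<iota> u) (FT lborel u)"
  unfolding spectral_def by (auto intro!: exI[of _ "\<lambda>_. u"] simp: energy_def)

text \<open>
The graph is closed, and convergence of the transforms forces convergence of the vectors, since the
transform is an isometry and the completion is complete.
\<close>
lemma spectral_limit:
  assumes h: "\<And>n. spectral (h n) (\<Phi> n)" and [measurable]: "\<Psi> \<in> borel_measurable borel"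
    and lim: "(\<lambda>n. energy (\<lambda>\<xi>. \<Phi> n \<xi> - \<Psi> \<xi>)) \<longlonglongrightarrow> 0"
  shows "\<exists>k. h \<longlonglongrightarrow> k \<and> spectral k \<Psi>"
proof -
  have [measurable]: "\<Phi> n \<in> borel_measurable borel" for n using h by (simp add: spectral_def)
  have "\<exists>u. schwartz u \<and> norm (\<iota> u - h n) < 1 / real (Suc n) \<and>
      energy (\<lambda>\<xi>. FT lborel u \<xi> - \<Phi> n \<xi>) < ennreal (1 / real (Suc n))" for n
  proof -
    obtain u where u: "\<And>n. schwartz (u n)" "(\<lambda>k. \<iota> (u k)) \<longlonglongrightarrow> h n"
      "(\<lambda>k. energy (\<lambda>\<xi>. FT lborel (u k) \<xi> - \<Phi> n \<xi>)) \<longlonglongrightarrow> 0"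
      using h[of n] by (auto simp: spectral_def)
    have "eventually (\<lambda>k. dist (\<iota> (u k)) (h n) < 1 / real (Suc n)) sequentially"
      using tendstoD[OF u(2)] by simp
    moreover have "eventually (\<lambda>k. energy (\<lambda>\<xi>. FT lborel (u k) \<xi> - \<Phi> n \<xi>) < ennreal (1 / real (Suc n))) sequentially"
      using order_tendstoD(2)[OF u(3)] by simp
    ultimately have "eventually (\<lambda>k. dist (\<iota> (u k)) (h n) < 1 / real (Suc n) \<and>
        energy (\<lambda>\<xi>. FT lborel (u k) \<xi> - \<Phi> n \<xi>) < ennreal (1 / real (Suc n))) sequentially"
      by (rule eventually_conj)
    then show ?thesis using u(1) by (auto simp: eventually_sequentially dist_norm)
  qed
  then obtain u where u: "\<And>n. schwartz (u n)" "\<And>n. norm (\<iota> (u n) - h n) < 1 / real (Suc n)"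
    "\<And>n. energy (\<lambda>\<xi>. FT lborel (u n) \<xi> - \<Phi> n \<xi>) < ennreal (1 / real (Suc n))"
    by metis
  note [measurable] = FT_schwartz_measurable[OF u(1)]
  have z: "(\<lambda>n. 1 / real (Suc n)) \<longlonglongrightarrow> 0" by (rule LIMSEQ_Suc[OF lim_1_over_n])
  define a where "a n = energy (\<lambda>\<xi>. FT lborel (u n) \<xi> - \<Psi> \<xi>)" for n
  have a0: "a \<longlonglongrightarrow> 0"
  proof (rule tendsto_sandwich[OF _ _ tendsto_const])
    have "a n \<le> 2 * ennreal (1 / real (Suc n)) + 2 * energy (\<lambda>\<xi>. \<Phi> n \<xi> - \<Psi> \<xi>)" for n
    proof -
      have "a n \<le> 2 * energy (\<lambda>\<xi>. FT lborel (u n) \<xi> - \<Phi> n \<xi>) + 2 * energy (\<lambda>\<xi>. \<Phi> n \<xi> - \<Psi> \<xi>)"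
        unfolding a_def by (rule energy_triangle) measurable
      also have "\<dots> \<le> 2 * ennreal (1 / real (Suc n)) + 2 * energy (\<lambda>\<xi>. \<Phi> n \<xi> - \<Psi> \<xi>)"
        using u(3)[of n] by (intro add_mono mult_left_mono) (auto simp: less_imp_le)
      finally show ?thesis .
    qed
    then show "\<forall>\<^sub>F n in sequentially. a n \<le> 2 * ennreal (1 / real (Suc n)) + 2 * energy (\<lambda>\<xi>. \<Phi> n \<xi> - \<Psi> \<xi>)"
      by simp
    have "(\<lambda>n. 2 * ennreal (1 / real (Suc n)) + 2 * energy (\<lambda>\<xi>. \<Phi> n \<xi> - \<Psi> \<xi>)) \<longlonglongrightarrow> 2 * ennreal 0 + 2 * 0"
      by (intro tendsto_add ennreal_tendsto_cmult tendsto_ennrealI z lim) auto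
    then show "(\<lambda>n. 2 * ennreal (1 / real (Suc n)) + 2 * energy (\<lambda>\<xi>. \<Phi> n \<xi> - \<Psi> \<xi>)) \<longlonglongrightarrow> 0" by simp
  qed simp
  have "Cauchy (\<lambda>n. \<iota> (u n))"
  proof (rule metric_CauchyI)
    fix e :: real assume e: "0 < e"
    have "eventually (\<lambda>n. a n < ennreal (e\<^sup>2 / 4)) sequentially"
      using order_tendstoD(2)[OF a0] e by simp
    then obtain N where N: "\<And>n. N \<le> n \<Longrightarrow> a n < ennreal (e\<^sup>2 / 4)" by (auto simp: eventually_sequentially)
    have "dist (\<iota> (u m)) (\<iota> (u n)) < e" if "N \<le> m" "N \<le> n" for m n
    proof -
      have "ennreal ((norm (\<iota> (u m) - \<iota> (u n)))\<^sup>2) \<le> 2 * a m + 2 * energy (\<lambda>\<xi>. \<Psi> \<xi> - FT lborel (u n) \<xi>)"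
        unfolding norm_iota_diff[OF u(1) u(1)] a_def by (rule energy_triangle) measurable
      also have "\<dots> = 2 * a m + 2 * a n" by (simp only: a_def energy_commute[of \<Psi>])
      also have "\<dots> < 2 * ennreal (e\<^sup>2 / 4) + 2 * ennreal (e\<^sup>2 / 4)"
        using N[OF that(1)] N[OF that(2)]
        by (intro add_strict_mono ennreal_mult_strict_left_mono) (auto simp: less_top[symmetric])
      also have "\<dots> = ennreal (e\<^sup>2)"
      proof -
        have "2 * ennreal (e\<^sup>2 / 4) = ennreal (e\<^sup>2 / 2)"
          using ennreal_mult[of 2 "e\<^sup>2 / 4"] by simp
        then show ?thesis using ennreal_plus[of "e\<^sup>2 / 2" "e\<^sup>2 / 2"] by simp
      qed
      finally have "(norm (\<iota> (u m) - \<iota> (u n)))\<^sup>2 < e\<^sup>2" by (simp add: ennreal_less_iff)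
      then show ?thesis using e by (simp add: dist_norm power_less_imp_less_base)
    qed
    then show "\<exists>M. \<forall>m\<ge>M. \<forall>n\<ge>M. dist (\<iota> (u m)) (\<iota> (u n)) < e" by blast
  qed
  then obtain k where k: "(\<lambda>n. \<iota> (u n)) \<longlonglongrightarrow> k" using Cauchy_convergent convergent_def by blast
  have "(\<lambda>n. \<iota> (u n) - h n) \<longlonglongrightarrow> 0"
    by (rule tendsto_norm_zero_cancel, rule tendsto_sandwich[OF _ _ tendsto_const z])
       (intro always_eventually allI norm_ge_zero less_imp_le u(2))+
  from tendsto_diff[OF k this] have "h \<longlonglongrightarrow> k" by simp
  moreover have "spectral k \<Psi>"
    unfolding spectral_def using u(1) k a0 by (auto simp: a_def[abs_def])
  ultimately show ?thesis by blast
qed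

text \<open>
The factor 2 comes from the crude triangle inequality for the squared norm; it is harmless for
square integrability.
\<close>
lemma spectral_norm_le:
  assumes "spectral h \<Phi>"
  shows "ennreal ((norm h)\<^sup>2) \<le> 2 * energy \<Phi>"
proof -
  obtain u where u: "\<And>n. schwartz (u n)" "(\<lambda>k. \<iota> (u k)) \<longlonglongrightarrow> h"
      "(\<lambda>k. energy (\<lambda>\<xi>. FT lborel (u k) \<xi> - \<Phi> \<xi>)) \<longlonglongrightarrow> 0"
    and [measurable]: "\<Phi> \<in> borel_measurable borel"
    using assms by (auto simp: spectral_def)
  note [measurable] = FT_schwartz_measurable[OF u(1)]
  have z: "FT lborel (\<lambda>x::'a. 0) \<xi> = 0" for \<xi> by (simp add: FT_def)
  have i0: "\<iota> (\<lambda>x. 0) = 0" using iota_sum[of "{}"] by simp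
  have "ennreal ((norm (\<iota> (u n)))\<^sup>2) \<le> 2 * energy (\<lambda>\<xi>. FT lborel (u n) \<xi> - \<Phi> \<xi>) + 2 * energy \<Phi>" for n
    using norm_iota_diff[OF u(1) schwartz_zero, of n] energy_triangle[of "FT lborel (u n)" \<Phi> "\<lambda>_. 0"]
    by (simp add: z i0)
  moreover have "(\<lambda>n. ennreal ((norm (\<iota> (u n)))\<^sup>2)) \<longlonglongrightarrow> ennreal ((norm h)\<^sup>2)"
    by (intro tendsto_intros tendsto_ennrealI u)
  moreover have "(\<lambda>n. 2 * energy (\<lambda>\<xi>. FT lborel (u n) \<xi> - \<Phi> \<xi>) + 2 * energy \<Phi>) \<longlonglongrightarrow> 2 * 0 + 2 * energy \<Phi>"
    by (intro tendsto_add ennreal_tendsto_cmult u tendsto_const) auto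
  ultimately show ?thesis by (auto intro: LIMSEQ_le)
qed

text \<open>
Both sides are continuous along the sequence of Schwartz functions that defines \<open>spectral\<close>.
\<close>
lemma spectral_inner_iota:
  assumes "spectral h \<Phi>" and fin: "energy \<Phi> < \<infinity>" and \<phi>: "schwartz \<phi>"
  shows "h \<bullet> \<iota> \<phi> = Re (LINT \<xi>|\<mu>. \<Phi> \<xi> * cnj (FT lborel \<phi> \<xi>))"
proof -
  obtain u where u: "\<And>n. schwartz (u n)" "(\<lambda>k. \<iota> (u k)) \<longlonglongrightarrow> h"
      "(\<lambda>k. energy (\<lambda>\<xi>. FT lborel (u k) \<xi> - \<Phi> \<xi>)) \<longlonglongrightarrow> 0"
    and m [measurable]: "\<Phi> \<in> borel_measurable borel"
    using assms(1) by (auto simp: spectral_def)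
  note [measurable] = FT_schwartz_measurable[OF u(1)] FT_schwartz_measurable[OF \<phi>]
  note fins = energy_FT_schwartz_finite[OF u(1)] energy_FT_schwartz_finite[OF \<phi>]
  let ?I = "\<lambda>\<Phi>. LINT \<xi>|\<mu>. \<Phi> \<xi> * cnj (FT lborel \<phi> \<xi>)"
  have le: "ennreal ((cmod (?I (FT lborel (u n)) - ?I \<Phi>))\<^sup>2) \<le> energy (\<lambda>\<xi>. FT lborel (u n) \<xi> - \<Phi> \<xi>) * energy (FT lborel \<phi>)" for n
  proof -
    have "?I (FT lborel (u n)) - ?I \<Phi> = ?I (\<lambda>\<xi>. FT lborel (u n) \<xi> - \<Phi> \<xi>)"
      unfolding left_diff_distrib
      by (rule Bochner_Integration.integral_diff[symmetric]; rule integrable_energy_mult) (use fins fin in auto)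
    then show ?thesis using inner_energy_bound[of "\<lambda>\<xi>. FT lborel (u n) \<xi> - \<Phi> \<xi>" "FT lborel \<phi>"] by simp
  qed
  have lim: "(\<lambda>n. energy (\<lambda>\<xi>. FT lborel (u n) \<xi> - \<Phi> \<xi>) * energy (FT lborel \<phi>)) \<longlonglongrightarrow> 0"
    using ennreal_tendsto_cmult[OF _ u(3), of "energy (FT lborel \<phi>)"] fins(2) by (simp add: mult.commute)
  have "(\<lambda>n. ennreal ((cmod (?I (FT lborel (u n)) - ?I \<Phi>))\<^sup>2)) \<longlonglongrightarrow> 0"
    by (rule tendsto_sandwich[OF _ _ tendsto_const lim]) (simp_all add: le)
  then have "(\<lambda>n. ennreal ((cmod (?I (FT lborel (u n)) - ?I \<Phi>))\<^sup>2)) \<longlonglongrightarrow> ennreal 0" by simp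
  then have "(\<lambda>n. (cmod (?I (FT lborel (u n)) - ?I \<Phi>))\<^sup>2) \<longlonglongrightarrow> 0"
    by (subst (asm) tendsto_ennreal_iff) auto
  then have "(\<lambda>n. sqrt ((cmod (?I (FT lborel (u n)) - ?I \<Phi>))\<^sup>2)) \<longlonglongrightarrow> sqrt 0"
    by (rule tendsto_real_sqrt)
  then have "(\<lambda>n. ?I (FT lborel (u n)) - ?I \<Phi>) \<longlonglongrightarrow> 0"
    by (simp add: tendsto_norm_zero_iff)
  then have "(\<lambda>n. ?I (FT lborel (u n))) \<longlonglongrightarrow> ?I \<Phi>" by (simp add: LIM_zero_iff)
  then have "(\<lambda>n. Re (?I (FT lborel (u n)))) \<longlonglongrightarrow> Re (?I \<Phi>)" by (rule tendsto_Re)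
  moreover have "(\<lambda>n. \<iota> (u n) \<bullet> \<iota> \<phi>) \<longlonglongrightarrow> h \<bullet> \<iota> \<phi>" by (intro tendsto_intros u)
  ultimately show ?thesis unfolding iota_inner[OF u(1) \<phi>] by (blast intro: LIMSEQ_unique)
qed

text \<open>
A signed measure with square integrable transform is an element of the Hilbert space, obtained as an
iterated limit of vectors that depend on the measure through finitely many real numbers.
\<close>
lemma spectral_discretize_limit:
  assumes \<sigma>: "\<And>n. 0 < \<sigma> n" "\<sigma> \<longlonglongrightarrow> 0" and s: "\<And>i. simple_function borel (s i)" "\<And>x. (\<lambda>i. s i x) \<longlonglongrightarrow> x"
    and M: "sigma_finite_measure M" "sets M = sets borel" and z: "integrable M z" and fin: "energy (FT M z) < \<infinity>"
  shows "\<exists>H h. (\<forall>n. (\<lambda>i. \<iota> (discretize (s i) (\<sigma> n) M z)) \<longlonglongrightarrow> H n) \<and> H \<longlonglongrightarrow> h \<and> spectral h (FT M z)"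
proof -
  have [measurable]: "z \<in> borel_measurable M" using z by simp
  have [measurable]: "FT M z \<in> borel_measurable borel" using FT_measurable[OF M(1) _ M(2)] by simp
  have "\<exists>k. (\<lambda>i. \<iota> (discretize (s i) (\<sigma> n) M z)) \<longlonglongrightarrow> k \<and> spectral k (\<lambda>\<xi>. of_real (damp (\<sigma> n) \<xi>) * FT M z \<xi>)" for n
  proof (rule spectral_limit)
    show "spectral (\<iota> (discretize (s i) (\<sigma> n) M z)) (FT lborel (discretize (s i) (\<sigma> n) M z))" for i
      by (intro spectral_iota schwartz_discretize \<sigma>)
    show "(\<lambda>i. energy (\<lambda>\<xi>. FT lborel (discretize (s i) (\<sigma> n) M z) \<xi> - of_real (damp (\<sigma> n) \<xi>) * FT M z \<xi>)) \<longlonglongrightarrow> 0"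
      by (rule energy_discretize_tendsto[OF \<sigma>(1) s M z])
  qed measurable
  then have "\<forall>n. \<exists>k. (\<lambda>i. \<iota> (discretize (s i) (\<sigma> n) M z)) \<longlonglongrightarrow> k \<and> spectral k (\<lambda>\<xi>. of_real (damp (\<sigma> n) \<xi>) * FT M z \<xi>)"
    by blast
  from choice[OF this] obtain H where H: "\<And>n. (\<lambda>i. \<iota> (discretize (s i) (\<sigma> n) M z)) \<longlonglongrightarrow> H n"
    "\<And>n. spectral (H n) (\<lambda>\<xi>. of_real (damp (\<sigma> n) \<xi>) * FT M z \<xi>)" by auto
  have "\<exists>h. H \<longlonglongrightarrow> h \<and> spectral h (FT M z)"
  proof (rule spectral_limit)
    show "spectral (H n) (\<lambda>\<xi>. of_real (damp (\<sigma> n) \<xi>) * FT M z \<xi>)" for n by (rule H(2))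
    show "(\<lambda>n. energy (\<lambda>\<xi>. of_real (damp (\<sigma> n) \<xi>) * FT M z \<xi> - FT M z \<xi>)) \<longlonglongrightarrow> 0"
      by (rule energy_damp_tendsto) (use fin \<sigma> in auto)
  qed measurable
  then obtain h where "H \<longlonglongrightarrow> h" "spectral h (FT M z)" by auto
  then show ?thesis by (intro exI[of _ H] exI[of _ h] conjI allI H(1))
qed

end

section \<open>Measurability of integrals against a time kernel\<close>

locale bounded_time_kernel =
  fixes \<Gamma> :: "real \<Rightarrow> 'a::euclidean_space measure" and T C :: real
  assumes kernel: "time_kernel \<Gamma>" and C_pos: "0 < C"
    and mass_le: "\<And>t. t \<in> {0..T} \<Longrightarrow> emeasure (\<Gamma> t) UNIV \<le> ennreal C"
begin

lemma sets_\<Gamma>: "t \<in> {0..T} \<Longrightarrow> sets (\<Gamma> t) = sets borel"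
  using kernel by (simp add: time_kernel_def)

lemma space_\<Gamma>: "t \<in> {0..T} \<Longrightarrow> space (\<Gamma> t) = UNIV"
  using sets_eq_imp_space_eq[OF sets_\<Gamma>] by simp

lemma finite_measure_\<Gamma>: "t \<in> {0..T} \<Longrightarrow> finite_measure (\<Gamma> t)"
  using mass_le[of t] by (intro finite_measureI) (auto simp: space_\<Gamma> top_unique)

text \<open>
Dividing by the mass bound \<open>C\<close> turns the measures into a subprobability kernel, for which integrals
against a jointly measurable function depend measurably on the parameter.
\<close>
lemma kernel_nn_integral_measurable:
  assumes \<tau>: "\<tau> \<in> borel_measurable N" and T: "\<And>x. x \<in> space N \<Longrightarrow> \<tau> x \<in> {0..T}"
    and h: "(\<lambda>(x, y). h x y) \<in> borel_measurable (N \<Otimes>\<^sub>M borel)"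
  shows "(\<lambda>x. \<integral>\<^sup>+ y. h x y \<partial>\<Gamma> (\<tau> x)) \<in> borel_measurable N"
proof -
  let ?c = "ennreal (1 / C)"
  have c1: "ennreal C * ?c = 1" using C_pos by (simp add: ennreal_mult[symmetric])
  have \<tau>0: "\<tau> \<in> measurable N (restrict_space borel {0..})"
    using \<tau> T by (intro measurable_restrict_space2) auto
  have L: "(\<lambda>x. density (\<Gamma> (\<tau> x)) (\<lambda>_. ?c)) \<in> measurable N (subprob_algebra borel)"
  proof (rule measurable_subprob_algebra)
    fix x assume x: "x \<in> space N"
    show "subprob_space (density (\<Gamma> (\<tau> x)) (\<lambda>_. ?c))"
    proof (rule subprob_spaceI)
      have "emeasure (density (\<Gamma> (\<tau> x)) (\<lambda>_. ?c)) UNIV = ?c * emeasure (\<Gamma> (\<tau> x)) UNIV"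
        by (simp add: emeasure_density_const sets_\<Gamma>[OF T[OF x]])
      also have "\<dots> \<le> ?c * ennreal C" using mass_le[OF T[OF x]] by (intro mult_left_mono) auto
      finally show "emeasure (density (\<Gamma> (\<tau> x)) (\<lambda>_. ?c)) (space (density (\<Gamma> (\<tau> x)) (\<lambda>_. ?c))) \<le> 1"
        using c1 by (simp add: mult.commute space_\<Gamma>[OF T[OF x]])
    qed (simp add: space_\<Gamma>[OF T[OF x]])
    show "sets (density (\<Gamma> (\<tau> x)) (\<lambda>_. ?c)) = sets borel" by (simp add: sets_\<Gamma>[OF T[OF x]])
  next
    fix A :: "'a set" assume A: "A \<in> sets borel"
    have "(\<lambda>t. emeasure (\<Gamma> t) A) \<in> borel_measurable (restrict_space borel {0..})"
      using kernel A by (simp add: time_kernel_def)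
    from measurable_compose[OF \<tau>0 this]
    have [measurable]: "(\<lambda>x. emeasure (\<Gamma> (\<tau> x)) A) \<in> borel_measurable N" .
    have "(\<lambda>x. ?c * emeasure (\<Gamma> (\<tau> x)) A) \<in> borel_measurable N" by measurable
    then show "(\<lambda>x. emeasure (density (\<Gamma> (\<tau> x)) (\<lambda>_. ?c)) A) \<in> borel_measurable N"
      by (subst measurable_cong[where g="\<lambda>x. ?c * emeasure (\<Gamma> (\<tau> x)) A"])
         (auto simp: emeasure_density_const A sets_\<Gamma>[OF T])
  qed
  have [measurable]: "(\<lambda>x. integral\<^sup>N (density (\<Gamma> (\<tau> x)) (\<lambda>_. ?c)) (h x)) \<in> borel_measurable N"
    by (rule nn_integral_measurable_subprob_algebra2[OF h L])
  have "(\<lambda>x. ennreal C * integral\<^sup>N (density (\<Gamma> (\<tau> x)) (\<lambda>_. ?c)) (h x)) \<in> borel_measurable N"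
    by measurable
  moreover have "ennreal C * integral\<^sup>N (density (\<Gamma> (\<tau> x)) (\<lambda>_. ?c)) (h x) = (\<integral>\<^sup>+ y. h x y \<partial>\<Gamma> (\<tau> x))"
    if x: "x \<in> space N" for x
  proof -
    note [measurable_cong] = sets_\<Gamma>[OF T[OF x]]
    have [measurable]: "h x \<in> borel_measurable (\<Gamma> (\<tau> x))"
      using measurable_Pair2[OF h x] by simp
    have "ennreal C * integral\<^sup>N (density (\<Gamma> (\<tau> x)) (\<lambda>_. ?c)) (h x) = (ennreal C * ?c) * (\<integral>\<^sup>+ y. h x y \<partial>\<Gamma> (\<tau> x))"
      by (simp add: nn_integral_density nn_integral_cmult mult.assoc)
    then show ?thesis by (simp add: c1)
  qed
  ultimately show ?thesis by (subst (asm) measurable_cong) auto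
qed

text \<open>
The default value 0 of a divergent integral is taken on a measurable set.
\<close>
lemma kernel_integral_measurable_real:
  fixes h :: "_ \<Rightarrow> 'a \<Rightarrow> real"
  assumes \<tau>: "\<tau> \<in> borel_measurable N" and T: "\<And>x. x \<in> space N \<Longrightarrow> \<tau> x \<in> {0..T}"
    and h [measurable]: "(\<lambda>(x, y). h x y) \<in> borel_measurable (N \<Otimes>\<^sub>M borel)"
  shows "(\<lambda>x. LINT y|\<Gamma> (\<tau> x). h x y) \<in> borel_measurable N"
proof -
  note nn [measurable] = kernel_nn_integral_measurable[OF \<tau> T]
  have eq: "(LINT y|\<Gamma> (\<tau> x). h x y) = (if (\<integral>\<^sup>+ y. ennreal \<bar>h x y\<bar> \<partial>\<Gamma> (\<tau> x)) < \<infinity>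
      then enn2real (\<integral>\<^sup>+ y. ennreal (h x y) \<partial>\<Gamma> (\<tau> x)) - enn2real (\<integral>\<^sup>+ y. ennreal (- h x y) \<partial>\<Gamma> (\<tau> x)) else 0)"
    if x: "x \<in> space N" for x
  proof -
    note [measurable_cong] = sets_\<Gamma>[OF T[OF x]]
    have [measurable]: "h x \<in> borel_measurable (\<Gamma> (\<tau> x))"
      using measurable_Pair2[OF h x] by simp
    have "integrable (\<Gamma> (\<tau> x)) (h x) \<longleftrightarrow> (\<integral>\<^sup>+ y. ennreal \<bar>h x y\<bar> \<partial>\<Gamma> (\<tau> x)) < \<infinity>"
      by (simp add: integrable_iff_bounded)
    then show ?thesis by (simp add: real_lebesgue_integral_def not_integrable_integral_eq)
  qed
  have [measurable]: "(\<lambda>x. \<integral>\<^sup>+ y. ennreal \<bar>h x y\<bar> \<partial>\<Gamma> (\<tau> x)) \<in> borel_measurable N"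
    "(\<lambda>x. \<integral>\<^sup>+ y. ennreal (h x y) \<partial>\<Gamma> (\<tau> x)) \<in> borel_measurable N"
    "(\<lambda>x. \<integral>\<^sup>+ y. ennreal (- h x y) \<partial>\<Gamma> (\<tau> x)) \<in> borel_measurable N"
    by (intro kernel_nn_integral_measurable[OF \<tau> T]; simp)+
  show ?thesis by (subst measurable_cong[OF eq]) (simp, measurable)
qed

lemma kernel_integral_measurable_complex:
  fixes h :: "_ \<Rightarrow> 'a \<Rightarrow> complex"
  assumes \<tau>: "\<tau> \<in> borel_measurable N" and T: "\<And>x. x \<in> space N \<Longrightarrow> \<tau> x \<in> {0..T}"
    and h [measurable]: "(\<lambda>(x, y). h x y) \<in> borel_measurable (N \<Otimes>\<^sub>M borel)"
  shows "(\<lambda>x. LINT y|\<Gamma> (\<tau> x). h x y) \<in> borel_measurable N"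
proof -
  have eq: "(LINT y|\<Gamma> (\<tau> x). h x y) = (if (\<integral>\<^sup>+ y. ennreal (cmod (h x y)) \<partial>\<Gamma> (\<tau> x)) < \<infinity>
      then of_real (LINT y|\<Gamma> (\<tau> x). Re (h x y)) + \<i> * of_real (LINT y|\<Gamma> (\<tau> x). Im (h x y)) else 0)"
    if x: "x \<in> space N" for x
  proof -
    note [measurable_cong] = sets_\<Gamma>[OF T[OF x]]
    have [measurable]: "h x \<in> borel_measurable (\<Gamma> (\<tau> x))"
      using measurable_Pair2[OF h x] by simp
    have i: "integrable (\<Gamma> (\<tau> x)) (h x) \<longleftrightarrow> (\<integral>\<^sup>+ y. ennreal (cmod (h x y)) \<partial>\<Gamma> (\<tau> x)) < \<infinity>"
      by (simp add: integrable_iff_bounded)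
    show ?thesis
    proof (cases "integrable (\<Gamma> (\<tau> x)) (h x)")
      case True
      then show ?thesis using i by (simp add: complex_eq_iff)
    qed (use i in \<open>simp add: not_integrable_integral_eq\<close>)
  qed
  have [measurable]: "(\<lambda>x. \<integral>\<^sup>+ y. ennreal (cmod (h x y)) \<partial>\<Gamma> (\<tau> x)) \<in> borel_measurable N"
    by (intro kernel_nn_integral_measurable[OF \<tau> T]; simp)
  have [measurable]: "(\<lambda>x. LINT y|\<Gamma> (\<tau> x). Re (h x y)) \<in> borel_measurable N"
    "(\<lambda>x. LINT y|\<Gamma> (\<tau> x). Im (h x y)) \<in> borel_measurable N"
    by (intro kernel_integral_measurable_real[OF \<tau> T]; simp)+
  show ?thesis by (subst measurable_cong[OF eq]) (simp, measurable)
qed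

end

text \<open>
Sums of measurable functions with values in a space without a countable base need not be measurable, as
the Borel sets of its square may exceed the product of the Borel sets. Here the coefficients form a
measurable map into a sequence space, which does have a countable base, and the vectors enter through a
continuous map on that space.
\<close>
lemma borel_measurable_finite_lincomb:
  fixes v :: "'q \<Rightarrow> 'h::real_normed_vector"
  assumes I: "finite I" and c: "\<And>q. q \<in> I \<Longrightarrow> c q \<in> borel_measurable N"
  shows "(\<lambda>x. \<Sum>q\<in>I. c q x *\<^sub>R v q) \<in> borel_measurable N"
proof -
  obtain e where e: "bij_betw e {0..<card I} I" using ex_bij_betw_nat_finite[OF I] by blast
  define F :: "(nat \<Rightarrow> real) \<Rightarrow> 'h" where "F y = (\<Sum>k\<in>{0..<card I}. y k *\<^sub>R v (e k))" for y
  have "continuous_on UNIV F"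
    unfolding F_def by (intro continuous_on_sum continuous_on_scaleR continuous_on_product_coordinates continuous_on_const)
  then have "F \<in> borel_measurable borel" by (rule borel_measurable_continuous_onI)
  moreover have "(\<lambda>x k. if k < card I then c (e k) x else 0) \<in> borel_measurable N"
  proof (rule measurable_coordinatewise_then_product)
    fix k
    have "k < card I \<Longrightarrow> c (e k) \<in> borel_measurable N"
      using e by (intro c) (auto simp: bij_betw_def)
    then show "(\<lambda>x. if k < card I then c (e k) x else 0) \<in> borel_measurable N"
      by (cases "k < card I") simp_all
  qed
  ultimately have "(\<lambda>x. F (\<lambda>k. if k < card I then c (e k) x else 0)) \<in> borel_measurable N"
    by (rule measurable_compose[rotated])
  moreover have "F (\<lambda>k. if k < card I then c (e k) x else 0) = (\<Sum>q\<in>I. c q x *\<^sub>R v q)" for x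
    unfolding F_def by (simp add: sum.reindex_bij_betw[OF e, symmetric])
  ultimately show ?thesis by simp
qed

section \<open>The predictable sigma-algebra\<close>

text \<open>
The generators are null sets and events of the variables \<open>W\<^sub>T (1\<^sub>[\<^sub>0\<^sub>,\<^sub>s\<^sub>] h)\<close>; these variables are measurable
because the indicator times a fixed vector is an admissible integrand.
\<close>
lemma noise_filtration_subset:
  fixes W\<^sub>T :: "(real \<Rightarrow> 'h::real_normed_vector) \<Rightarrow> 'w \<Rightarrow> real"
  assumes W: "centered_gaussian_family P (Collect (square_integrable (time_measure T))) W\<^sub>T"
  shows "sets (noise_filtration P W\<^sub>T t) \<subseteq> sets P" and "space P \<in> sets (noise_filtration P W\<^sub>T t)"
proof -
  let ?G = "null_sets P \<union> {W\<^sub>T (\<lambda>r. indicator {0..s} r *\<^sub>R h) -` B \<inter> space P | h s B.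
         0 \<le> s \<and> s \<le> t \<and> B \<in> sets borel}"
  have sq: "square_integrable (time_measure T) (\<lambda>r. indicator {0..s} r *\<^sub>R h :: 'h)" for s h
      unfolding square_integrable_def
  proof
    have "(\<lambda>c::real. c *\<^sub>R h) \<in> borel_measurable borel"
      by (intro borel_measurable_continuous_onI continuous_intros)
    moreover have "(indicator {0..s} :: real \<Rightarrow> real) \<in> borel_measurable (time_measure T)"
      by (intro measurable_restrict_space1) simp
    ultimately show m [measurable]: "(\<lambda>r. indicator {0..s} r *\<^sub>R h) \<in> borel_measurable (time_measure T)"
      by (rule measurable_compose[rotated])
    have fm: "finite_measure (time_measure T)"
      by (intro finite_measureI) (simp add: emeasure_restrict_space space_restrict_space emeasure_lborel_Icc_eq)
    show "integrable (time_measure T) (\<lambda>r. (norm (indicator {0..s} r *\<^sub>R h :: 'h))\<^sup>2)"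
    proof (rule finite_measure.integrable_const_bound[OF fm, of _ "(norm h)\<^sup>2"])
      show "(\<lambda>r. (norm (indicator {0..s} r *\<^sub>R h :: 'h))\<^sup>2) \<in> borel_measurable (time_measure T)"
        using measurable_compose[OF m borel_measurable_norm] by (rule borel_measurable_power)
    qed (auto simp: indicator_def)
  qed
  have m: "W\<^sub>T g \<in> borel_measurable P" if "square_integrable (time_measure T) g" for g
  proof -
    have "centered_gaussian P (\<lambda>\<omega>. \<Sum>i\<in>{g}. 1 * W\<^sub>T i \<omega>)"
      using W[unfolded centered_gaussian_family_def, rule_format, of "{g}" "\<lambda>_. 1"] that by simp
    then show ?thesis by (simp add: centered_gaussian_def)
  qed
  have G: "?G \<subseteq> sets P"
    using measurable_sets[OF m[OF sq]] by auto
  then have "?G \<subseteq> Pow (space P)" using sets.sets_into_space by blast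
  then show "sets (noise_filtration P W\<^sub>T t) \<subseteq> sets P"
    using G by (simp add: noise_filtration_def sets.sigma_sets_subset)
  have "space (noise_filtration P W\<^sub>T t) = space P"
    using \<open>?G \<subseteq> Pow (space P)\<close> by (simp add: noise_filtration_def space_measure_of_conv)
  then show "space P \<in> sets (noise_filtration P W\<^sub>T t)" using sets.top by metis
qed

locale predictable_setting = P: prob_space P
  for P :: "'w measure" +
  fixes \<F> :: "real \<Rightarrow> 'w measure" and T :: real
  assumes T_pos: "0 < T"
    and filtration_sub: "\<And>s. sets (\<F> s) \<subseteq> sets P"
    and filtration_space: "\<And>s. space P \<in> sets (\<F> s)"
begin

abbreviation "\<P> \<equiv> predictable_sigma P \<F> T"

lemma generator_subset:
  "{A \<times> {s<..t} | A s t. 0 \<le> s \<and> s < t \<and> t \<le> T \<and> A \<in> sets (\<F> s)} \<subseteq> Pow (space P \<times> {0..T})"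
  using filtration_sub sets.sets_into_space[of _ P] by fastforce

lemma space_predictable: "space \<P> = space P \<times> {0..T}"
  by (simp add: predictable_sigma_def space_measure_of_conv)

lemma sets_predictable: "sets \<P> = sigma_sets (space P \<times> {0..T})
    {A \<times> {s<..t} | A s t. 0 \<le> s \<and> s < t \<and> t \<le> T \<and> A \<in> sets (\<F> s)}"
  unfolding predictable_sigma_def by (rule sets_measure_of[OF generator_subset])

sublocale time: finite_measure "time_measure T"
  using T_pos by (intro finite_measureI) (simp add: emeasure_restrict_space space_restrict_space emeasure_lborel_Icc)

sublocale pair_sigma_finite P "time_measure T" ..

lemma space_pair: "space (P \<Otimes>\<^sub>M time_measure T) = space P \<times> {0..T}"
  by (simp add: space_pair_measure space_restrict_space)

lemma measurable_id_predictable: "(\<lambda>p. p) \<in> measurable (P \<Otimes>\<^sub>M time_measure T) \<P>"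
  unfolding predictable_sigma_def
proof (rule measurable_measure_of[OF generator_subset])
  fix X assume "X \<in> {A \<times> {s<..t} | A s t. 0 \<le> s \<and> s < t \<and> t \<le> T \<and> A \<in> sets (\<F> s)}"
  then obtain A s t where X: "X = A \<times> {s<..t}" "0 \<le> s" "t \<le> T" "A \<in> sets P"
    using filtration_sub by blast
  have "{s<..t} \<in> sets (time_measure T)"
    using X by (subst sets_restrict_space_iff) auto
  then have "X \<in> sets (P \<Otimes>\<^sub>M time_measure T)" using X by auto
  then show "(\<lambda>p. p) -` X \<inter> space (P \<Otimes>\<^sub>M time_measure T) \<in> sets (P \<Otimes>\<^sub>M time_measure T)" by auto
qed (simp add: space_pair)

lemma measurable_predictable_pair:
  "g \<in> measurable \<P> N \<Longrightarrow> g \<in> measurable (P \<Otimes>\<^sub>M time_measure T) N"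
  by (rule measurable_compose[OF measurable_id_predictable])

lemma measurable_section_predictable:
  assumes "r \<in> {0..T}" shows "(\<lambda>\<omega>. (\<omega>, r)) \<in> measurable P \<P>"
proof -
  have "(\<lambda>\<omega>. (\<omega>, r)) \<in> measurable P (P \<Otimes>\<^sub>M time_measure T)"
    using assms by (intro measurable_Pair measurable_ident measurable_const) (simp_all add: space_restrict_space)
  from measurable_compose[OF this measurable_id_predictable] show ?thesis .
qed

lemma measurable_time_predictable: "snd \<in> borel_measurable \<P>"
proof (rule borel_measurableI_le)
  fix y :: real
  consider "y < 0" | "0 \<le> y" "y < T" | "T \<le> y" by linarith
  then show "{p \<in> space \<P>. snd p \<le> y} \<in> sets \<P>"
  proof cases
    case 1
    then have "{p \<in> space \<P>. snd p \<le> y} = {}" by (auto simp: space_predictable)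
    then show ?thesis by (metis sets.empty_sets)
  next
    case 2
    \<comment> \<open>The complement is taken because time 0 belongs to no generator.\<close>
    then have "space P \<times> {y<..T} \<in> sets \<P>"
      unfolding sets_predictable using filtration_space by (intro sigma_sets.Basic) blast
    then have "space \<P> - space P \<times> {y<..T} \<in> sets \<P>" by (rule sets.compl_sets)
    moreover have "{p \<in> space \<P>. snd p \<le> y} = space \<P> - space P \<times> {y<..T}"
      by (auto simp: space_predictable)
    ultimately show ?thesis by simp
  next
    case 3
    then have "{p \<in> space \<P>. snd p \<le> y} = space \<P>" by (auto simp: space_predictable)
    then show ?thesis by (metis sets.top)
  qed
qed

end

section \<open>The process with values in the completion\<close>

locale walsh_integrand =
  spectral_completion f \<mu> \<iota> + bounded_time_kernel \<Gamma> T C + predictable_setting P \<F> T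
  for f :: "'a::euclidean_space \<Rightarrow> real" and \<mu> and \<iota> :: "('a \<Rightarrow> real) \<Rightarrow> 'h::{real_inner,complete_space}"
    and \<Gamma> T C and P :: "'w measure" and \<F> +
  fixes Z :: "real \<Rightarrow> 'a \<Rightarrow> 'w \<Rightarrow> real" and K :: ennreal
  assumes Z_predictable: "predictable_field P \<F> T Z"
    and K_finite: "K < \<infinity>"
    and Z_moment: "\<And>t x. t \<in> {0..T} \<Longrightarrow> (\<integral>\<^sup>+ \<omega>. ennreal ((Z t x \<omega>)\<^sup>2) \<partial>P) \<le> K"
    and \<Gamma>_energy: "(\<integral>\<^sup>+ t. energy (FT (\<Gamma> t) (\<lambda>_. 1)) \<partial>time_measure T) < \<infinity>"
begin

definition sample :: "'w \<times> real \<Rightarrow> 'a \<Rightarrow> real" where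
  "sample p x = Z (snd p) x (fst p)"

lemma sample_measurable [measurable]: "(\<lambda>(p, x). sample p x) \<in> borel_measurable (\<P> \<Otimes>\<^sub>M borel)"
  using Z_predictable unfolding predictable_field_def sample_def case_prod_beta .

lemma snd_mem: "p \<in> space \<P> \<Longrightarrow> snd p \<in> {0..T}"
  by (auto simp: space_predictable)

lemma sample_section_measurable: "p \<in> space \<P> \<Longrightarrow> sample p \<in> borel_measurable borel"
  using measurable_Pair2[OF sample_measurable] by simp

lemma sample_section_measurable_\<Gamma>: "p \<in> space \<P> \<Longrightarrow> sample p \<in> borel_measurable (\<Gamma> (snd p))"
  using sample_section_measurable[of p] measurable_cong_sets[OF sets_\<Gamma>[OF snd_mem[of p]] refl] by blast

lemma time_section_measurable:
  assumes "r \<in> {0..T}"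
  shows "(\<lambda>(\<omega>, x). sample (\<omega>, r) x) \<in> borel_measurable (P \<Otimes>\<^sub>M borel)"
proof -
  have "(\<lambda>q. ((fst q, r), snd q)) \<in> measurable (P \<Otimes>\<^sub>M borel) (\<P> \<Otimes>\<^sub>M borel)"
    using measurable_compose[OF measurable_fst measurable_section_predictable[OF assms]]
    by (intro measurable_Pair) auto
  from measurable_compose[OF this sample_measurable] show ?thesis by (simp add: case_prod_beta)
qed

definition sample_FT :: "'w \<times> real \<Rightarrow> 'a \<Rightarrow> complex" where
  "sample_FT p = FT (\<Gamma> (snd p)) (sample p)"

lemma sample_FT_measurable [measurable]: "(\<lambda>(p, \<xi>). sample_FT p \<xi>) \<in> borel_measurable (\<P> \<Otimes>\<^sub>M \<mu>)"
proof -
  note [measurable] = measurable_time_predictable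
  have [measurable]: "(\<lambda>q. sample (fst (fst q)) (snd q)) \<in> borel_measurable ((\<P> \<Otimes>\<^sub>M \<mu>) \<Otimes>\<^sub>M borel)"
    by (rule measurable_compose[OF _ sample_measurable, of "\<lambda>q. (fst (fst q), snd q)", simplified]) measurable
  show ?thesis
    unfolding sample_FT_def FT_def case_prod_beta
  proof (rule kernel_integral_measurable_complex)
    show "(\<lambda>x. snd (fst x)) \<in> borel_measurable (\<P> \<Otimes>\<^sub>M \<mu>)" by measurable
    show "(\<lambda>(x, y). chi y (snd x) * complex_of_real (sample (fst x) y)) \<in> borel_measurable ((\<P> \<Otimes>\<^sub>M \<mu>) \<Otimes>\<^sub>M borel)"
      unfolding case_prod_beta by measurable
  qed (auto simp: space_pair_measure space_predictable)
qed

lemma sample_energy_measurable [measurable]: "(\<lambda>p. energy (sample_FT p)) \<in> borel_measurable \<P>"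
  unfolding energy_def by measurable

lemma sample_mass_measurable [measurable]: "(\<lambda>p. \<integral>\<^sup>+ x. ennreal \<bar>sample p x\<bar> \<partial>\<Gamma> (snd p)) \<in> borel_measurable \<P>"
  by (rule kernel_nn_integral_measurable[OF measurable_time_predictable snd_mem]) measurable

text \<open>
The comparison estimate is applied at each fixed time, and Hypothesis A is used after integration in time.
\<close>
lemma expected_sample_energy:
  "(\<integral>\<^sup>+ p. energy (sample_FT p) \<partial>(P \<Otimes>\<^sub>M time_measure T)) < \<infinity>"
proof -
  have [measurable]: "(\<lambda>p. energy (sample_FT p)) \<in> borel_measurable (P \<Otimes>\<^sub>M time_measure T)"
    by (rule measurable_predictable_pair) measurable
  have m: "(\<lambda>t. energy (FT (\<Gamma> t) (\<lambda>_. 1))) \<in> borel_measurable (time_measure T)"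
  proof -
    have [measurable]: "(\<lambda>t. t) \<in> measurable (time_measure T) borel" by (rule measurable_restrict_space1) simp
    have "(\<lambda>q. FT (\<Gamma> (fst q)) (\<lambda>_. 1) (snd q)) \<in> borel_measurable (time_measure T \<Otimes>\<^sub>M \<mu>)"
      unfolding FT_def
      by (rule kernel_integral_measurable_complex[where \<tau> = fst]) (auto simp: space_pair_measure space_restrict_space case_prod_beta)
    then show ?thesis unfolding energy_def by measurable
  qed
  have "(\<integral>\<^sup>+ p. energy (sample_FT p) \<partial>(P \<Otimes>\<^sub>M time_measure T)) =
        (\<integral>\<^sup>+ r. \<integral>\<^sup>+ \<omega>. energy (sample_FT (\<omega>, r)) \<partial>P \<partial>time_measure T)"
    by (rule nn_integral_snd[symmetric]) measurable
  also have "\<dots> \<le> (\<integral>\<^sup>+ r. K * energy (FT (\<Gamma> r) (\<lambda>_. 1)) \<partial>time_measure T)"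
  proof (rule nn_integral_mono)
    fix r assume "r \<in> space (time_measure T)"
    then have r: "r \<in> {0..T}" by (simp add: space_restrict_space)
    have "(\<integral>\<^sup>+ \<omega>. energy (FT (\<Gamma> r) (sample (\<omega>, r))) \<partial>P) \<le> K * energy (FT (\<Gamma> r) (\<lambda>_. 1))"
      by (rule expected_energy_le[OF P.prob_space_axioms finite_measure_\<Gamma>[OF r] sets_\<Gamma>[OF r] time_section_measurable[OF r]])
         (simp add: sample_def Z_moment[OF r])
    then show "(\<integral>\<^sup>+ \<omega>. energy (sample_FT (\<omega>, r)) \<partial>P) \<le> K * energy (FT (\<Gamma> r) (\<lambda>_. 1))"
      by (simp add: sample_FT_def)
  qed
  also have "\<dots> = K * (\<integral>\<^sup>+ r. energy (FT (\<Gamma> r) (\<lambda>_. 1)) \<partial>time_measure T)"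
    by (rule nn_integral_cmult[OF m])
  also have "\<dots> < \<infinity>" using K_finite \<Gamma>_energy by (simp add: ennreal_mult_less_top)
  finally show ?thesis .
qed

lemma expected_sample_mass:
  "(\<integral>\<^sup>+ p. (\<integral>\<^sup>+ x. ennreal \<bar>sample p x\<bar> \<partial>\<Gamma> (snd p)) \<partial>(P \<Otimes>\<^sub>M time_measure T)) < \<infinity>"
proof -
  have [measurable]: "(\<lambda>p. \<integral>\<^sup>+ x. ennreal \<bar>sample p x\<bar> \<partial>\<Gamma> (snd p)) \<in> borel_measurable (P \<Otimes>\<^sub>M time_measure T)"
    by (rule measurable_predictable_pair) measurable
  have "(\<integral>\<^sup>+ p. (\<integral>\<^sup>+ x. ennreal \<bar>sample p x\<bar> \<partial>\<Gamma> (snd p)) \<partial>(P \<Otimes>\<^sub>M time_measure T)) =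
        (\<integral>\<^sup>+ r. \<integral>\<^sup>+ \<omega>. \<integral>\<^sup>+ x. ennreal \<bar>sample (\<omega>, r) x\<bar> \<partial>\<Gamma> r \<partial>P \<partial>time_measure T)"
    by (subst nn_integral_snd[symmetric]) auto
  also have "\<dots> \<le> (\<integral>\<^sup>+ r. (1 + K) * ennreal C \<partial>time_measure T)"
  proof (rule nn_integral_mono)
    fix r assume "r \<in> space (time_measure T)"
    then have r: "r \<in> {0..T}" by (simp add: space_restrict_space)
    interpret G: finite_measure "\<Gamma> r" by (rule finite_measure_\<Gamma>[OF r])
    interpret PG: pair_sigma_finite P "\<Gamma> r" ..
    note [measurable_cong] = sets_\<Gamma>[OF r]
    note [measurable] = time_section_measurable[OF r]
    have "(\<integral>\<^sup>+ \<omega>. \<integral>\<^sup>+ x. ennreal \<bar>sample (\<omega>, r) x\<bar> \<partial>\<Gamma> r \<partial>P) = (\<integral>\<^sup>+ x. \<integral>\<^sup>+ \<omega>. ennreal \<bar>sample (\<omega>, r) x\<bar> \<partial>P \<partial>\<Gamma> r)"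
      by (rule PG.Fubini'[symmetric]) measurable
    also have "\<dots> \<le> (\<integral>\<^sup>+ x. 1 + K \<partial>\<Gamma> r)"
    proof (rule nn_integral_mono)
      fix x
      have [measurable]: "(\<lambda>\<omega>. sample (\<omega>, r) x) \<in> borel_measurable P"
        using measurable_Pair1[OF time_section_measurable[OF r], of x] by simp
      have "(\<integral>\<^sup>+ \<omega>. ennreal \<bar>sample (\<omega>, r) x\<bar> \<partial>P) \<le> (\<integral>\<^sup>+ \<omega>. 1 + ennreal ((sample (\<omega>, r) x)\<^sup>2) \<partial>P)"
      proof (rule nn_integral_mono)
        fix \<omega>
        have "\<bar>sample (\<omega>, r) x\<bar> \<le> 1 + (sample (\<omega>, r) x)\<^sup>2"
          using sum_squares_bound[of "\<bar>sample (\<omega>, r) x\<bar>" 1] by simp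
        then have "ennreal \<bar>sample (\<omega>, r) x\<bar> \<le> ennreal (1 + (sample (\<omega>, r) x)\<^sup>2)" by (rule ennreal_leI)
        then show "ennreal \<bar>sample (\<omega>, r) x\<bar> \<le> 1 + ennreal ((sample (\<omega>, r) x)\<^sup>2)" by simp
      qed
      also have "\<dots> = 1 + (\<integral>\<^sup>+ \<omega>. ennreal ((sample (\<omega>, r) x)\<^sup>2) \<partial>P)"
        by (subst nn_integral_add) (auto simp: P.emeasure_space_1)
      also have "\<dots> \<le> 1 + K" using Z_moment[OF r, of x] by (intro add_left_mono) (simp add: sample_def)
      finally show "(\<integral>\<^sup>+ \<omega>. ennreal \<bar>sample (\<omega>, r) x\<bar> \<partial>P) \<le> 1 + K" .
    qed
    also have "\<dots> = (1 + K) * emeasure (\<Gamma> r) UNIV" by (simp add: space_\<Gamma>[OF r])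
    also have "\<dots> \<le> (1 + K) * ennreal C" by (intro mult_left_mono mass_le[OF r]) simp
    finally show "(\<integral>\<^sup>+ \<omega>. \<integral>\<^sup>+ x. ennreal \<bar>sample (\<omega>, r) x\<bar> \<partial>\<Gamma> r \<partial>P) \<le> (1 + K) * ennreal C" .
  qed
  also have "\<dots> < \<infinity>"
  proof -
    have "emeasure (time_measure T) {0..T} < top"
      using time.emeasure_finite[of "{0..T}"] by (simp only: less_top infinity_ennreal_def)
    then show ?thesis
      using K_finite by (simp add: space_restrict_space ennreal_mult_less_top ennreal_add_less_top)
  qed
  finally show ?thesis .
qed

text \<open>
The points at which \<open>Z(t,\<cdot>) \<Gamma>(t)\<close> is a finite signed measure with square integrable transform. Being
predictable, this set can be used to set the process to 0 on its complement.
\<close>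
definition good :: "'w \<times> real \<Rightarrow> bool" where
  "good p \<longleftrightarrow> (\<integral>\<^sup>+ x. ennreal \<bar>sample p x\<bar> \<partial>\<Gamma> (snd p)) < \<infinity> \<and> energy (sample_FT p) < \<infinity>"

lemma good_measurable [measurable]: "Measurable.pred \<P> good"
  unfolding good_def by measurable

lemma AE_good: "AE p in P \<Otimes>\<^sub>M time_measure T. good p"
proof -
  have m: "(\<lambda>p. energy (sample_FT p)) \<in> borel_measurable (P \<Otimes>\<^sub>M time_measure T)"
    "(\<lambda>p. \<integral>\<^sup>+ x. ennreal \<bar>sample p x\<bar> \<partial>\<Gamma> (snd p)) \<in> borel_measurable (P \<Otimes>\<^sub>M time_measure T)"
    by (intro measurable_predictable_pair; measurable)+
  have "AE p in P \<Otimes>\<^sub>M time_measure T. energy (sample_FT p) \<noteq> \<infinity>"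
    using expected_sample_energy by (intro nn_integral_PInf_AE m(1)) auto
  moreover have "AE p in P \<Otimes>\<^sub>M time_measure T. (\<integral>\<^sup>+ x. ennreal \<bar>sample p x\<bar> \<partial>\<Gamma> (snd p)) \<noteq> \<infinity>"
    using expected_sample_mass by (intro nn_integral_PInf_AE m(2)) auto
  ultimately show ?thesis by eventually_elim (auto simp: good_def less_top)
qed

lemma good_integrable:
  assumes "p \<in> space \<P>" "good p" shows "integrable (\<Gamma> (snd p)) (sample p)"
  using assms sample_section_measurable_\<Gamma>[of p] by (auto simp: good_def intro!: integrableI_bounded)

lemma cell_mass_measurable:
  assumes s: "simple_function borel s"
  shows "(\<lambda>p. cell_mass (\<Gamma> (snd p)) (sample p) s q) \<in> borel_measurable \<P>"
  unfolding cell_mass_def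
proof (rule kernel_integral_measurable_real[OF measurable_time_predictable snd_mem])
  have [measurable]: "s \<in> borel_measurable borel" using s by (rule borel_measurable_simple_function)
  have [measurable]: "s -` {q} \<in> sets borel"
    using measurable_sets[of s borel borel "{q}"] by simp
  show "(\<lambda>(p, x). indicator (s -` {q}) x * sample p x) \<in> borel_measurable (\<P> \<Otimes>\<^sub>M borel)"
    using sample_measurable unfolding case_prod_beta by measurable
qed

text \<open>
On the set \<open>good\<close> the process is the iterated limit of discretizations. Convergence holds at every point
because the approximations are cut off to 0 outside \<open>good\<close>, and so measurability passes to the limit.
\<close>
lemma exists_spectral_process:
  "\<exists>G. G \<in> borel_measurable \<P> \<and>
       (\<forall>p \<in> space \<P>. good p \<longrightarrow> spectral (G p) (sample_FT p)) \<and> (\<forall>p. \<not> good p \<longrightarrow> G p = 0)"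
proof -
  obtain s :: "nat \<Rightarrow> 'a \<Rightarrow> 'a" where s: "\<And>i. simple_function borel (s i)" "\<And>x. (\<lambda>i. s i x) \<longlonglongrightarrow> x"
    using borel_measurable_implies_sequence_metric[of "\<lambda>x::'a. x" borel 0] by auto
  define \<sigma> :: "nat \<Rightarrow> real" where "\<sigma> n = 1 / real (Suc n)" for n
  have \<sigma>: "\<And>n. 0 < \<sigma> n" "\<sigma> \<longlonglongrightarrow> 0"
    unfolding \<sigma>_def by (simp, rule LIMSEQ_Suc[OF lim_1_over_n])
  define A where "A n i p = (if good p then \<iota> (discretize (s i) (\<sigma> n) (\<Gamma> (snd p)) (sample p)) else 0)" for n i p
  define B where "B n p = lim (\<lambda>i. A n i p)" for n p
  define G where "G p = lim (\<lambda>n. B n p)" for p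
  have A_meas: "A n i \<in> borel_measurable \<P>" for n i
  proof -
    have "A n i = (\<lambda>p. \<Sum>q\<in>range (s i). (if good p then cell_mass (\<Gamma> (snd p)) (sample p) (s i) q else 0) *\<^sub>R \<iota> (\<lambda>y. gauss (\<sigma> n) (y - q)))"
    proof (rule ext)
      fix p
      have "\<iota> (discretize (s i) (\<sigma> n) (\<Gamma> (snd p)) (sample p)) =
          (\<Sum>q\<in>range (s i). cell_mass (\<Gamma> (snd p)) (sample p) (s i) q *\<^sub>R \<iota> (\<lambda>y. gauss (\<sigma> n) (y - q)))"
        unfolding discretize_def[abs_def] by (intro iota_sum schwartz_translate schwartz_gauss \<sigma>)
      then show "A n i p = (\<Sum>q\<in>range (s i). (if good p then cell_mass (\<Gamma> (snd p)) (sample p) (s i) q else 0) *\<^sub>R \<iota> (\<lambda>y. gauss (\<sigma> n) (y - q)))"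
        by (simp add: A_def)
    qed
    moreover have "(\<lambda>p. (\<Sum>q\<in>range (s i). (if good p then cell_mass (\<Gamma> (snd p)) (sample p) (s i) q else 0) *\<^sub>R \<iota> (\<lambda>y. gauss (\<sigma> n) (y - q)))) \<in> borel_measurable \<P>"
    proof (rule borel_measurable_finite_lincomb)
      show "finite (range (s i))" using s(1)[of i] by (simp add: simple_function_def)
      note [measurable] = cell_mass_measurable[OF s(1)]
      show "(\<lambda>p. if good p then cell_mass (\<Gamma> (snd p)) (sample p) (s i) q else 0) \<in> borel_measurable \<P>" for q
        by measurable
    qed
    ultimately show ?thesis by simp
  qed
  have conv: "(\<lambda>i. A n i p) \<longlonglongrightarrow> B n p" "(\<lambda>n. B n p) \<longlonglongrightarrow> G p" "good p \<Longrightarrow> spectral (G p) (sample_FT p)"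
    if p: "p \<in> space \<P>" for n p
  proof -
    have "(\<forall>n. (\<lambda>i. A n i p) \<longlonglongrightarrow> B n p) \<and> (\<lambda>n. B n p) \<longlonglongrightarrow> G p \<and> (good p \<longrightarrow> spectral (G p) (sample_FT p))"
    proof (cases "good p")
      case True
      interpret M: finite_measure "\<Gamma> (snd p)" by (rule finite_measure_\<Gamma>[OF snd_mem[OF p]])
      have fin: "energy (FT (\<Gamma> (snd p)) (sample p)) < \<infinity>" using True by (simp add: good_def sample_FT_def)
      from spectral_discretize_limit[OF \<sigma> s M.sigma_finite_measure_axioms sets_\<Gamma>[OF snd_mem[OF p]] good_integrable[OF p True] fin]
      obtain H h where H: "\<And>n. (\<lambda>i. \<iota> (discretize (s i) (\<sigma> n) (\<Gamma> (snd p)) (sample p))) \<longlonglongrightarrow> H n"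
        "H \<longlonglongrightarrow> h" "spectral h (FT (\<Gamma> (snd p)) (sample p))" by auto
      have A: "(\<lambda>i. A n i p) \<longlonglongrightarrow> H n" for n using H(1) True by (simp add: A_def)
      then have B: "B n p = H n" for n unfolding B_def by (rule limI)
      have "G p = h" unfolding G_def B using H(2) by (rule limI)
      then show ?thesis using A H(2,3) by (simp add: B sample_FT_def)
    next
      case False
      then have "A n i p = 0" for n i by (simp add: A_def)
      then have "B n p = 0" for n by (simp add: B_def lim_const)
      then have "G p = 0" by (simp add: G_def lim_const)
      then show ?thesis using False \<open>\<And>n i. A n i p = 0\<close> \<open>\<And>n. B n p = 0\<close> by simp
    qed
    then show "(\<lambda>i. A n i p) \<longlonglongrightarrow> B n p" "(\<lambda>n. B n p) \<longlonglongrightarrow> G p" "good p \<Longrightarrow> spectral (G p) (sample_FT p)" by auto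
  qed
  have "B n \<in> borel_measurable \<P>" for n
    by (rule borel_measurable_LIMSEQ_metric[OF A_meas conv(1)])
  then have "G \<in> borel_measurable \<P>"
    by (rule borel_measurable_LIMSEQ_metric[OF _ conv(2)])
  moreover have "G p = 0" if "\<not> good p" for p
    using that by (simp add: G_def B_def A_def lim_const)
  ultimately show ?thesis using conv(3) by blast
qed

lemma spectral_process_square_integrable:
  assumes G: "G \<in> borel_measurable \<P>"
    and sp: "\<And>p. p \<in> space \<P> \<Longrightarrow> good p \<Longrightarrow> spectral (G p) (sample_FT p)" and G0: "\<And>p. \<not> good p \<Longrightarrow> G p = 0"
  shows "square_integrable (P \<Otimes>\<^sub>M time_measure T) G"
  unfolding square_integrable_def
proof
  show m: "G \<in> borel_measurable (P \<Otimes>\<^sub>M time_measure T)" by (rule measurable_predictable_pair[OF G])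
  show "integrable (P \<Otimes>\<^sub>M time_measure T) (\<lambda>p. (norm (G p))\<^sup>2)"
  proof (rule integrableI_bounded)
    show "(\<lambda>p. (norm (G p))\<^sup>2) \<in> borel_measurable (P \<Otimes>\<^sub>M time_measure T)"
      using measurable_compose[OF m borel_measurable_norm] by (rule borel_measurable_power)
    have [measurable]: "(\<lambda>p. energy (sample_FT p)) \<in> borel_measurable (P \<Otimes>\<^sub>M time_measure T)"
      by (rule measurable_predictable_pair) measurable
    have "(\<integral>\<^sup>+ p. ennreal (norm ((norm (G p))\<^sup>2)) \<partial>(P \<Otimes>\<^sub>M time_measure T)) \<le>
          (\<integral>\<^sup>+ p. 2 * energy (sample_FT p) \<partial>(P \<Otimes>\<^sub>M time_measure T))"
    proof (rule nn_integral_mono)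
      fix p assume "p \<in> space (P \<Otimes>\<^sub>M time_measure T)"
      then have p: "p \<in> space \<P>" by (simp add: space_pair space_predictable)
      show "ennreal (norm ((norm (G p))\<^sup>2)) \<le> 2 * energy (sample_FT p)"
        using spectral_norm_le[OF sp[OF p]] G0[of p] by (cases "good p") auto
    qed
    also have "\<dots> < \<infinity>"
      using expected_sample_energy by (subst nn_integral_cmult) (auto simp: ennreal_mult_less_top)
    finally show "(\<integral>\<^sup>+ p. ennreal (norm ((norm (G p))\<^sup>2)) \<partial>(P \<Otimes>\<^sub>M time_measure T)) < \<infinity>" .
  qed
qed

definition pairing :: "('a \<Rightarrow> real) \<Rightarrow> 'w \<times> real \<Rightarrow> real" where
  "pairing \<phi> p = (LINT x|\<Gamma> (snd p). sample p x * conv f \<phi> x)"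

lemma pairing_measurable: "schwartz \<phi> \<Longrightarrow> pairing \<phi> \<in> borel_measurable \<P>"
  unfolding pairing_def[abs_def]
  by (rule kernel_integral_measurable_real[OF measurable_time_predictable snd_mem])
     (use sample_measurable in \<open>simp_all add: case_prod_beta\<close>)

lemma spectral_inner_eq_pairing:
  assumes p: "p \<in> space \<P>" "good p" and sp: "spectral h (sample_FT p)" and \<phi>: "schwartz \<phi>"
  shows "h \<bullet> \<iota> \<phi> = pairing \<phi> p"
proof -
  interpret M: finite_measure "\<Gamma> (snd p)" by (rule finite_measure_\<Gamma>[OF snd_mem[OF p(1)]])
  have "h \<bullet> \<iota> \<phi> = Re (LINT \<xi>|\<mu>. sample_FT p \<xi> * cnj (FT lborel \<phi> \<xi>))"
    using p(2) by (intro spectral_inner_iota[OF sp _ \<phi>]) (simp add: good_def)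
  also have "\<dots> = pairing \<phi> p"
    unfolding sample_FT_def pairing_def
    by (rule pairing_eq_FT[symmetric, OF M.sigma_finite_measure_axioms sets_\<Gamma>[OF snd_mem[OF p(1)]] good_integrable[OF p] \<phi>])
  finally show ?thesis .
qed

lemma set_integral_time:
  fixes u :: "real \<Rightarrow> real"
  assumes "0 \<le> s" "t \<le> T"
  shows "(LINT r:{s..t}|lborel. u r) = (LINT r|time_measure T. indicator {s..t} r * u r)"
  unfolding set_lebesgue_integral_def
  by (subst integral_restrict_space) (use assms in \<open>auto intro!: Bochner_Integration.integral_cong simp: indicator_def\<close>)

text \<open>
The inner products agree for almost every \<open>(\<omega>,r)\<close>, so integrating over time and over any
event preserves the identity.
\<close>
lemma spectral_process_represents:
  assumes G: "G \<in> borel_measurable \<P>"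
    and sp: "\<And>p. p \<in> space \<P> \<Longrightarrow> good p \<Longrightarrow> spectral (G p) (sample_FT p)"
  shows "represents_G P \<F> T f \<iota> \<Gamma> Z G"
  unfolding represents_G_def
proof (intro allI impI)
  fix \<phi> :: "'a \<Rightarrow> real" and s t :: real and B
  assume \<phi>: "schwartz \<phi>" and s: "0 \<le> s" "s < t" "t \<le> T" and B: "B \<in> sets (\<F> s)"
  have [measurable]: "B \<in> sets P" using B filtration_sub by blast
  define u where "u p = G p \<bullet> \<iota> \<phi>" for p
  have "(\<lambda>h. h \<bullet> \<iota> \<phi>) \<in> borel_measurable borel" by (intro borel_measurable_continuous_onI continuous_intros)
  from measurable_compose[OF G this]
  have u_meas: "u \<in> borel_measurable (P \<Otimes>\<^sub>M time_measure T)"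
    unfolding u_def[abs_def] by (rule measurable_predictable_pair)
  note v_meas = measurable_predictable_pair[OF pairing_measurable[OF \<phi>]]
  have i_meas: "(indicator {s..t} :: real \<Rightarrow> real) \<in> borel_measurable (time_measure T)"
    by (intro measurable_restrict_space1) simp
  note [measurable] = u_meas v_meas i_meas
  have "AE p in P \<Otimes>\<^sub>M time_measure T. u p = pairing \<phi> p"
  proof (rule AE_mp[OF AE_good AE_I2], rule impI)
    fix p assume "p \<in> space (P \<Otimes>\<^sub>M time_measure T)" "good p"
    then show "u p = pairing \<phi> p"
      unfolding u_def by (intro spectral_inner_eq_pairing sp \<phi>) (simp_all add: space_pair space_predictable)
  qed
  then have ae: "AE \<omega> in P. AE r in time_measure T. u (\<omega>, r) = pairing \<phi> (\<omega>, r)" by (rule AE_pair)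
  have "(LINT \<omega>|P. indicator B \<omega> * (LINT r:{s..t}|lborel. u (\<omega>, r))) =
        (LINT \<omega>|P. indicator B \<omega> * (LINT r:{s..t}|lborel. pairing \<phi> (\<omega>, r)))"
    unfolding set_integral_time[OF s(1) s(3)]
  proof (rule integral_cong_AE)
    show "AE \<omega> in P. indicator B \<omega> * (LINT r|time_measure T. indicator {s..t} r * u (\<omega>, r)) =
        indicator B \<omega> * (LINT r|time_measure T. indicator {s..t} r * pairing \<phi> (\<omega>, r))"
      using ae AE_space
    proof eventually_elim
      fix \<omega> assume w: "AE r in time_measure T. u (\<omega>, r) = pairing \<phi> (\<omega>, r)" "\<omega> \<in> space P"
      note [measurable] = measurable_Pair2[OF u_meas w(2)] measurable_Pair2[OF v_meas w(2)]
      have "(LINT r|time_measure T. indicator {s..t} r * u (\<omega>, r)) =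
            (LINT r|time_measure T. indicator {s..t} r * pairing \<phi> (\<omega>, r))"
        by (rule integral_cong_AE) (measurable, use w(1) in auto)
      then show "indicator B \<omega> * (LINT r|time_measure T. indicator {s..t} r * u (\<omega>, r)) =
        indicator B \<omega> * (LINT r|time_measure T. indicator {s..t} r * pairing \<phi> (\<omega>, r))" by simp
    qed
  qed measurable
  moreover have "pairing \<phi> (\<omega>, r) = (LINT x|\<Gamma> r. LINT y|lborel. Z r x \<omega> * f (x - y) * \<phi> y)" for \<omega> r
    by (simp add: pairing_def sample_def conv_def mult.assoc)
  ultimately show "(LINT \<omega>|P. indicator B \<omega> * (LINT r:{s..t}|lborel. G (\<omega>, r) \<bullet> \<iota> \<phi>)) =
        (LINT \<omega>|P. indicator B \<omega> *
           (LINT r:{s..t}|lborel. (LINT x|\<Gamma> r. LINT y|lborel. Z r x \<omega> * f (x - y) * \<phi> y)))"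
    by (simp add: u_def)
qed

theorem exists_predictable_representative:
  "\<exists>G :: 'w \<times> real \<Rightarrow> 'h. G \<in> borel_measurable \<P> \<and>
     square_integrable (P \<Otimes>\<^sub>M time_measure T) G \<and> represents_G P \<F> T f \<iota> \<Gamma> Z G"
proof -
  obtain G where G: "G \<in> borel_measurable \<P>"
    "\<And>p. p \<in> space \<P> \<Longrightarrow> good p \<Longrightarrow> spectral (G p) (sample_FT p)" "\<And>p. \<not> good p \<Longrightarrow> G p = 0"
    using exists_spectral_process by blast
  show ?thesis
    using G(1) spectral_process_square_integrable[OF G] spectral_process_represents[OF G(1,2)] by blast
qed

end

theorem proposition3p3:
  fixes f :: "'a::euclidean_space \<Rightarrow> real"
    and \<mu> :: "'a measure"
    and \<iota> :: "('a \<Rightarrow> real) \<Rightarrow> 'h::{real_inner,complete_space}"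
    and P :: "'w measure"
    and W :: "(real \<times> 'a \<Rightarrow> real) \<Rightarrow> 'w \<Rightarrow> real"
    and W\<^sub>T :: "(real \<Rightarrow> 'h) \<Rightarrow> 'w \<Rightarrow> real"
    and \<F> :: "real \<Rightarrow> 'w measure"
    and a :: "real \<times> 'a \<Rightarrow> real \<times> 'a \<Rightarrow> real \<times> 'a \<Rightarrow> real"
    and b :: "real \<times> 'a \<Rightarrow> real \<times> 'a \<Rightarrow> real"
    and c :: "real \<times> 'a \<Rightarrow> real"
    and \<Gamma> :: "real \<Rightarrow> 'a measure"
    and Z :: "real \<Rightarrow> 'a \<Rightarrow> 'w \<Rightarrow> real"
    and T :: real
  assumes "spatial_covariance f \<mu>"
    and "schwartz_completion f \<iota>"
    and "prob_space P" and "complete_measure P"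
    and "gaussian_noise P f W"
    and "T > 0"
    and "noise_extension P T \<iota> W W\<^sub>T"
    and "\<F> = noise_filtration P W\<^sub>T"
    and "hypothesis_A a b c \<mu> \<Gamma>"
    and "predictable_field P \<F> T Z"
    and "(SUP (t, x)\<in>{0..T} \<times> UNIV. \<integral>\<^sup>+ \<omega>. ennreal (\<bar>Z t x \<omega>\<bar>\<^sup>2) \<partial>P) < \<infinity>"
  shows "\<exists>G :: 'w \<times> real \<Rightarrow> 'h.
           G \<in> borel_measurable (predictable_sigma P \<F> T) \<and>
           square_integrable (P \<Otimes>\<^sub>M time_measure T) G \<and>
           represents_G P \<F> T f \<iota> \<Gamma> Z G"
proof -
  interpret prob_space P by fact
  interpret spectral_completion f \<mu> \<iota> by unfold_locales fact+
  define K where "K = (SUP (t, x)\<in>{0..T} \<times> UNIV. \<integral>\<^sup>+ \<omega>. ennreal (\<bar>Z t x \<omega>\<bar>\<^sup>2) \<partial>P)"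
  have gf: "centered_gaussian_family P (Collect (square_integrable (time_measure T))) W\<^sub>T"
    using assms(7) by (simp add: noise_extension_def)
  have A: "time_kernel \<Gamma>" "(SUP t\<in>{0..T}. emeasure (\<Gamma> t) UNIV) < \<infinity>"
    "(\<integral>\<^sup>+ t\<in>{0..T}. (\<integral>\<^sup>+ \<xi>. ennreal ((cmod (fourier_measure (\<Gamma> t) \<xi>))\<^sup>2) \<partial>\<mu>) \<partial>lborel) < \<infinity>"
    using assms(9) \<open>T > 0\<close> by (auto simp: hypothesis_A_def)
  define C where "C = enn2real (SUP t\<in>{0..T}. emeasure (\<Gamma> t) UNIV) + 1"
  have C: "(SUP t\<in>{0..T}. emeasure (\<Gamma> t) UNIV) \<le> ennreal C"
  proof -
    have "(SUP t\<in>{0..T}. emeasure (\<Gamma> t) UNIV) = ennreal (enn2real (SUP t\<in>{0..T}. emeasure (\<Gamma> t) UNIV))"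
      using A(2) by simp
    also have "\<dots> \<le> ennreal C" unfolding C_def by (intro ennreal_leI) simp
    finally show ?thesis .
  qed
  interpret walsh_integrand f \<mu> \<iota> \<Gamma> T C P \<F> Z K
  proof unfold_locales
    show "time_kernel \<Gamma>" by (rule A)
    show "0 < C" by (simp add: C_def add_nonneg_pos)
    show "emeasure (\<Gamma> t) UNIV \<le> ennreal C" if "t \<in> {0..T}" for t
      using order_trans[OF SUP_upper[OF that] C] .
    show "0 < T" "predictable_field P \<F> T Z" by fact+
    show "sets (\<F> s) \<subseteq> sets P" "space P \<in> sets (\<F> s)" for s
      using noise_filtration_subset[OF gf] by (simp_all add: assms(8))
    show "K < \<infinity>" unfolding K_def by (rule assms(11))
    show "(\<integral>\<^sup>+ \<omega>. ennreal ((Z t x \<omega>)\<^sup>2) \<partial>P) \<le> K" if "t \<in> {0..T}" for t x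
      unfolding K_def using that by (intro SUP_upper2[of "(t, x)"]) auto
    show "(\<integral>\<^sup>+ t. energy (FT (\<Gamma> t) (\<lambda>_. 1)) \<partial>time_measure T) < \<infinity>"
      using A(3) by (simp add: nn_integral_restrict_space energy_def fourier_measure_eq_FT)
  qed
  show ?thesis by (rule exists_predictable_representative)
qed

end
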